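(* Let $G$ be a finitely presented group, let $p$ be a prime and suppose that $G \geq G_1 \triangleright G_2 \triangleright \dots$ is a nested sequence of finite index subgroups of $G$ such that each $G_{i+1}$ is normal in $G_i$ and has index a power of $p$ in $G_i$. Suppose that $\{G_i\}$ has linear growth of mod $p$ homology. Then at least one of the following must hold: (i) some $G_i$ admits a surjective homomorphism onto $(\mathbb{Z}/p\mathbb{Z}) \ast (\mathbb{Z}/p\mathbb{Z})$, and some normal subgroup of $G_i$, with index a power of $p$, admits a surjective homomorphism onto a non-abelian free group; in particular, $G$ is large; (ii) $G$ has Property $(\tau)$ with respect to $\{G_i\}$.
   Context: For a group $H$ and prime $p$, $d_p(H)$ denotes the dimension of $H_1(H;\mathbb{F}_p)$ over the field $\mathbb{F}_p$ of order $p$. A collection $\{G_i\}$ of finite index subgroups of $G$ has linear growth of mod $p$ homology if $\inf_i d_p(G_i)/[G:G_i] > 0$. A group is large if it has a finite index subgroup that admits a surjective homomorphism onto a non-abelian free group. Property $(\tau)$: for a finite graph $X$ with vertex set $V(X)$ (loops and multiple edges allowed) and $A \subset V(X)$, $\partial A$ is the set of edges with one endpoint in $A$ and one not in $A$. The Cheeger constant is $h(X) = \min\{|\partial A|/|A| : A \subset V(X),\ 0<|A|\leq |V(X)|/2\}$ (a one-vertex graph is given $h=+\infty$). For a finite generating set $S$ of $G$ and a finite index subgroup $G_i$, $X(G/G_i;S)$ is the Schreier coset graph: vertices are the right cosets $G_i g$, with one edge from $G_i g$ to $G_i g s$ for each coset and each $s\in S$. A finitely generated group $G$ has Property $(\tau)$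 with respect to a collection $\{G_i\}$ of finite index subgroups if $\inf_i h(X(G/G_i;S))>0$ for some (equivalently, any) finite generating set $S$ of $G$. *)

theory Defs
  imports
    "HOL-Algebra.Generated_Groups"
    "HOL-Algebra.Elementary_Groups"
    "HOL-Number_Theory.Residues"
    "HOL-Library.Extended_Real"
    "Jordan_Normal_Form.Missing_VectorSpace"
    "Graph_Theory.Digraph"
begin

section \<open>Free groups, free products, presentations\<close>

text \<open>The least congruence on the free monoid \<open>lists A\<close> containing the pairs in \<open>R\<close>.\<close>

inductive_set word_cong :: "'x set \<Rightarrow> ('x list \<times> 'x list) set \<Rightarrow> ('x list \<times> 'x list) set"
  for A R where
  rel: "\<lbrakk>(l, r) \<in> R; l \<in> lists A; r \<in> lists A; u \<in> lists A; v \<in> lists A\<rbrakk>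
          \<Longrightarrow> (u @ l @ v, u @ r @ v) \<in> word_cong A R"
| refl: "w \<in> lists A \<Longrightarrow> (w, w) \<in> word_cong A R"
| sym: "(v, w) \<in> word_cong A R \<Longrightarrow> (w, v) \<in> word_cong A R"
| trans: "\<lbrakk>(u, v) \<in> word_cong A R; (v, w) \<in> word_cong A R\<rbrakk> \<Longrightarrow> (u, w) \<in> word_cong A R"

definition word_quotient :: "'x set \<Rightarrow> ('x list \<times> 'x list) set \<Rightarrow> 'x list set monoid" where
  "word_quotient A R =
     \<lparr>carrier = lists A // word_cong A R,
      monoid.mult = (\<lambda>C D. \<Union>u\<in>C. \<Union>v\<in>D. word_cong A R `` {u @ v}),
      one = word_cong A R `` {[]}\<rparr>"

text \<open>The letter \<open>(x, True)\<close> stands for \<open>x\<close> and \<open>(x, False)\<close> for its inverse.\<close>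

definition free_group :: "'x set \<Rightarrow> ('x \<times> bool) list set monoid" where
  "free_group X = word_quotient (X \<times> UNIV) {([(x, b), (x, \<not> b)], []) | x b. x \<in> X}"

definition free_product ::
    "('a, 'c) monoid_scheme \<Rightarrow> ('b, 'd) monoid_scheme \<Rightarrow> ('a + 'b) list set monoid" where
  "free_product G H = word_quotient (Inl ` carrier G \<union> Inr ` carrier H)
     ({([Inl x, Inl y], [Inl (x \<otimes>\<^bsub>G\<^esub> y)]) | x y. x \<in> carrier G \<and> y \<in> carrier G}
      \<union> {([Inr x, Inr y], [Inr (x \<otimes>\<^bsub>H\<^esub> y)]) | x y. x \<in> carrier H \<and> y \<in> carrier H}
      \<union> {([Inl \<one>\<^bsub>G\<^esub>], []), ([Inr \<one>\<^bsub>H\<^esub>], [])})"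

definition normal_closure :: "('a, 'b) monoid_scheme \<Rightarrow> 'a set \<Rightarrow> 'a set" where
  "normal_closure G R = \<Inter>{N. N \<lhd> G \<and> R \<subseteq> N}"

definition finitely_presented :: "('a, 'b) monoid_scheme \<Rightarrow> bool" where
  "finitely_presented G \<longleftrightarrow>
     (\<exists>(X :: nat set) R. finite X \<and> finite R \<and> R \<subseteq> carrier (free_group X) \<and>
        G \<cong> free_group X Mod normal_closure (free_group X) R)"

text \<open>
  Bases in \<open>nat\<close> give all free groups of countable rank. Uncountable rank adds nothing here,
  since every free group of rank at least two maps onto the one of rank two.
\<close>

definition onto_nonabelian_free :: "('a, 'b) monoid_scheme \<Rightarrow> bool" where
  "onto_nonabelian_free G \<longleftrightarrow>
     (\<exists>X :: nat set. \<not> comm_group (free_group X) \<and> epi G (free_group X) \<noteq> {})"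

definition large :: "('a, 'b) monoid_scheme \<Rightarrow> bool" where
  "large G \<longleftrightarrow>
     (\<exists>H. subgroup H G \<and> finite (rcosets\<^bsub>G\<^esub> H) \<and> onto_nonabelian_free (G\<lparr>carrier := H\<rparr>))"


section \<open>First homology of a group\<close>

text \<open>
  The inhomogeneous bar complex with trivial coefficients in a ring \<open>K\<close>: an \<open>n\<close>-chain is a
  finitely supported function on \<open>n\<close>-tuples of group elements, the tuples being lists.
  The \<open>mult\<close> and \<open>one\<close> fields of modules carry no meaning.
\<close>

definition bar_chains :: "('r, 'm) ring_scheme \<Rightarrow> ('g, 'b) monoid_scheme \<Rightarrow> nat
    \<Rightarrow> ('r, 'g list \<Rightarrow> 'r) module" where
  "bar_chains K G n =
     \<lparr>carrier = {c. range c \<subseteq> carrier K \<and> finite {w. c w \<noteq> \<zero>\<^bsub>K\<^esub>} \<and>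
                    {w. c w \<noteq> \<zero>\<^bsub>K\<^esub>} \<subseteq> {w \<in> lists (carrier G). length w = n}},
      monoid.mult = (\<lambda>c d w. \<zero>\<^bsub>K\<^esub>), one = (\<lambda>w. \<zero>\<^bsub>K\<^esub>),
      zero = (\<lambda>w. \<zero>\<^bsub>K\<^esub>), add = (\<lambda>c d w. c w \<oplus>\<^bsub>K\<^esub> d w),
      smult = (\<lambda>a c w. a \<otimes>\<^bsub>K\<^esub> c w)\<rparr>"

definition bar_face :: "('g, 'b) monoid_scheme \<Rightarrow> nat \<Rightarrow> 'g list \<Rightarrow> 'g list" where
  "bar_face G i w =
     (if i = 0 then tl w
      else if i = length w then butlast w
      else take (i - 1) w @ [w ! (i - 1) \<otimes>\<^bsub>G\<^esub> w ! i] @ drop (i + 1) w)"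

text \<open>
  For \<open>n \<ge> 1\<close>, the linear map from \<open>n\<close>-chains to \<open>(n - 1)\<close>-chains with
  \<open>[g\<^sub>1, \<dots>, g\<^sub>n] \<mapsto> (\<Sum>i\<le>n. (-1)\<^sup>i d\<^sub>i [g\<^sub>1, \<dots>, g\<^sub>n])\<close>, where \<open>d\<^sub>i\<close> is the \<open>i\<close>-th face.
\<close>

definition bar_boundary :: "('r, 'm) ring_scheme \<Rightarrow> ('g, 'b) monoid_scheme \<Rightarrow> nat
    \<Rightarrow> ('g list \<Rightarrow> 'r) \<Rightarrow> ('g list \<Rightarrow> 'r)" where
  "bar_boundary K G n c = (\<lambda>v.
     finsum K (\<lambda>(w, i). ((\<ominus>\<^bsub>K\<^esub> \<one>\<^bsub>K\<^esub>) [^]\<^bsub>K\<^esub> i) \<otimes>\<^bsub>K\<^esub> c w)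
       {(w, i). c w \<noteq> \<zero>\<^bsub>K\<^esub> \<and> i \<le> n \<and> bar_face G i w = v})"

text \<open>In the scalar multiple of a coset the summand \<open>N\<close> matters only for the scalar zero.\<close>

definition quotient_module :: "('r, 'v, 'm) module_scheme \<Rightarrow> 'v set \<Rightarrow> ('r, 'v set) module" where
  "quotient_module M N =
     \<lparr>carrier = a_rcosets\<^bsub>M\<^esub> N,
      monoid.mult = (\<lambda>C D. N), one = N,
      zero = N, add = (\<lambda>C D. C <+>\<^bsub>M\<^esub> D),
      smult = (\<lambda>a C. N <+>\<^bsub>M\<^esub> (\<lambda>v. a \<odot>\<^bsub>M\<^esub> v) ` C)\<rparr>"

definition group_homology_1 :: "('r, 'm) ring_scheme \<Rightarrow> ('g, 'b) monoid_scheme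
    \<Rightarrow> ('r, ('g list \<Rightarrow> 'r) set) module" where
  "group_homology_1 K G =
     (let Z = {c \<in> carrier (bar_chains K G 1). bar_boundary K G 1 c = \<zero>\<^bsub>bar_chains K G 0\<^esub>};
          B = bar_boundary K G 2 ` carrier (bar_chains K G 2)
      in quotient_module ((bar_chains K G 1)\<lparr>carrier := Z\<rparr>) B)"

text \<open>\<open>vectorspace.dim\<close> is meaningful only in finite dimension, e.g. for finitely generated groups.\<close>

definition dim_H1_mod :: "nat \<Rightarrow> ('g, 'b) monoid_scheme \<Rightarrow> nat" where
  "dim_H1_mod p G =
     vectorspace.dim (residue_ring (int p)) (group_homology_1 (residue_ring (int p)) G)"

definition linear_growth_mod_homology ::
    "nat \<Rightarrow> ('g, 'b) monoid_scheme \<Rightarrow> 'g set set \<Rightarrow> bool" where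
  "linear_growth_mod_homology p G \<H> \<longleftrightarrow>
     (INF H\<in>\<H>. real (dim_H1_mod p (G\<lparr>carrier := H\<rparr>)) / real (card (rcosets\<^bsub>G\<^esub> H))) > 0"


section \<open>Property \<open>(\<tau>)\<close>\<close>

text \<open>A digraph is read as an undirected multigraph by forgetting the direction of its arcs.\<close>

definition edge_boundary :: "('v, 'e) pre_digraph \<Rightarrow> 'v set \<Rightarrow> 'e set" where
  "edge_boundary X A = {e \<in> arcs X. (tail X e \<in> A) \<noteq> (head X e \<in> A)}"

text \<open>For a one-vertex graph the infimum is over the empty set, hence \<open>\<infinity>\<close>.\<close>

definition cheeger :: "('v, 'e) pre_digraph \<Rightarrow> ereal" where
  "cheeger X =
     (INF A \<in> {A. A \<subseteq> verts X \<and> 0 < card A \<and> real (card A) \<le> real (card (verts X)) / 2}.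
        ereal (real (card (edge_boundary X A)) / real (card A)))"

definition schreier_graph :: "('g, 'b) monoid_scheme \<Rightarrow> 'g set \<Rightarrow> 'g set
    \<Rightarrow> ('g set, 'g set \<times> 'g) pre_digraph" where
  "schreier_graph G H S =
     \<lparr>verts = rcosets\<^bsub>G\<^esub> H, arcs = (rcosets\<^bsub>G\<^esub> H) \<times> S,
      tail = fst, head = (\<lambda>(C, s). C #>\<^bsub>G\<^esub> s)\<rparr>"

definition property_tau :: "('g, 'b) monoid_scheme \<Rightarrow> 'g set set \<Rightarrow> bool" where
  "property_tau G \<H> \<longleftrightarrow>
     (\<exists>S. finite S \<and> S \<subseteq> carrier G \<and> generate G S = carrier G \<and>
        (INF H\<in>\<H>. cheeger (schreier_graph G H S)) > 0)"

end

theory Submission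
  imports Defs "HOL-Algebra.Bij" "HOL-Algebra.Group_Action" "HOL-Algebra.Sylow"
    "HOL-Algebra.Multiplicative_Group"
begin

text \<open>
  If property \<open>(\<tau>)\<close> fails, then the coset graphs of the \<open>G\<^sub>j\<close> have Cheeger constants tending
  to zero along a subsequence. A minimising vertex set \<open>D\<close> of maximal size has more than a
  quarter of the vertices whenever the Cheeger constant drops at step \<open>j\<close>: otherwise submodularity
  of the boundary makes \<open>D\<close> invariant under the deck group, and \<open>D\<close> descends to the previous graph.
  So \<open>D\<close> and its complement both have at most three quarters of the vertices, and the boundary
  of \<open>D\<close> is negligible.

  Homomorphisms \<open>\<alpha>\<close> from \<open>G\<^sub>j\<close> to \<open>\<int>/p\<close> are cocycles on the edges of the coset graph. Let
  \<open>e\<^sub>k\<close> be the dimension of the space of these for \<open>G\<^sub>k\<close>, and take \<open>i\<close> such that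
  \<open>e\<^sub>i / [G : G\<^sub>i]\<close> nearly attains the infimum of these ratios, which is positive by linear growth.
  Since \<open>G\<^sub>j\<close> is reached from \<open>G\<^sub>i\<close> by normal steps of \<open>p\<close>-power index, \<open>\<alpha>\<close> is determined by its
  values on the lifts of \<open>e\<^sub>i\<close> elements of \<open>G\<^sub>i\<close>; an \<open>\<alpha>\<close> supported on \<open>D\<close>, or on the complement,
  only needs the lifts starting there. Hence the space of such \<open>\<alpha>\<close> has dimension at most about
  \<open>3/4 \<cdot> e\<^sub>i [G\<^sub>i : G\<^sub>j]\<close>, which is less than \<open>e\<^sub>j\<close> by a definite proportion.

  So there are many \<open>\<alpha>\<close> which vanish near the boundary of \<open>D\<close> but neither inside nor outside
  \<open>D\<close>. As no path of a relator sees both sides, the values inside and outside \<open>D\<close> may be sent to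
  the two factors of \<open>\<int>/p * \<int>/p\<close>. With two such homomorphisms, independent inside \<open>D\<close>, the same
  cut applied to a wreath product with a free group yields a normal subgroup of index a power of
  \<open>p\<close> that maps onto a non-abelian free group.
\<close>

section \<open>Words\<close>

text \<open>The bound of about three quarters does not follow from the size of \<open>D\<close>
  alone. The lifts in question start only at cosets contained in \<open>G\<^sub>i\<close>, and
  \<open>D\<close> might contain a larger share of these than of all cosets. The remedy is to make
  \<open>D\<close> almost invariant under a transversal of \<open>G\<^sub>i\<close> as well: its
  translates spread the cosets inside \<open>G\<^sub>i\<close> evenly over the whole graph.
  Everything that \<open>D\<close> has to respect (relators, transversal, words of the lifted
  elements) forms one finite set depending on \<open>i\<close> only, so the tolerance for the
  boundary is fixed before \<open>j\<close> is chosen.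

  A quarter is the threshold for \<open>D\<close> because the union of two sets of that size has at
  most half of the vertices and still competes for the Cheeger constant. With \<open>b\<close> the
  infimum of the ratios, \<open>i\<close> is taken within a factor 9/8 of \<open>b\<close>; as 9/8
  times 3/4 is 27/32, a share 5/32 of \<open>b\<close> is left, of which 1/32 pays for the boundary.
  A reserve of two dimensions allows a homomorphism to be chosen outside a union of two subspaces,
  and another outside a subspace enlarged by a line.\<close>

definition eval_word :: "('g, 'c) monoid_scheme \<Rightarrow> ('x \<Rightarrow> 'g) \<Rightarrow> 'x list \<Rightarrow> 'g" where
  "eval_word P e w = foldr (\<lambda>a y. e a \<otimes>\<^bsub>P\<^esub> y) w \<one>\<^bsub>P\<^esub>"

lemma eval_word_Nil [simp]: "eval_word P e [] = \<one>\<^bsub>P\<^esub>"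
  and eval_word_Cons [simp]: "eval_word P e (a # w) = e a \<otimes>\<^bsub>P\<^esub> eval_word P e w"
  by (simp_all add: eval_word_def)

lemma (in monoid) eval_word_closed [simp]:
  "e \<in> A \<rightarrow> carrier G \<Longrightarrow> w \<in> lists A \<Longrightarrow> eval_word G e w \<in> carrier G"
  by (induction w) auto

lemma (in monoid) eval_word_append:
  "e \<in> A \<rightarrow> carrier G \<Longrightarrow> u \<in> lists A \<Longrightarrow> v \<in> lists A \<Longrightarrow>
    eval_word G e (u @ v) = eval_word G e u \<otimes> eval_word G e v"
  by (induction u) (auto simp: m_assoc Pi_iff)

lemma (in monoid) eval_word_in_submonoid:
  "\<one> \<in> H \<Longrightarrow> (\<And>x y. x \<in> H \<Longrightarrow> y \<in> H \<Longrightarrow> x \<otimes> y \<in> H) \<Longrightarrow> e \<in> A \<rightarrow> H \<Longrightarrow> w \<in> lists A \<Longrightarrow>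
    eval_word G e w \<in> H"
  by (induction w) auto

lemma eval_word_hom:
  assumes "monoid P" "monoid Q" "h \<in> hom P Q" "h \<one>\<^bsub>P\<^esub> = \<one>\<^bsub>Q\<^esub>" "e \<in> A \<rightarrow> carrier P" "w \<in> lists A"
  shows "h (eval_word P e w) = eval_word Q (h \<circ> e) w"
  using assms(6)
  by (induction w) (use assms in \<open>auto simp: hom_mult[OF assms(3)] monoid.eval_word_closed Pi_iff\<close>)

lemma word_cong_lists: "(u, v) \<in> word_cong A R \<Longrightarrow> u \<in> lists A \<and> v \<in> lists A"
  by (induction rule: word_cong.induct) auto

lemma word_cong_append_context:
  "(u, v) \<in> word_cong A R \<Longrightarrow> a \<in> lists A \<Longrightarrow> b \<in> lists A \<Longrightarrow> (a @ u @ b, a @ v @ b) \<in> word_cong A R"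
proof (induction rule: word_cong.induct)
  case (rel l r u v)
  then show ?case using word_cong.rel[of l r R A "a @ u" "v @ b"] by simp
next
  case (refl w)
  then show ?case by (intro word_cong.refl) auto
qed (blast intro: word_cong.sym word_cong.trans)+

lemma word_cong_append:
  assumes "(u, u') \<in> word_cong A R" "(v, v') \<in> word_cong A R"
  shows "(u @ v, u' @ v') \<in> word_cong A R"
proof -
  have "(u @ v, u' @ v) \<in> word_cong A R"
    using word_cong_append_context[of u u' A R "[]" v] word_cong_lists[OF assms(2)] assms(1) by simp
  moreover have "(u' @ v, u' @ v') \<in> word_cong A R"
    using word_cong_append_context[of v v' A R u' "[]"] word_cong_lists[OF assms(1)] assms(2) by simp
  ultimately show ?thesis by (rule word_cong.trans)
qed

lemma equiv_word_cong: "equiv (lists A) (word_cong A R)"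
  unfolding equiv_def refl_on_def sym_def trans_def
  by (auto intro: word_cong.intros dest: word_cong_lists)

lemma eval_word_cong:
  assumes "monoid P" "e \<in> A \<rightarrow> carrier P"
    and "\<And>l r. (l, r) \<in> R \<Longrightarrow> l \<in> lists A \<Longrightarrow> r \<in> lists A \<Longrightarrow> eval_word P e l = eval_word P e r"
    and "(u, v) \<in> word_cong A R"
  shows "eval_word P e u = eval_word P e v"
  using assms(4)
proof (induction rule: word_cong.induct)
  case (rel l r u v)
  then show ?case using monoid.eval_word_append[OF assms(1,2)] assms(3) by simp
qed auto

abbreviation word_class :: "'x set \<Rightarrow> ('x list \<times> 'x list) set \<Rightarrow> 'x list \<Rightarrow> 'x list set" where
  "word_class A R w \<equiv> word_cong A R `` {w}"

lemma word_class_eq_iff: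
  "u \<in> lists A \<Longrightarrow> v \<in> lists A \<Longrightarrow> word_class A R u = word_class A R v \<longleftrightarrow> (u, v) \<in> word_cong A R"
  using eq_equiv_class_iff[OF equiv_word_cong] .

lemma carrier_word_quotient: "carrier (word_quotient A R) = word_class A R ` lists A"
  by (auto simp: word_quotient_def quotient_def)

lemma one_word_quotient: "\<one>\<^bsub>word_quotient A R\<^esub> = word_class A R []"
  by (simp add: word_quotient_def)

lemma mult_word_quotient:
  assumes "u \<in> lists A" "v \<in> lists A"
  shows "word_class A R u \<otimes>\<^bsub>word_quotient A R\<^esub> word_class A R v = word_class A R (u @ v)"
proof -
  have *: "word_class A R (u' @ v') = word_class A R (u @ v)"
    if "u' \<in> word_class A R u" "v' \<in> word_class A R v" for u' v'
  proof -
    have "(u @ v, u' @ v') \<in> word_cong A R"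
      using that by (intro word_cong_append) (simp_all only: Image_singleton_iff)
    then show ?thesis by (rule equiv_class_eq[OF equiv_word_cong, symmetric])
  qed
  have u: "u \<in> word_class A R u" and v: "v \<in> word_class A R v"
    using word_cong.refl assms by (simp_all only: Image_singleton_iff)
  have "word_class A R u \<otimes>\<^bsub>word_quotient A R\<^esub> word_class A R v =
      (\<Union>u'\<in>word_class A R u. \<Union>v'\<in>word_class A R v. word_class A R (u' @ v'))"
    by (simp only: word_quotient_def monoid.simps)
  also have "\<dots> = word_class A R (u @ v)"
    using * u v by blast
  finally show ?thesis .
qed

text \<open>Left inverses of single letters are enough: the inverse of a word is the reversed
  product of inverses of its letters. For a free product the inverse of a letter is a letter of the
  same factor, for a free group the letter of opposite sign.\<close>

lemma group_word_quotient:
  assumes "\<And>a. a \<in> A \<Longrightarrow> \<exists>a'\<in>lists A. (a' @ [a], []) \<in> word_cong A R"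
  shows "group (word_quotient A R)"
proof (rule groupI)
  have inv: "\<exists>w'\<in>lists A. (w' @ w, []) \<in> word_cong A R" if "w \<in> lists A" for w
    using that
  proof (induction w)
    case Nil
    show ?case by (rule bexI[of _ "[]"]) (simp_all add: word_cong.refl)
  next
    case (Cons a w)
    note aw = Cons.hyps
    obtain w' where w': "w' \<in> lists A" "(w' @ w, []) \<in> word_cong A R"
      using Cons.IH by blast
    obtain a' where a': "a' \<in> lists A" "(a' @ [a], []) \<in> word_cong A R"
      using assms[OF aw(1)] by blast
    have "(w' @ (a' @ [a]) @ w, w' @ [] @ w) \<in> word_cong A R"
      by (rule word_cong_append_context[OF a'(2) w'(1)]) (rule aw(2))
    then have "(w' @ (a' @ [a]) @ w, w' @ w) \<in> word_cong A R" by (simp only: append_Nil)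
    from word_cong.trans[OF this w'(2)] have "((w' @ a') @ a # w, []) \<in> word_cong A R" by simp
    then show ?case by (rule bexI[of _ "w' @ a'"]) (use a'(1) w'(1) in simp)
  qed
  fix x assume "x \<in> carrier (word_quotient A R)"
  then obtain w where w: "w \<in> lists A" "x = word_class A R w" by (auto simp: carrier_word_quotient)
  obtain w' where w': "w' \<in> lists A" "(w' @ w, []) \<in> word_cong A R" using inv[OF w(1)] by blast
  then show "\<exists>y\<in>carrier (word_quotient A R). y \<otimes>\<^bsub>word_quotient A R\<^esub> x = \<one>\<^bsub>word_quotient A R\<^esub>"
  proof (intro bexI)
    have "w' @ w \<in> lists A" using w w' by simp
    then show "word_class A R w' \<otimes>\<^bsub>word_quotient A R\<^esub> x = \<one>\<^bsub>word_quotient A R\<^esub>"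
      unfolding w(2) mult_word_quotient[OF w'(1) w(1)] one_word_quotient
      using w'(2) word_class_eq_iff[of "w' @ w" A "[]" R] by blast
    show "word_class A R w' \<in> carrier (word_quotient A R)"
      unfolding carrier_word_quotient by (rule imageI[OF w'(1)])
  qed
next
  show "\<one>\<^bsub>word_quotient A R\<^esub> \<in> carrier (word_quotient A R)"
    unfolding carrier_word_quotient one_word_quotient by (intro imageI) simp
next
  fix x y assume "x \<in> carrier (word_quotient A R)" "y \<in> carrier (word_quotient A R)"
  then obtain u v where uv: "u \<in> lists A" "x = word_class A R u" "v \<in> lists A" "y = word_class A R v"
    unfolding carrier_word_quotient by blast
  have uv': "u @ v \<in> lists A" using uv by simp
  show "x \<otimes>\<^bsub>word_quotient A R\<^esub> y \<in> carrier (word_quotient A R)"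
    unfolding carrier_word_quotient uv(2,4) mult_word_quotient[OF uv(1,3)] by (rule imageI[OF uv'])
  show "\<one>\<^bsub>word_quotient A R\<^esub> \<otimes>\<^bsub>word_quotient A R\<^esub> x = x"
    unfolding one_word_quotient uv(2) mult_word_quotient[OF lists.Nil uv(1)] by simp
  fix z assume "z \<in> carrier (word_quotient A R)"
  then obtain w where w: "w \<in> lists A" "z = word_class A R w"
    unfolding carrier_word_quotient by blast
  have vw: "v @ w \<in> lists A" using uv w by simp
  show "(x \<otimes>\<^bsub>word_quotient A R\<^esub> y) \<otimes>\<^bsub>word_quotient A R\<^esub> z = x \<otimes>\<^bsub>word_quotient A R\<^esub> (y \<otimes>\<^bsub>word_quotient A R\<^esub> z)"
    unfolding uv(2,4) w(2) mult_word_quotient[OF uv(1,3)] mult_word_quotient[OF uv(3) w(1)]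
      mult_word_quotient[OF uv' w(1)] mult_word_quotient[OF uv(1) vw] by simp
qed

lemma word_class_eval:
  assumes "w \<in> lists A"
  shows "word_class A R w = eval_word (word_quotient A R) (\<lambda>a. word_class A R [a]) w"
  using assms
proof (induction w)
  case (Cons a w)
  then show ?case using mult_word_quotient[of "[a]" A w R] by simp
qed (simp add: one_word_quotient)


section \<open>Free groups and finitely presented groups\<close>

abbreviation free_alphabet :: "'x set \<Rightarrow> ('x \<times> bool) set" where
  "free_alphabet X \<equiv> X \<times> UNIV"

definition free_relations :: "'x set \<Rightarrow> (('x \<times> bool) list \<times> ('x \<times> bool) list) set" where
  "free_relations X = {([(x, b), (x, \<not> b)], []) | x b. x \<in> X}"

abbreviation free_class :: "'x set \<Rightarrow> ('x \<times> bool) list \<Rightarrow> ('x \<times> bool) list set" where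
  "free_class X \<equiv> word_class (free_alphabet X) (free_relations X)"

lemma free_group_eq: "free_group X = word_quotient (free_alphabet X) (free_relations X)"
  by (simp add: free_group_def free_relations_def)

lemma group_free_group: "group (free_group X)"
  unfolding free_group_eq
proof (rule group_word_quotient)
  fix a assume "a \<in> free_alphabet X"
  then obtain x b where a: "a = (x, b)" "x \<in> X" by auto
  have "([(x, \<not> b), (x, b)], []) \<in> free_relations X" using a(2) by (force simp: free_relations_def)
  then have "([] @ [(x, \<not> b), (x, b)] @ [], [] @ [] @ []) \<in> word_cong (free_alphabet X) (free_relations X)"
    by (rule word_cong.rel) (use a in auto)
  then show "\<exists>a'\<in>lists (free_alphabet X). (a' @ [a], []) \<in> word_cong (free_alphabet X) (free_relations X)"
    using a by (intro bexI[of _ "[(x, \<not> b)]"]) auto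
qed

definition signed :: "('g, 'c) monoid_scheme \<Rightarrow> ('x \<Rightarrow> 'g) \<Rightarrow> 'x \<times> bool \<Rightarrow> 'g" where
  "signed P c = (\<lambda>(x, b). if b then c x else inv\<^bsub>P\<^esub> c x)"

lemma (in group) signed_closed: "c \<in> X \<rightarrow> carrier G \<Longrightarrow> signed G c \<in> free_alphabet X \<rightarrow> carrier G"
  by (auto simp: signed_def Pi_iff)

lemma (in group) eval_signed_relation:
  "c \<in> X \<rightarrow> carrier G \<Longrightarrow> (l, r) \<in> free_relations X \<Longrightarrow>
    eval_word G (signed G c) l = eval_word G (signed G c) r"
  by (auto simp: signed_def Pi_iff free_relations_def)

lemma (in group) eval_signed_cong:
  "c \<in> X \<rightarrow> carrier G \<Longrightarrow> (u, v) \<in> word_cong (free_alphabet X) (free_relations X) \<Longrightarrow>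
    eval_word G (signed G c) u = eval_word G (signed G c) v"
  by (rule eval_word_cong[OF is_monoid signed_closed eval_signed_relation])

definition free_lift :: "('g, 'c) monoid_scheme \<Rightarrow> ('x \<Rightarrow> 'g) \<Rightarrow> ('x \<times> bool) list set \<Rightarrow> 'g" where
  "free_lift P c C = eval_word P (signed P c) (SOME w. w \<in> C)"

lemma (in group) free_lift_class:
  assumes "c \<in> X \<rightarrow> carrier G" "w \<in> lists (free_alphabet X)"
  shows "free_lift G c (free_class X w) = eval_word G (signed G c) w"
proof -
  have "w \<in> free_class X w" using assms by (auto intro: word_cong.refl)
  then have "(SOME v. v \<in> free_class X w) \<in> free_class X w" by (rule someI)
  then show ?thesis
    unfolding free_lift_def using eval_signed_cong[OF assms(1)] by (metis Image_singleton_iff)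
qed

lemma (in group) free_lift_hom:
  assumes "c \<in> X \<rightarrow> carrier G"
  shows "free_lift G c \<in> hom (free_group X) G"
proof (rule homI)
  fix C assume "C \<in> carrier (free_group X)"
  then obtain u where u: "u \<in> lists (free_alphabet X)" "C = free_class X u"
    unfolding free_group_eq carrier_word_quotient by blast
  show "free_lift G c C \<in> carrier G"
    using free_lift_class[OF assms u(1)] eval_word_closed[OF signed_closed[OF assms] u(1)] u(2) by simp
  fix D assume "D \<in> carrier (free_group X)"
  then obtain v where v: "v \<in> lists (free_alphabet X)" "D = free_class X v"
    unfolding free_group_eq carrier_word_quotient by blast
  have "u @ v \<in> lists (free_alphabet X)" using u v by simp
  then show "free_lift G c (C \<otimes>\<^bsub>free_group X\<^esub> D) = free_lift G c C \<otimes> free_lift G c D"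
    using free_lift_class[OF assms] eval_word_append[OF signed_closed[OF assms]] u v
    by (simp add: free_group_eq mult_word_quotient del: append_in_lists_conv in_lists_conv_set)
qed

text \<open>A presentation with explicit generators \<open>c\<close>. Relators are words rather than
  elements of the free group, because later arguments follow the prefixes of a relator through a
  coset graph and prefixes are lost in classes. The last two clauses say that the kernel of
  evaluation is the normal closure of \<open>R\<close>.\<close>

definition presents :: "('g, 'c) monoid_scheme \<Rightarrow> 'x set \<Rightarrow> ('x \<Rightarrow> 'g) \<Rightarrow> ('x \<times> bool) list set \<Rightarrow> bool" where
  "presents G X c R \<longleftrightarrow> c \<in> X \<rightarrow> carrier G \<and> R \<subseteq> lists (free_alphabet X) \<and>
     eval_word G (signed G c) ` lists (free_alphabet X) = carrier G \<and>
     (\<forall>r\<in>R. eval_word G (signed G c) r = \<one>\<^bsub>G\<^esub>) \<and>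
     (\<forall>w\<in>lists (free_alphabet X). eval_word G (signed G c) w = \<one>\<^bsub>G\<^esub> \<longrightarrow>
        free_class X w \<in> normal_closure (free_group X) (free_class X ` R))"

lemma normal_closure_normal:
  fixes G (structure)
  assumes "group G" "R \<subseteq> carrier G"
  shows "normal_closure G R \<lhd> G"
proof -
  interpret group G by fact
  have "carrier G \<in> {N. N \<lhd> G \<and> R \<subseteq> N}" using assms normal_self by simp
  then have ne: "{N. N \<lhd> G \<and> R \<subseteq> N} \<noteq> {}" by blast
  show ?thesis
    unfolding normal_closure_def
  proof (subst normal_inv_iff, intro conjI ballI)
    show "subgroup (\<Inter> {N. N \<lhd> G \<and> R \<subseteq> N}) G"
      by (rule subgroups_Inter) (use ne in \<open>auto dest: normal_imp_subgroup\<close>)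
  next
    fix x h assume "x \<in> carrier G" "h \<in> \<Inter> {N. N \<lhd> G \<and> R \<subseteq> N}"
    then show "x \<otimes> h \<otimes> inv x \<in> \<Inter> {N. N \<lhd> G \<and> R \<subseteq> N}"
      using normal_inv_iff by auto
  qed
qed

lemma normal_closure_minimal: "N \<lhd> G \<Longrightarrow> R \<subseteq> N \<Longrightarrow> normal_closure G R \<subseteq> N"
  by (auto simp: normal_closure_def)

lemma normal_closure_superset: "R \<subseteq> normal_closure G R"
  by (auto simp: normal_closure_def)

lemma presents_exists:
  assumes G: "group G" and fp: "finitely_presented G"
  obtains X :: "nat set" and c R where "finite X" "finite R" "presents G X c R"
proof -
  obtain X :: "nat set" and R where X: "finite X" "finite R" "R \<subseteq> carrier (free_group X)"
    "G \<cong> free_group X Mod normal_closure (free_group X) R"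
    using fp unfolding finitely_presented_def by blast
  let ?F = "free_group X" and ?A = "free_alphabet X"
  interpret F: group ?F by (rule group_free_group)
  interpret G: group G by (rule G)
  let ?N = "normal_closure ?F R"
  interpret N: normal ?N ?F by (rule normal_closure_normal[OF F.is_group X(3)])
  interpret Q: group "?F Mod ?N" by (rule N.factorgroup_is_group)
  obtain f where f: "f \<in> iso (?F Mod ?N) G"
    using X(4) G.iso_sym unfolding is_iso_def by blast
  define k where "k = f \<circ> (\<lambda>x. ?N #>\<^bsub>?F\<^esub> x)"
  have k: "k \<in> hom ?F G"
    unfolding k_def using hom_compose[OF N.r_coset_hom_Mod] f by (auto simp: iso_def)
  interpret k: group_hom ?F G k
    by unfold_locales (rule k)
  interpret f: group_hom "?F Mod ?N" G f
    by unfold_locales (use f in \<open>auto simp: iso_def\<close>)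
  have kN: "k x = \<one>\<^bsub>G\<^esub> \<longleftrightarrow> x \<in> ?N" if "x \<in> carrier ?F" for x
  proof -
    have c: "?N #>\<^bsub>?F\<^esub> x \<in> carrier (?F Mod ?N)" using that by (auto simp: carrier_FactGroup)
    have "k x = \<one>\<^bsub>G\<^esub> \<longleftrightarrow> ?N #>\<^bsub>?F\<^esub> x = ?N"
      using f.iso_iff f c f.hom_one unfolding k_def by (auto simp: one_FactGroup)
    also have "\<dots> \<longleftrightarrow> x \<in> ?N"
      using F.coset_join1 F.coset_join2 N.subgroup_axioms that N.subset by metis
    finally show ?thesis .
  qed
  define c where "c x = k (free_class X [(x, True)])" for x
  \<comment> \<open>One word is chosen in each given class, so \<open>R'\<close> is finite and its
    classes are again \<open>R\<close>.\<close>
  define R' where "R' = (\<lambda>C. SOME w. w \<in> lists ?A \<and> free_class X w = C) ` R"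
  have R': "w \<in> lists ?A \<and> free_class X w = C"
    if "C \<in> R" "w = (SOME w. w \<in> lists ?A \<and> free_class X w = C)" for C w
  proof -
    have "\<exists>w. w \<in> lists ?A \<and> free_class X w = C"
      using X(3) that(1) by (auto simp: free_group_eq carrier_word_quotient)
    from someI_ex[OF this] that(2) show ?thesis by simp
  qed
  have clR: "free_class X ` R' = R"
    unfolding R'_def image_image using R' by (simp cong: image_cong)
  have car: "free_class X w \<in> carrier ?F" if "w \<in> lists ?A" for w
    using that by (auto simp: free_group_eq carrier_word_quotient)
  have cc: "c \<in> X \<rightarrow> carrier G"
    by (auto simp: c_def intro!: k.hom_closed car)
  have sg: "signed G c (x, b) = k (free_class X [(x, b)])" if "x \<in> X" for x b
  proof (cases b)
    case False
    have "([] @ [(x, False), (x, True)] @ [], [] @ [] @ []) \<in> word_cong ?A (free_relations X)"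
      by (rule word_cong.rel) (use that in \<open>auto simp: free_relations_def\<close>)
    then have "free_class X [(x, False)] \<otimes>\<^bsub>?F\<^esub> free_class X [(x, True)] = \<one>\<^bsub>?F\<^esub>"
      using that by (simp add: free_group_eq mult_word_quotient one_word_quotient word_class_eq_iff)
    then have "inv\<^bsub>?F\<^esub> (free_class X [(x, True)]) = free_class X [(x, False)]"
      using F.inv_equality car that by auto
    then show ?thesis using False that car by (simp add: signed_def c_def flip: k.hom_inv)
  qed (simp add: signed_def c_def)
  have ev: "eval_word G (signed G c) w = k (free_class X w)" if w: "w \<in> lists ?A" for w
  proof -
    have "k (eval_word ?F (\<lambda>a. free_class X [a]) w) = eval_word G (k \<circ> (\<lambda>a. free_class X [a])) w"
      by (rule eval_word_hom[where A = ?A]) (use w car in \<open>auto intro: k\<close>)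
    also have "\<dots> = eval_word G (signed G c) w"
      using w by (induction w) (auto simp: sg)
    finally show ?thesis using word_class_eval[OF w, of "free_relations X"] by (simp add: free_group_eq)
  qed
  have kim: "k ` carrier ?F = carrier G"
  proof -
    have "f ` carrier (?F Mod ?N) = carrier G" using f by (auto simp: iso_def bij_betw_def)
    then show ?thesis by (simp add: k_def carrier_FactGroup image_comp)
  qed
  have "presents G X c R'"
    unfolding presents_def
  proof (intro conjI ballI impI)
    show "R' \<subseteq> lists ?A" using R' unfolding R'_def by blast
    have "eval_word G (signed G c) ` lists ?A = k ` free_class X ` lists ?A"
      unfolding image_image by (rule image_cong) (auto simp: ev)
    then show "eval_word G (signed G c) ` lists ?A = carrier G"
      using kim by (simp add: free_group_eq carrier_word_quotient)
    show "eval_word G (signed G c) r = \<one>\<^bsub>G\<^esub>" if "r \<in> R'" for r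
    proof -
      have "r \<in> lists ?A" using that R' unfolding R'_def by blast
      moreover have "free_class X r \<in> ?N"
        using that clR normal_closure_superset[of R ?F] by blast
      ultimately show ?thesis using ev[of r] kN[OF car[of r]] by simp
    qed
    show "free_class X w \<in> normal_closure ?F (free_class X ` R')"
      if "w \<in> lists ?A" "eval_word G (signed G c) w = \<one>\<^bsub>G\<^esub>" for w
      using ev[OF that(1)] kN[OF car[OF that(1)]] clR that(2) by simp
  qed (use cc in auto)
  then show ?thesis using that X R'_def by blast
qed

definition inv_word :: "('x \<times> bool) list \<Rightarrow> ('x \<times> bool) list" where
  "inv_word w = rev (map (\<lambda>(x, b). (x, \<not> b)) w)"

lemma inv_word_lists: "w \<in> lists (free_alphabet X) \<Longrightarrow> inv_word w \<in> lists (free_alphabet X)"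
  by (auto simp: inv_word_def in_lists_conv_set)

lemma (in group) eval_inv_word:
  assumes "c \<in> X \<rightarrow> carrier G" "w \<in> lists (free_alphabet X)"
  shows "eval_word G (signed G c) (inv_word w) = inv (eval_word G (signed G c) w)"
  using assms(2)
proof (induction w)
  case (Cons a w)
  obtain x b where a: "a = (x, b)" "x \<in> X" using Cons by auto
  have "eval_word G (signed G c) (inv_word w @ [(x, \<not> b)]) =
     eval_word G (signed G c) (inv_word w) \<otimes> eval_word G (signed G c) [(x, \<not> b)]"
    by (rule eval_word_append[OF signed_closed[OF assms(1)]]) (use Cons a inv_word_lists in auto)
  moreover have "inv_word (a # w) = inv_word w @ [(x, \<not> b)]" by (simp add: a inv_word_def)
  moreover have cx: "c x \<in> carrier G" using a assms by auto
  moreover have "eval_word G (signed G c) w \<in> carrier G"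
    using Cons by (intro eval_word_closed[OF signed_closed[OF assms(1)]]) auto
  ultimately show ?case
    using Cons a by (cases b) (auto simp: signed_def inv_mult_group)
qed (simp add: inv_word_def)

text \<open>Von Dyck's theorem: the kernel of the induced map on the free group is normal and
  contains the relators, hence contains every word trivial in \<open>G\<close>. Applied to
  \<open>u @ inv_word v\<close>, this shows that evaluation in \<open>P\<close> depends only on the
  value in \<open>G\<close>.\<close>

lemma presents_universal:
  assumes "presents G X c R" "group G" "group P" "d \<in> X \<rightarrow> carrier P"
    and "\<And>r. r \<in> R \<Longrightarrow> eval_word P (signed P d) r = \<one>\<^bsub>P\<^esub>"
  obtains h where "h \<in> hom G P"
    "\<And>w. w \<in> lists (free_alphabet X) \<Longrightarrow> h (eval_word G (signed G c) w) = eval_word P (signed P d) w"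
proof -
  interpret G: group G by fact
  interpret P: group P by fact
  interpret F: group "free_group X" by (rule group_free_group)
  let ?A = "free_alphabet X" and ?eG = "eval_word G (signed G c)" and ?eP = "eval_word P (signed P d)"
  have c: "c \<in> X \<rightarrow> carrier G" and R: "R \<subseteq> lists ?A" and im: "?eG ` lists ?A = carrier G"
    and pk: "\<forall>w\<in>lists ?A. ?eG w = \<one>\<^bsub>G\<^esub> \<longrightarrow> free_class X w \<in> normal_closure (free_group X) (free_class X ` R)"
    using assms(1)[unfolded presents_def] by blast+
  have l: "group_hom (free_group X) P (free_lift P d)"
    by (intro group_hom.intro group_hom_axioms.intro group_free_group assms(3) P.free_lift_hom[OF assms(4)])
  have nc: "normal_closure (free_group X) (free_class X ` R) \<subseteq> kernel (free_group X) P (free_lift P d)"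
  proof (rule normal_closure_minimal[OF group_hom.normal_kernel[OF l]], rule image_subsetI)
    fix r assume r: "r \<in> R"
    then have rA: "r \<in> lists ?A" using R by blast
    have "free_class X r \<in> carrier (free_group X)"
      unfolding free_group_eq carrier_word_quotient by (rule imageI[OF rA])
    then show "free_class X r \<in> kernel (free_group X) P (free_lift P d)"
      unfolding kernel_def using P.free_lift_class[OF assms(4) rA] assms(5)[OF r] by simp
  qed
  have ker: "?eP w = \<one>\<^bsub>P\<^esub>" if "w \<in> lists ?A" "?eG w = \<one>\<^bsub>G\<^esub>" for w

  proof -
    have "free_class X w \<in> kernel (free_group X) P (free_lift P d)"
      using pk[rule_format, OF that] nc by (rule subsetD[rotated])
    then show ?thesis using P.free_lift_class[OF assms(4) that(1)] by (simp add: kernel_def)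
  qed
  note Gapp = G.eval_word_append[OF G.signed_closed[OF c]] and Papp = P.eval_word_append[OF P.signed_closed[OF assms(4)]]
  note Gcl = G.eval_word_closed[OF G.signed_closed[OF c]] and Pcl = P.eval_word_closed[OF P.signed_closed[OF assms(4)]]
  have wd: "?eP u = ?eP v" if "u \<in> lists ?A" "v \<in> lists ?A" "?eG u = ?eG v" for u v
  proof -
    note v' = inv_word_lists[OF that(2)]
    have uv: "u @ inv_word v \<in> lists ?A" using that(1) v' by simp
    have "?eG (u @ inv_word v) = \<one>\<^bsub>G\<^esub>"
      by (simp only: Gapp[OF that(1) v'] G.eval_inv_word[OF c that(2)] that(3) G.r_inv[OF Gcl[OF that(2)]])
    from ker[OF uv this] have "?eP u \<otimes>\<^bsub>P\<^esub> inv\<^bsub>P\<^esub> ?eP v = \<one>\<^bsub>P\<^esub>"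
      by (simp only: Papp[OF that(1) v'] P.eval_inv_word[OF assms(4) that(2)])
    from P.inv_equality[OF this P.inv_closed[OF Pcl[OF that(2)]] Pcl[OF that(1)]]
    show ?thesis by (simp only: P.inv_inv[OF Pcl[OF that(2)]])
  qed
  define h where "h g = ?eP (SOME w. w \<in> lists ?A \<and> ?eG w = g)" for g
  have h: "h (?eG w) = ?eP w" if "w \<in> lists ?A" for w
  proof -
    have "(SOME v. v \<in> lists ?A \<and> ?eG v = ?eG w) \<in> lists ?A \<and> ?eG (SOME v. v \<in> lists ?A \<and> ?eG v = ?eG w) = ?eG w"
      by (rule someI[of _ w]) (use that in simp)
    then show ?thesis unfolding h_def using wd[OF _ that] by blast
  qed
  have "h \<in> hom G P"
  proof (rule homI)
    fix x assume "x \<in> carrier G"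
    then obtain u where u: "u \<in> lists ?A" "x = ?eG u" using im by blast
    show "h x \<in> carrier P" unfolding u(2) h[OF u(1)] by (rule Pcl[OF u(1)])
    fix y assume "y \<in> carrier G"
    then obtain v where v: "v \<in> lists ?A" "y = ?eG v" using im by blast
    from u v have uv: "u @ v \<in> lists ?A" by simp
    show "h (x \<otimes>\<^bsub>G\<^esub> y) = h x \<otimes>\<^bsub>P\<^esub> h y"
      unfolding u(2) v(2) h[OF u(1)] h[OF v(1)] Gapp[OF u(1) v(1), symmetric] Papp[OF u(1) v(1), symmetric]
      by (rule h[OF uv])
  qed
  with h show ?thesis using that by blast
qed

section \<open>Free products\<close>

definition prod_alphabet :: "('a, 'c) monoid_scheme \<Rightarrow> ('b, 'd) monoid_scheme \<Rightarrow> ('a + 'b) set" where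
  "prod_alphabet G H = Inl ` carrier G \<union> Inr ` carrier H"

definition prod_relations ::
    "('a, 'c) monoid_scheme \<Rightarrow> ('b, 'd) monoid_scheme \<Rightarrow> (('a + 'b) list \<times> ('a + 'b) list) set" where
  "prod_relations G H =
     {([Inl x, Inl y], [Inl (x \<otimes>\<^bsub>G\<^esub> y)]) | x y. x \<in> carrier G \<and> y \<in> carrier G}
      \<union> {([Inr x, Inr y], [Inr (x \<otimes>\<^bsub>H\<^esub> y)]) | x y. x \<in> carrier H \<and> y \<in> carrier H}
      \<union> {([Inl \<one>\<^bsub>G\<^esub>], []), ([Inr \<one>\<^bsub>H\<^esub>], [])}"

lemma free_product_eq: "free_product G H = word_quotient (prod_alphabet G H) (prod_relations G H)"
  by (simp add: free_product_def prod_alphabet_def prod_relations_def)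

abbreviation prod_letter ::
    "('a, 'c) monoid_scheme \<Rightarrow> ('b, 'd) monoid_scheme \<Rightarrow> 'a + 'b \<Rightarrow> ('a + 'b) list set" where
  "prod_letter G H a \<equiv> word_class (prod_alphabet G H) (prod_relations G H) [a]"

lemma word_cong_relI:
  "(l, r) \<in> R \<Longrightarrow> l \<in> lists A \<Longrightarrow> r \<in> lists A \<Longrightarrow> (l, r) \<in> word_cong A R"
  using word_cong.rel[of l r R A "[]" "[]"] by simp

context
  fixes G :: "('a, 'c) monoid_scheme" and H :: "('b, 'd) monoid_scheme"
  assumes G: "group G" and H: "group H"
begin

interpretation G: group G by (rule G)
interpretation H: group H by (rule H)

lemma prod_alphabet_simps:
  "Inl x \<in> prod_alphabet G H \<longleftrightarrow> x \<in> carrier G" "Inr y \<in> prod_alphabet G H \<longleftrightarrow> y \<in> carrier H"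
  by (auto simp: prod_alphabet_def)

lemma group_free_product: "group (free_product G H)"
  unfolding free_product_eq
proof (rule group_word_quotient)
  let ?C = "word_cong (prod_alphabet G H) (prod_relations G H)"
  fix a assume "a \<in> prod_alphabet G H"
  then consider x where "x \<in> carrier G" "a = Inl x" | y where "y \<in> carrier H" "a = Inr y"
    by (auto simp: prod_alphabet_def)
  then show "\<exists>a'\<in>lists (prod_alphabet G H). (a' @ [a], []) \<in> ?C"
  proof cases
    case 1
    have "([Inl (inv\<^bsub>G\<^esub> x), Inl x], [Inl (inv\<^bsub>G\<^esub> x \<otimes>\<^bsub>G\<^esub> x)]) \<in> ?C"
      by (rule word_cong_relI) (use 1 in \<open>simp_all add: prod_alphabet_simps prod_relations_def\<close>)
    moreover have "([Inl \<one>\<^bsub>G\<^esub>], []) \<in> ?C"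
      by (rule word_cong_relI) (use 1 in \<open>simp_all add: prod_alphabet_simps prod_relations_def\<close>)
    ultimately have "([Inl (inv\<^bsub>G\<^esub> x)] @ [a], []) \<in> ?C"
      using 1 by (simp add: word_cong.trans)
    then show ?thesis by (rule bexI) (use 1 in \<open>simp add: prod_alphabet_simps\<close>)
  next
    case 2
    have "([Inr (inv\<^bsub>H\<^esub> y), Inr y], [Inr (inv\<^bsub>H\<^esub> y \<otimes>\<^bsub>H\<^esub> y)]) \<in> ?C"
      by (rule word_cong_relI) (use 2 in \<open>simp_all add: prod_alphabet_simps prod_relations_def\<close>)
    moreover have "([Inr \<one>\<^bsub>H\<^esub>], []) \<in> ?C"
      by (rule word_cong_relI) (use 2 in \<open>simp_all add: prod_alphabet_simps prod_relations_def\<close>)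
    ultimately have "([Inr (inv\<^bsub>H\<^esub> y)] @ [a], []) \<in> ?C"
      using 2 by (simp add: word_cong.trans)
    then show ?thesis by (rule bexI) (use 2 in \<open>simp add: prod_alphabet_simps\<close>)
  qed
qed

lemma prod_letter_closed:
  "a \<in> prod_alphabet G H \<Longrightarrow> prod_letter G H a \<in> carrier (free_product G H)"
  unfolding free_product_eq carrier_word_quotient by (rule imageI) simp

lemma inl_hom: "(\<lambda>x. prod_letter G H (Inl x)) \<in> hom G (free_product G H)"
proof (rule homI)
  fix x y assume xy: "x \<in> carrier G" "y \<in> carrier G"
  have "([Inl x, Inl y], [Inl (x \<otimes>\<^bsub>G\<^esub> y)]) \<in> word_cong (prod_alphabet G H) (prod_relations G H)"
    by (rule word_cong_relI) (use xy in \<open>auto simp add: prod_alphabet_simps prod_relations_def\<close>)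
  then show "prod_letter G H (Inl (x \<otimes>\<^bsub>G\<^esub> y)) =
      prod_letter G H (Inl x) \<otimes>\<^bsub>free_product G H\<^esub> prod_letter G H (Inl y)"
    using xy unfolding free_product_eq
    by (simp add: mult_word_quotient prod_alphabet_simps equiv_class_eq[OF equiv_word_cong])
qed (simp add: prod_letter_closed prod_alphabet_simps)

lemma inr_hom: "(\<lambda>x. prod_letter G H (Inr x)) \<in> hom H (free_product G H)"
proof (rule homI)
  fix x y assume xy: "x \<in> carrier H" "y \<in> carrier H"
  have "([Inr x, Inr y], [Inr (x \<otimes>\<^bsub>H\<^esub> y)]) \<in> word_cong (prod_alphabet G H) (prod_relations G H)"
    by (rule word_cong_relI) (use xy in \<open>auto simp add: prod_alphabet_simps prod_relations_def\<close>)
  then show "prod_letter G H (Inr (x \<otimes>\<^bsub>H\<^esub> y)) =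
      prod_letter G H (Inr x) \<otimes>\<^bsub>free_product G H\<^esub> prod_letter G H (Inr y)"
    using xy unfolding free_product_eq
    by (simp add: mult_word_quotient prod_alphabet_simps equiv_class_eq[OF equiv_word_cong])
qed (simp add: prod_letter_closed prod_alphabet_simps)

end

text \<open>This reduces surjectivity onto a free group or a free product to hitting the
  letters.\<close>

lemma word_quotient_subgroup_eq:
  assumes "subgroup K (word_quotient A R)" "\<And>a. a \<in> A \<Longrightarrow> word_class A R [a] \<in> K"
  shows "K = carrier (word_quotient A R)"
proof
  show "K \<subseteq> carrier (word_quotient A R)" by (rule subgroup.subset[OF assms(1)])
  have "word_class A R w \<in> K" if "w \<in> lists A" for w
    using that
  proof (induction w)
    case Nil
    show ?case using subgroup.one_closed[OF assms(1)] by (simp only: one_word_quotient)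
  next
    case (Cons a w)
    have "word_class A R [a] \<otimes>\<^bsub>word_quotient A R\<^esub> word_class A R w \<in> K"
      by (rule subgroup.m_closed[OF assms(1) assms(2)]) (use Cons in auto)
    moreover have "[a] \<in> lists A" "w \<in> lists A" using Cons by auto
    ultimately show ?case by (simp add: mult_word_quotient)
  qed
  then show "carrier (word_quotient A R) \<subseteq> K" unfolding carrier_word_quotient by blast
qed

lemma free_group_subgroup_eq:
  assumes "subgroup K (free_group X)" "\<And>x. x \<in> X \<Longrightarrow> free_class X [(x, True)] \<in> K"
  shows "K = carrier (free_group X)"
  unfolding free_group_eq
proof (rule word_quotient_subgroup_eq)
  show "subgroup K (word_quotient (free_alphabet X) (free_relations X))"
    using assms(1) by (simp only: free_group_eq)
  fix a assume "a \<in> free_alphabet X"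
  then obtain x b where a: "a = (x, b)" "x \<in> X" by auto
  interpret F: group "free_group X" by (rule group_free_group)
  show "free_class X [a] \<in> K"
  proof (cases b)
    case False
    have "([(x, False), (x, True)], []) \<in> word_cong (free_alphabet X) (free_relations X)"
      by (rule word_cong_relI) (use a in \<open>auto simp: free_relations_def\<close>)
    from equiv_class_eq[OF equiv_word_cong this]
    have "free_class X [(x, False)] \<otimes>\<^bsub>free_group X\<^esub> free_class X [(x, True)] = \<one>\<^bsub>free_group X\<^esub>"
      unfolding free_group_eq one_word_quotient using a by (simp add: mult_word_quotient)
    moreover have cl: "free_class X [(x, b)] \<in> carrier (free_group X)" for b
      unfolding free_group_eq carrier_word_quotient by (rule imageI) (use a in simp)
    ultimately have "inv\<^bsub>free_group X\<^esub> (free_class X [(x, True)]) = free_class X [(x, False)]"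
      by (intro F.inv_equality cl)
    then show ?thesis
      using subgroup.m_inv_closed[OF assms(1) assms(2)[OF a(2)]] a False by simp
  qed (use a assms in simp)
qed

section \<open>Wreath products and cocycles\<close>

text \<open>Actions are on the right to match right cosets: a word read from left to right then
  traces a path in the coset graph.\<close>

locale right_action = group G for G (structure) +
  fixes V :: "'v set" and act :: "'v \<Rightarrow> 'a \<Rightarrow> 'v"
  assumes act_closed [simp]: "v \<in> V \<Longrightarrow> g \<in> carrier G \<Longrightarrow> act v g \<in> V"
    and act_one [simp]: "v \<in> V \<Longrightarrow> act v \<one> = v"
    and act_mult: "v \<in> V \<Longrightarrow> g \<in> carrier G \<Longrightarrow> h \<in> carrier G \<Longrightarrow> act v (g \<otimes> h) = act (act v g) h"

lemma (in right_action) act_inv [simp]: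
  "v \<in> V \<Longrightarrow> g \<in> carrier G \<Longrightarrow> act (act v g) (inv g) = v"
  "v \<in> V \<Longrightarrow> g \<in> carrier G \<Longrightarrow> act (act v (inv g)) g = v"
  by (simp_all flip: act_mult)

text \<open>The second factor of a product is read at the vertex reached by the first. So the base
  coordinate of a word at \<open>v\<close> multiplies the labels met along the path of the word from
  \<open>v\<close>.\<close>

definition wreath :: "('g, 'c) monoid_scheme \<Rightarrow> ('k, 'd) monoid_scheme \<Rightarrow> 'v set \<Rightarrow> ('v \<Rightarrow> 'k \<Rightarrow> 'v)
    \<Rightarrow> (('v \<Rightarrow> 'g) \<times> 'k) monoid" where
  "wreath P K V act =
     \<lparr>carrier = (V \<rightarrow>\<^sub>E carrier P) \<times> carrier K,
      monoid.mult = (\<lambda>x y. (\<lambda>v\<in>V. fst x v \<otimes>\<^bsub>P\<^esub> fst y (act v (snd x)), snd x \<otimes>\<^bsub>K\<^esub> snd y)),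
      one = (\<lambda>v\<in>V. \<one>\<^bsub>P\<^esub>, \<one>\<^bsub>K\<^esub>)\<rparr>"

lemma wreath_simps:
  "carrier (wreath P K V act) = (V \<rightarrow>\<^sub>E carrier P) \<times> carrier K"
  "fst (x \<otimes>\<^bsub>wreath P K V act\<^esub> y) = (\<lambda>v\<in>V. fst x v \<otimes>\<^bsub>P\<^esub> fst y (act v (snd x)))"
  "snd (x \<otimes>\<^bsub>wreath P K V act\<^esub> y) = snd x \<otimes>\<^bsub>K\<^esub> snd y"
  "fst \<one>\<^bsub>wreath P K V act\<^esub> = (\<lambda>v\<in>V. \<one>\<^bsub>P\<^esub>)"
  "snd \<one>\<^bsub>wreath P K V act\<^esub> = \<one>\<^bsub>K\<^esub>"
  by (simp_all add: wreath_def)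

context right_action
begin

lemma group_wreath:
  assumes "group P"
  shows "group (wreath P G V act)"
proof (rule groupI)
  interpret P: group P by fact
  let ?W = "wreath P G V act"
  fix x assume x: "x \<in> carrier ?W"
  then have fx: "fst x v \<in> carrier P" if "v \<in> V" for v
    using that by (auto simp: wreath_simps)
  have ex: "fst x \<in> extensional V" and sx: "snd x \<in> carrier G" using x by (auto simp: wreath_simps PiE_def)
  show "\<one>\<^bsub>?W\<^esub> \<otimes>\<^bsub>?W\<^esub> x = x"
    using fx ex sx by (auto simp: prod_eq_iff wreath_simps fun_eq_iff extensional_def)
  show "\<exists>y\<in>carrier ?W. y \<otimes>\<^bsub>?W\<^esub> x = \<one>\<^bsub>?W\<^esub>"
    by (rule bexI[of _ "(\<lambda>v\<in>V. inv\<^bsub>P\<^esub> fst x (act v (inv (snd x))), inv (snd x))"])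
      (use fx ex sx in \<open>auto simp: prod_eq_iff wreath_simps fun_eq_iff\<close>)
  fix y assume y: "y \<in> carrier ?W"
  then have fy: "fst y v \<in> carrier P" if "v \<in> V" for v
    using that by (auto simp: wreath_simps)
  have sy: "snd y \<in> carrier G" using y by (auto simp: wreath_simps)
  show "x \<otimes>\<^bsub>?W\<^esub> y \<in> carrier ?W"
    using fx fy sx sy by (simp add: wreath_simps mem_Times_iff)
  fix z assume z: "z \<in> carrier ?W"
  then have fz: "fst z v \<in> carrier P" if "v \<in> V" for v
    using that by (auto simp: wreath_simps)
  have sz: "snd z \<in> carrier G" using z by (auto simp: wreath_simps)
  show "x \<otimes>\<^bsub>?W\<^esub> y \<otimes>\<^bsub>?W\<^esub> z = x \<otimes>\<^bsub>?W\<^esub> (y \<otimes>\<^bsub>?W\<^esub> z)"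
    using fx fy fz sx sy sz by (simp add: prod_eq_iff wreath_simps fun_eq_iff P.m_assoc m_assoc act_mult)
qed (use assms in \<open>auto simp: wreath_simps group.is_monoid mem_Times_iff\<close>)

lemma snd_wreath_hom: "snd \<in> hom (wreath P G V act) G"
  by (auto simp: hom_def wreath_simps mem_Times_iff)

text \<open>A functor from the groupoid of the action to \<open>P\<close>, that is, a multiplicative
  labelling of paths.\<close>

definition cocycle :: "('p, 'c) monoid_scheme \<Rightarrow> ('v \<Rightarrow> 'a \<Rightarrow> 'p) \<Rightarrow> bool" where
  "cocycle P \<phi> \<longleftrightarrow> (\<forall>v\<in>V. \<forall>g\<in>carrier G. \<phi> v g \<in> carrier P) \<and>
     (\<forall>v\<in>V. \<forall>g\<in>carrier G. \<forall>h\<in>carrier G. \<phi> v (g \<otimes> h) = \<phi> v g \<otimes>\<^bsub>P\<^esub> \<phi> (act v g) h)"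

lemma cocycle_closed: "cocycle P \<phi> \<Longrightarrow> v \<in> V \<Longrightarrow> g \<in> carrier G \<Longrightarrow> \<phi> v g \<in> carrier P"
  by (simp add: cocycle_def)

lemma cocycle_mult:
  "cocycle P \<phi> \<Longrightarrow> v \<in> V \<Longrightarrow> g \<in> carrier G \<Longrightarrow> h \<in> carrier G \<Longrightarrow>
    \<phi> v (g \<otimes> h) = \<phi> v g \<otimes>\<^bsub>P\<^esub> \<phi> (act v g) h"
  by (simp add: cocycle_def)

lemma cocycle_one: 
  assumes "group P" "cocycle P \<phi>" "v \<in> V"
  shows "\<phi> v \<one> = \<one>\<^bsub>P\<^esub>"
proof -
  interpret P: group P by fact
  have "\<phi> v \<one> = \<phi> v \<one> \<otimes>\<^bsub>P\<^esub> \<phi> v \<one>" using cocycle_mult[OF assms(2,3), of \<one> \<one>] assms(3) by simp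
  then show ?thesis using cocycle_closed[OF assms(2,3)] P.l_cancel_one' by force
qed

lemma cocycle_inv:
  assumes "group P" "cocycle P \<phi>" "v \<in> V" "g \<in> carrier G"
  shows "\<phi> v (inv g) = inv\<^bsub>P\<^esub> \<phi> (act v (inv g)) g"
proof -
  interpret P: group P by fact
  have "\<phi> v (inv g) \<otimes>\<^bsub>P\<^esub> \<phi> (act v (inv g)) g = \<one>\<^bsub>P\<^esub>"
    using cocycle_mult[OF assms(2,3), of "inv g" g] cocycle_one[OF assms(1-3)] assms(4) by simp
  then have "inv\<^bsub>P\<^esub> \<phi> (act v (inv g)) g = \<phi> v (inv g)"
    using P.inv_equality cocycle_closed[OF assms(2)] assms(3,4) by simp
  then show ?thesis by simp
qed

text \<open>A cocycle with prescribed values on the generators is a homomorphism into the wreath product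
  lifting the identity of \<open>G\<close>, so the universal property of the presentation applies.\<close>

lemma cocycle_extension:
  assumes pres: "presents G X c R" and P: "group P"
    and d: "\<And>v x. v \<in> V \<Longrightarrow> x \<in> X \<Longrightarrow> d v x \<in> carrier P"
    and rel: "\<And>r v. r \<in> R \<Longrightarrow> v \<in> V \<Longrightarrow>
      fst (eval_word (wreath P G V act) (signed (wreath P G V act) (\<lambda>x. (\<lambda>v\<in>V. d v x, c x))) r) v = \<one>\<^bsub>P\<^esub>"
  obtains \<Phi> where "cocycle P \<Phi>" "\<And>v x. v \<in> V \<Longrightarrow> x \<in> X \<Longrightarrow> \<Phi> v (c x) = d v x"
proof -
  let ?W = "wreath P G V act" and ?d = "\<lambda>x. (\<lambda>v\<in>V. d v x, c x)" and ?A = "free_alphabet X"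
  interpret W: group ?W by (rule group_wreath[OF P])
  note pres' = pres[unfolded presents_def]
  have c: "c \<in> X \<rightarrow> carrier G" and R: "R \<subseteq> lists ?A"
    and rG: "\<And>r. r \<in> R \<Longrightarrow> eval_word G (signed G c) r = \<one>"
    and im: "eval_word G (signed G c) ` lists ?A = carrier G"
    using pres' by blast+
  have dW: "?d \<in> X \<rightarrow> carrier ?W" using d c by (auto simp: wreath_simps)
  interpret s: group_hom ?W G snd by unfold_locales (rule snd_wreath_hom)
  have sev: "snd (eval_word ?W (signed ?W ?d) w) = eval_word G (signed G c) w" if w: "w \<in> lists ?A" for w
  proof -
    have "snd (eval_word ?W (signed ?W ?d) w) = eval_word G (snd \<circ> signed ?W ?d) w"
      by (rule eval_word_hom[OF W.is_monoid is_monoid snd_wreath_hom s.hom_one W.signed_closed[OF dW] w])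
    also have "\<dots> = eval_word G (signed G c) w"
      using w
    proof (induction w)
      case (Cons a w)
      obtain x b where a: "a = (x, b)" "x \<in> X" using Cons.hyps(1) by auto
      have "?d x \<in> carrier ?W" using dW a by auto
      then have "snd (signed ?W ?d a) = signed G c a"
        unfolding a signed_def by (simp add: s.hom_inv)
      then show ?case using Cons.IH by (simp only: eval_word_Cons o_apply)
    qed simp
    finally show ?thesis .
  qed
  have triv: "eval_word ?W (signed ?W ?d) r = \<one>\<^bsub>?W\<^esub>" if r: "r \<in> R" for r
  proof -
    have "r \<in> lists ?A" using R r by blast
    then have 1: "snd (eval_word ?W (signed ?W ?d) r) = \<one>" and
      2: "eval_word ?W (signed ?W ?d) r \<in> carrier ?W"
      using sev rG[OF r] W.eval_word_closed[OF W.signed_closed[OF dW]] by simp_all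
    from 2 have 3: "fst (eval_word ?W (signed ?W ?d) r) \<in> extensional V"
      by (simp add: wreath_simps mem_Times_iff PiE_def)
    show ?thesis
      by (rule prod_eqI) (use 1 3 rel[OF r] in \<open>auto simp: wreath_simps fun_eq_iff extensional_def\<close>)
  qed
  obtain h where h: "h \<in> hom G ?W"
    and hw: "\<And>w. w \<in> lists ?A \<Longrightarrow> h (eval_word G (signed G c) w) = eval_word ?W (signed ?W ?d) w"
    using presents_universal[OF pres is_group W.is_group dW triv] by blast
  \<comment> \<open>Because the second coordinate is \<open>g\<close> itself, multiplication in the
    wreath product shifts the vertex by \<open>g\<close>; this turns the homomorphism law into the
    cocycle identity for the first coordinate.\<close>
  have sh: "snd (h g) = g" if g: "g \<in> carrier G" for g
  proof -
    obtain w where w: "w \<in> lists ?A" "g = eval_word G (signed G c) w" using im g by blast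
    show ?thesis unfolding w(2) hw[OF w(1)] by (rule sev[OF w(1)])
  qed
  have hc: "h g \<in> carrier ?W" if "g \<in> carrier G" for g using h that by (auto simp: hom_def)
  show ?thesis
  proof (rule that)
    show "cocycle P (\<lambda>v g. fst (h g) v)"
      unfolding cocycle_def
    proof (intro conjI ballI)
      fix v g assume "v \<in> V" "g \<in> carrier G"
      then show "fst (h g) v \<in> carrier P" using hc by (auto simp: wreath_simps mem_Times_iff)
      fix k assume "k \<in> carrier G"
      with \<open>g \<in> carrier G\<close> \<open>v \<in> V\<close> show "fst (h (g \<otimes> k)) v = fst (h g) v \<otimes>\<^bsub>P\<^esub> fst (h k) (act v g)"
        by (simp add: hom_mult[OF h] wreath_simps sh)
    qed
    fix v x assume vx: "v \<in> V" "x \<in> X"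
    have x1: "[(x, True)] \<in> lists ?A" using vx by simp
    have cx: "c x \<in> carrier G" "?d x \<in> carrier ?W" using vx c dW by auto
    have "h (c x) = ?d x"
      using hw[OF x1] cx by (simp add: signed_def)
    then show "fst (h (c x)) v = d v x" using vx by simp
  qed
qed

text \<open>Only labels at vertices of the path enter the base coordinate, so \<open>d\<close> may
  differ from the composite of \<iota> and \<phi> elsewhere. The range of \<open>k\<close> includes
  the final vertex because an inverse letter reads the edge that starts where the letter
  ends.\<close>

lemma eval_wreath_path:
  assumes c: "c \<in> X \<rightarrow> carrier G" and P: "group P" and M: "group M"
    and d: "\<And>v x. v \<in> V \<Longrightarrow> x \<in> X \<Longrightarrow> d v x \<in> carrier P"
    and phi: "cocycle M \<phi>" and i: "\<iota> \<in> hom M P"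
    and w: "w \<in> lists (free_alphabet X)" and v: "v \<in> V"
    and path: "\<And>k x. k \<le> length w \<Longrightarrow> x \<in> X \<Longrightarrow>
       d (act v (eval_word G (signed G c) (take k w))) x =
         \<iota> (\<phi> (act v (eval_word G (signed G c) (take k w))) (c x))"
  shows "fst (eval_word (wreath P G V act) (signed (wreath P G V act) (\<lambda>x. (\<lambda>v\<in>V. d v x, c x))) w) v
     = \<iota> (\<phi> v (eval_word G (signed G c) w))"
  using w v path
proof (induction w arbitrary: v)
  case Nil
  interpret i: group_hom M P \<iota> using i M P by (simp add: group_hom_def group_hom_axioms_def)
  show ?case using Nil cocycle_one[OF M phi] by (simp add: wreath_simps)
next
  case (Cons a w)
  let ?W = "wreath P G V act" and ?d = "\<lambda>x. (\<lambda>v\<in>V. d v x, c x)"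
  interpret W: group ?W by (rule group_wreath[OF P])
  interpret P: group P by (rule P)
  interpret i: group_hom M P \<iota> using i M P by (simp add: group_hom_def group_hom_axioms_def)
  obtain x b where a: "a = (x, b)" "x \<in> X" using Cons.hyps(1) by auto
  have cx: "c x \<in> carrier G" using c a by auto
  have dx: "?d x \<in> carrier ?W" using d a cx by (auto simp: wreath_simps)
  have wG: "eval_word G (signed G c) w \<in> carrier G"
    by (rule eval_word_closed[OF signed_closed[OF c]]) (rule Cons.hyps(2))
  have sa: "signed G c a \<in> carrier G" using signed_closed[OF c] Cons.hyps(1) by (rule funcset_mem)
  note v = \<open>v \<in> V\<close>
  have tk: "eval_word G (signed G c) (take k w) \<in> carrier G" for k
    by (rule eval_word_closed[OF signed_closed[OF c]]) (use Cons.hyps(2) in \<open>auto dest: in_set_takeD\<close>)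
  have IH: "fst (eval_word ?W (signed ?W ?d) w) (act v (signed G c a)) =
      \<iota> (\<phi> (act v (signed G c a)) (eval_word G (signed G c) w))"
  proof (rule Cons.IH)
    show "act v (signed G c a) \<in> V" using v sa by simp
    fix k y assume "k \<le> length w" "y \<in> X"
    then show "d (act (act v (signed G c a)) (eval_word G (signed G c) (take k w))) y =
        \<iota> (\<phi> (act (act v (signed G c a)) (eval_word G (signed G c) (take k w))) (c y))"
      using Cons.prems(2)[of "Suc k" y] tk[of k] v sa by (simp add: act_mult)
  qed
  have ev: "d v y = \<iota> (\<phi> v (c y))" if "y \<in> X" for y
    using Cons.prems(2)[of 0 y] that v by simp
  have ev': "d (act v (signed G c a)) y = \<iota> (\<phi> (act v (signed G c a)) (c y))" if "y \<in> X" for y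
    using Cons.prems(2)[of 1 y] that v sa by simp
  have 1: "snd (signed ?W ?d a) = signed G c a \<and> fst (signed ?W ?d a) v = \<iota> (\<phi> v (signed G c a))"
  proof (cases b)
    case True
    then show ?thesis using a v ev[OF a(2)] by (simp add: signed_def)
  next
    case False
    then have sa': "signed G c a = inv (c x)" "signed ?W ?d a = inv\<^bsub>?W\<^esub> (?d x)"
      using a by (simp_all add: signed_def)
    have "?d x \<otimes>\<^bsub>?W\<^esub> inv\<^bsub>?W\<^esub> (?d x) = \<one>\<^bsub>?W\<^esub>" "inv\<^bsub>?W\<^esub> (?d x) \<in> carrier ?W"
      using dx by auto
    then have e: "?d x \<otimes>\<^bsub>?W\<^esub> inv\<^bsub>?W\<^esub> (?d x) = \<one>\<^bsub>?W\<^esub>" and ic: "inv\<^bsub>?W\<^esub> (?d x) \<in> carrier ?W"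
      by blast+
    have sc: "snd (inv\<^bsub>?W\<^esub> (?d x)) \<in> carrier G" and
      fc: "\<And>u. u \<in> V \<Longrightarrow> fst (inv\<^bsub>?W\<^esub> (?d x)) u \<in> carrier P"
      using ic unfolding wreath_simps mem_Times_iff by blast+
    \<comment> \<open>The coordinates of the inverse are read off from the product of
      \<open>?d x\<close> with its inverse, vertex by vertex.\<close>
    have f: "d u x \<otimes>\<^bsub>P\<^esub> fst (inv\<^bsub>?W\<^esub> (?d x)) (act u (c x)) = \<one>\<^bsub>P\<^esub>" if "u \<in> V" for u
      using fun_cong[OF arg_cong[OF e, of fst], of u] that
      by (simp only: wreath_simps fst_conv snd_conv restrict_apply if_True)
    have "c x \<otimes> snd (inv\<^bsub>?W\<^esub> (?d x)) = \<one>"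
      using arg_cong[OF e, of snd] by (simp only: wreath_simps snd_conv)
    then have s: "snd (inv\<^bsub>?W\<^esub> (?d x)) = inv (c x)"
      using inv_equality[OF inv_comm[OF _ cx sc] cx sc] by simp
    let ?u = "act v (inv (c x))"
    have u: "?u \<in> V" using v cx by simp
    have "d ?u x \<otimes>\<^bsub>P\<^esub> fst (inv\<^bsub>?W\<^esub> (?d x)) v = \<one>\<^bsub>P\<^esub>"
      using f[OF u] v cx by simp
    then have "fst (inv\<^bsub>?W\<^esub> (?d x)) v = inv\<^bsub>P\<^esub> d ?u x"
      using P.inv_equality P.inv_comm d[OF u a(2)] fc[OF v] by metis
    also have "\<dots> = \<iota> (inv\<^bsub>M\<^esub> \<phi> ?u (c x))"
      using ev'[OF a(2)] cocycle_closed[OF phi u cx] by (simp add: sa' i.hom_inv)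
    also have "\<dots> = \<iota> (\<phi> v (inv (c x)))"
      using cocycle_inv[OF M phi v cx] by simp
    finally show ?thesis using s sa' by simp
  qed
  from 1 have s: "snd (signed ?W ?d a) = signed G c a" and f: "fst (signed ?W ?d a) v = \<iota> (\<phi> v (signed G c a))"
    by blast+
  have "\<iota> (\<phi> v (signed G c a \<otimes> eval_word G (signed G c) w)) =
      \<iota> (\<phi> v (signed G c a)) \<otimes>\<^bsub>P\<^esub> \<iota> (\<phi> (act v (signed G c a)) (eval_word G (signed G c) w))"
    using v sa wG cocycle_closed[OF phi v sa] cocycle_closed[OF phi _ wG]
    by (simp add: cocycle_mult[OF phi v sa wG])
  then show ?case
    by (simp only: eval_word_Cons wreath_simps restrict_apply'[OF v] s f IH)
qed

text \<open>The cocycle \<open>\<phi>\<close> is cut along the boundary of \<open>D\<close>: its values are sent to \<open>P\<close> by one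
  homomorphism inside \<open>D\<close> and by another one outside. The path of a relator meeting both sides
  stays where \<open>\<phi>\<close> is trivial.\<close>

lemma cut_cocycle:
  assumes pres: "presents G X c R" and P: "group P" and M: "group M"
    and phi: "cocycle M \<phi>" and iD: "\<iota>\<^sub>1 \<in> hom M P" and iE: "\<iota>\<^sub>2 \<in> hom M P"
    and triv: "\<And>v x r k l. v \<in> V \<Longrightarrow> x \<in> X \<Longrightarrow> r \<in> R \<Longrightarrow> k \<le> length r \<Longrightarrow> l \<le> length r \<Longrightarrow>
       (v \<in> D) \<noteq> (act v (inv (eval_word G (signed G c) (take k r)) \<otimes> eval_word G (signed G c) (take l r)) \<in> D)
       \<Longrightarrow> \<phi> v (c x) = \<one>\<^bsub>M\<^esub>"
  obtains \<Phi> where "cocycle P \<Phi>"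
    "\<And>v x. v \<in> V \<Longrightarrow> x \<in> X \<Longrightarrow> \<Phi> v (c x) = (if v \<in> D then \<iota>\<^sub>1 else \<iota>\<^sub>2) (\<phi> v (c x))"
proof -
  let ?d = "\<lambda>v x. (if v \<in> D then \<iota>\<^sub>1 else \<iota>\<^sub>2) (\<phi> v (c x))"
  let ?e = "eval_word G (signed G c)"
  have c: "c \<in> X \<rightarrow> carrier G" and R: "R \<subseteq> lists (free_alphabet X)"
    and rG: "\<And>r. r \<in> R \<Longrightarrow> eval_word G (signed G c) r = \<one>"
    using pres[unfolded presents_def] by blast+
  interpret i1: group_hom M P \<iota>\<^sub>1 using iD M P by (simp add: group_hom_def group_hom_axioms_def)
  interpret i2: group_hom M P \<iota>\<^sub>2 using iE M P by (simp add: group_hom_def group_hom_axioms_def)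
  have d: "?d v x \<in> carrier P" if "v \<in> V" "x \<in> X" for v x
  proof -
    have "\<phi> v (c x) \<in> carrier M" using that c cocycle_closed[OF phi] by auto
    then show ?thesis by simp
  qed
  have rel: "fst (eval_word (wreath P G V act) (signed (wreath P G V act) (\<lambda>x. (\<lambda>v\<in>V. ?d v x, c x))) r) v = \<one>\<^bsub>P\<^esub>"
    if r: "r \<in> R" and v: "v \<in> V" for r v
  proof -
    have rA: "r \<in> lists (free_alphabet X)" using R r by blast
    have tk: "?e (take k r) \<in> carrier G" for k
      by (rule eval_word_closed[OF signed_closed[OF c]]) (use rA in \<open>auto dest: in_set_takeD\<close>)
    define u where "u k = act v (?e (take k r))" for k
    have uV: "u k \<in> V" for k using v tk by (simp add: u_def)
    have ukl: "act (u k) (inv (?e (take k r)) \<otimes> ?e (take l r)) = u l" for k l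
      using v tk by (simp add: u_def act_mult)
    \<comment> \<open>If the path meets both sides, each of its vertices \<open>u m\<close> lies on
      the other side from \<open>u k\<close> or from \<open>u l\<close>. The displacement between
      the two is a difference of prefixes of \<open>r\<close>, so \<open>triv\<close> makes \<phi>
      trivial along the entire path.\<close>
    have mixed: "\<phi> (u m) (c x) = \<one>\<^bsub>M\<^esub>"
      if "k \<le> length r" "l \<le> length r" "m \<le> length r" "u k \<in> D" "u l \<notin> D" "x \<in> X" for k l m x
    proof (cases "u m \<in> D")
      case True
      show ?thesis by (rule triv[OF uV that(6) r that(3) that(2)]) (use True that ukl in simp)
    next
      case False
      show ?thesis by (rule triv[OF uV that(6) r that(3) that(1)]) (use False that ukl in simp)
    qed
    have "(\<forall>k\<le>length r. \<forall>x\<in>X. ?d (u k) x = \<iota>\<^sub>1 (\<phi> (u k) (c x))) \<or>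
        (\<forall>k\<le>length r. \<forall>x\<in>X. ?d (u k) x = \<iota>\<^sub>2 (\<phi> (u k) (c x)))"
    proof (cases "\<exists>k l. k \<le> length r \<and> l \<le> length r \<and> u k \<in> D \<and> u l \<notin> D")
      case True
      then have "\<forall>k\<le>length r. \<forall>x\<in>X. \<phi> (u k) (c x) = \<one>\<^bsub>M\<^esub>" using mixed by blast
      then show ?thesis by simp
    qed auto
    then obtain \<iota> where i: "\<iota> \<in> hom M P" "\<And>k x. k \<le> length r \<Longrightarrow> x \<in> X \<Longrightarrow> ?d (u k) x = \<iota> (\<phi> (u k) (c x))"
      using iD iE by blast
    interpret i: group_hom M P \<iota> using i M P by (simp add: group_hom_def group_hom_axioms_def)
    have "fst (eval_word (wreath P G V act) (signed (wreath P G V act) (\<lambda>x. (\<lambda>v\<in>V. ?d v x, c x))) r) v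
        = \<iota> (\<phi> v (?e r))"
      by (rule eval_wreath_path[OF c P M d phi i(1) rA v i(2)[unfolded u_def]])
    also have "\<dots> = \<one>\<^bsub>P\<^esub>"
      using cocycle_one[OF M phi v] rG[OF r] by simp
    finally show ?thesis .
  qed
  show ?thesis
    by (rule cocycle_extension[OF pres P d rel]) (use that in auto)
qed

end

section \<open>Non-abelian free quotients\<close>

definition free2 :: "(nat \<times> bool) list set monoid" where
  "free2 = free_group {0, 1}"

definition free2_x :: "(nat \<times> bool) list set" where "free2_x = free_class {0, 1} [(0, True)]"
definition free2_y :: "(nat \<times> bool) list set" where "free2_y = free_class {0, 1} [(1, True)]"

lemma group_free2: "group free2"
  unfolding free2_def by (rule group_free_group)

lemma free2_gens_closed: "free2_x \<in> carrier free2" "free2_y \<in> carrier free2"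
  unfolding free2_def free_group_eq carrier_word_quotient free2_x_def free2_y_def
  by (intro imageI; simp)+

lemma free2_subgroup_eq:
  "subgroup K free2 \<Longrightarrow> free2_x \<in> K \<Longrightarrow> free2_y \<in> K \<Longrightarrow> K = carrier free2"
  unfolding free2_def free2_x_def free2_y_def by (rule free_group_subgroup_eq) auto

lemma free2_not_comm: "\<not> comm_group free2"
proof
  assume "comm_group free2"
  then interpret F: comm_group free2 .
  \<comment> \<open>The generators go to the transpositions (0 1) and (1 2) of the natural numbers,
    whose two products differ at 0.\<close>
  define c where "c = (\<lambda>n::nat. if n = 0 then Transposition.transpose 0 1 else Transposition.transpose 1 (2::nat))"
  define P where "P = BijGroup (UNIV :: nat set)"
  interpret P: group P unfolding P_def by (rule group_BijGroup)
  have c: "c \<in> {0, 1} \<rightarrow> carrier P"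
    by (auto simp: BijGroup_def Bij_def P_def c_def)
  note l = P.free_lift_hom[OF c, folded free2_def]
  have "[(0, True)] \<in> lists (free_alphabet {0, 1 :: nat})" "[(1, True)] \<in> lists (free_alphabet {0, 1 :: nat})"
    by simp_all
  from this[THEN P.free_lift_class[OF c]]
  have lx: "free_lift P c free2_x = c 0" "free_lift P c free2_y = c 1"
    using c by (simp_all add: signed_def Pi_iff free2_x_def free2_y_def)
  have "free_lift P c (free2_x \<otimes>\<^bsub>free2\<^esub> free2_y) = free_lift P c (free2_y \<otimes>\<^bsub>free2\<^esub> free2_x)"
    using F.m_comm[OF free2_gens_closed] by simp
  then have "c 0 \<otimes>\<^bsub>P\<^esub> c 1 = c 1 \<otimes>\<^bsub>P\<^esub> c 0"
    using hom_mult[OF l] free2_gens_closed lx by simp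
  moreover have "c 0 \<in> Bij UNIV" "c 1 \<in> Bij UNIV"
    by (auto simp: Bij_def c_def)
  ultimately have "compose UNIV (c 0) (c 1) (0::nat) = compose UNIV (c 1) (c 0) 0"
    by (simp add: BijGroup_def P_def)
  then show False by (simp add: compose_def c_def)
qed

text \<open>The index is the order of the image, and Lagrange's theorem applies. The target will be
  a \<open>p\<close>-group, which makes the index a power of \<open>p\<close>.\<close>

lemma (in group_hom) card_rcosets_kernel:
  assumes "finite (carrier H)"
  shows "card (rcosets\<^bsub>G\<^esub> (kernel G H h)) dvd order H"
proof -
  let ?I = "H\<lparr>carrier := h ` carrier G\<rparr>"
  have sub: "subgroup (h ` carrier G) H" by (rule img_is_subgroup)
  interpret i: group_hom G ?I h
    by (intro group_hom.intro group_hom_axioms.intro G.is_group H.subgroup_imp_group[OF sub])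
      (auto simp: hom_def)
  have k: "kernel G ?I h = kernel G H h" by (simp add: kernel_def)
  have "(\<lambda>X. the_elem (h ` X)) \<in> iso (G Mod kernel G ?I h) ?I"
    by (rule i.FactGroup_iso_set) simp
  then have "card (carrier (G Mod kernel G ?I h)) = card (carrier ?I)"
    by (auto simp: iso_def intro: bij_betw_same_card)
  then have "card (rcosets\<^bsub>G\<^esub> (kernel G H h)) = card (h ` carrier G)"
    by (simp add: FactGroup_def k)
  then show ?thesis using H.lagrange[OF sub] by (metis dvd_triv_right)
qed

text \<open>The function \<open>\<theta>\<close> below makes \<open>\<iota>\<^sub>1\<close> a coboundary, hence a homomorphism; the commutators of
  \<open>\<iota>\<^sub>1 u\<close> and \<open>\<iota>\<^sub>2 u\<^sub>3\<close> lie in the base group and evaluate at the identity to the value of \<open>\<theta>\<close>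
  at \<open>(u, u\<^sub>3)\<close>.\<close>

locale free_target =
  M: comm_group M for M :: "('m, 'c) monoid_scheme" +
  fixes u1 u2 u3 :: 'm
  assumes u_closed: "u1 \<in> carrier M" "u2 \<in> carrier M" "u3 \<in> carrier M"
    and u_neq: "u1 \<noteq> \<one>\<^bsub>M\<^esub>" "u2 \<noteq> \<one>\<^bsub>M\<^esub>" "u3 \<noteq> \<one>\<^bsub>M\<^esub>" "u1 \<noteq> u2"
begin

abbreviation Q where "Q \<equiv> M \<times>\<times> M"
abbreviation W where "W \<equiv> wreath free2 Q (carrier M \<times> carrier M) (\<otimes>\<^bsub>Q\<^esub>)"

sublocale Q: comm_group Q
  by (rule group.group_comm_groupI) (auto intro: DirProd_group M.is_group M.m_comm)

sublocale Q: right_action Q "carrier M \<times> carrier M" "(\<otimes>\<^bsub>Q\<^esub>)"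
  by unfold_locales (auto simp: M.m_assoc)

sublocale F: group free2 by (rule group_free2)

lemma group_W: "group W" by (rule Q.group_wreath) (rule F.is_group)

text \<open>The two marked points have no trivial coordinate, so \<theta> is trivial on both axes;
  this isolates a single value of \<theta> when a commutator is evaluated. As the points differ,
  they can carry the two free generators separately.\<close>

definition \<theta> :: "'m \<times> 'm \<Rightarrow> (nat \<times> bool) list set" where
  "\<theta> q = (if q = (u1, u3) then free2_x else if q = (u2, u3) then free2_y else \<one>\<^bsub>free2\<^esub>)"

lemma theta_closed [simp]: "\<theta> q \<in> carrier free2"
  using free2_gens_closed by (simp add: \<theta>_def)

definition \<iota>\<^sub>1 where "\<iota>\<^sub>1 a = (\<lambda>q\<in>carrier M \<times> carrier M. inv\<^bsub>free2\<^esub> \<theta> q \<otimes>\<^bsub>free2\<^esub> \<theta> (q \<otimes>\<^bsub>Q\<^esub> (a, \<one>\<^bsub>M\<^esub>)), (a, \<one>\<^bsub>M\<^esub>))"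
definition \<iota>\<^sub>2 where "\<iota>\<^sub>2 b = (\<lambda>q\<in>carrier M \<times> carrier M. \<one>\<^bsub>free2\<^esub>, (\<one>\<^bsub>M\<^esub>, b))"

lemma iota1_hom: "\<iota>\<^sub>1 \<in> hom M W"
proof (rule homI)
  fix x y assume x: "x \<in> carrier M" and y: "y \<in> carrier M"
  show "\<iota>\<^sub>1 x \<in> carrier W" using x by (auto simp: \<iota>\<^sub>1_def wreath_simps)
  show "\<iota>\<^sub>1 (x \<otimes>\<^bsub>M\<^esub> y) = \<iota>\<^sub>1 x \<otimes>\<^bsub>W\<^esub> \<iota>\<^sub>1 y"
  proof (rule prod_eqI)
    show "fst (\<iota>\<^sub>1 (x \<otimes>\<^bsub>M\<^esub> y)) = fst (\<iota>\<^sub>1 x \<otimes>\<^bsub>W\<^esub> \<iota>\<^sub>1 y)"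
    proof
      fix q
      show "fst (\<iota>\<^sub>1 (x \<otimes>\<^bsub>M\<^esub> y)) q = fst (\<iota>\<^sub>1 x \<otimes>\<^bsub>W\<^esub> \<iota>\<^sub>1 y) q"
      proof (cases "q \<in> carrier M \<times> carrier M")
        case True
        then obtain a b where q: "q = (a, b)" "a \<in> carrier M" "b \<in> carrier M" by auto
        have "inv\<^bsub>free2\<^esub> r \<otimes>\<^bsub>free2\<^esub> s \<otimes>\<^bsub>free2\<^esub> (inv\<^bsub>free2\<^esub> s \<otimes>\<^bsub>free2\<^esub> t) = inv\<^bsub>free2\<^esub> r \<otimes>\<^bsub>free2\<^esub> t"
          if "r \<in> carrier free2" "s \<in> carrier free2" "t \<in> carrier free2" for r s t
          using that by (metis F.inv_solve_left F.inv_closed F.m_assoc F.m_closed)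
        from this[of "\<theta> q" "\<theta> (a \<otimes>\<^bsub>M\<^esub> x, b)" "\<theta> (a \<otimes>\<^bsub>M\<^esub> (x \<otimes>\<^bsub>M\<^esub> y), b)"]
        show ?thesis using q x y by (simp add: \<iota>\<^sub>1_def wreath_simps M.m_assoc)
      qed (simp add: \<iota>\<^sub>1_def wreath_simps)
    qed
    show "snd (\<iota>\<^sub>1 (x \<otimes>\<^bsub>M\<^esub> y)) = snd (\<iota>\<^sub>1 x \<otimes>\<^bsub>W\<^esub> \<iota>\<^sub>1 y)"
      using x y by (simp add: \<iota>\<^sub>1_def wreath_simps)
  qed
qed

lemma iota2_hom: "\<iota>\<^sub>2 \<in> hom M W"
  by (rule homI) (auto simp: \<iota>\<^sub>2_def wreath_simps prod_eq_iff fun_eq_iff)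

lemma commutator_value:
  assumes K: "group K" and Psi: "\<Psi> \<in> hom K W"
    and a: "g \<in> carrier K" "\<Psi> g = \<iota>\<^sub>1 a" "a = u1 \<or> a = u2" and b: "h \<in> carrier K" "\<Psi> h = \<iota>\<^sub>2 u3"
  shows "\<exists>k\<in>carrier K. snd (\<Psi> k) = \<one>\<^bsub>Q\<^esub> \<and> fst (\<Psi> k) \<one>\<^bsub>Q\<^esub> = \<theta> (a, u3)"
proof -
  interpret K: group K by fact
  interpret W: group W by (rule group_W)
  interpret \<Psi>: group_hom K W \<Psi> using Psi by unfold_locales
  have aM: "a \<in> carrier M" "a \<noteq> \<one>\<^bsub>M\<^esub>" using a(3) u_closed u_neq by auto
  \<comment> \<open>The commutator is arranged so that \<open>h g = k (g h)\<close>. Applying \<Psi>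
    and comparing both sides at the identity avoids computing inverses in the wreath
    product.\<close>
  define k where "k = (h \<otimes>\<^bsub>K\<^esub> g) \<otimes>\<^bsub>K\<^esub> inv\<^bsub>K\<^esub> (g \<otimes>\<^bsub>K\<^esub> h)"
  have kK: "k \<in> carrier K" using a b by (simp add: k_def)
  have "h \<otimes>\<^bsub>K\<^esub> g = k \<otimes>\<^bsub>K\<^esub> (g \<otimes>\<^bsub>K\<^esub> h)" using a b by (simp add: k_def K.m_assoc[of "h \<otimes>\<^bsub>K\<^esub> g" "inv\<^bsub>K\<^esub> (g \<otimes>\<^bsub>K\<^esub> h)" "g \<otimes>\<^bsub>K\<^esub> h"])
  from arg_cong[OF this, of \<Psi>] have eq: "\<iota>\<^sub>2 u3 \<otimes>\<^bsub>W\<^esub> \<iota>\<^sub>1 a = \<Psi> k \<otimes>\<^bsub>W\<^esub> (\<iota>\<^sub>1 a \<otimes>\<^bsub>W\<^esub> \<iota>\<^sub>2 u3)"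
    using a b kK by simp
  have Pk: "\<Psi> k \<in> carrier W" using kK by simp
  then have sk: "snd (\<Psi> k) \<in> carrier Q" by (simp add: wreath_simps mem_Times_iff)
  have "(a, u3) = snd (\<Psi> k) \<otimes>\<^bsub>Q\<^esub> (a, u3)"
    using arg_cong[OF eq, of snd] aM u_closed by (simp add: wreath_simps \<iota>\<^sub>1_def \<iota>\<^sub>2_def)
  then have s1: "snd (\<Psi> k) = \<one>\<^bsub>Q\<^esub>"
    using Q.r_cancel_one[OF _ sk, of "(a, u3)"] aM u_closed by simp
  have th: "\<theta> (\<one>\<^bsub>M\<^esub>, b) = \<one>\<^bsub>free2\<^esub>" "\<theta> (b, \<one>\<^bsub>M\<^esub>) = \<one>\<^bsub>free2\<^esub>" for b
    using u_neq by (auto simp: \<theta>_def)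
  have fk: "fst (\<Psi> k) \<one>\<^bsub>Q\<^esub> \<in> carrier free2"
    using Pk by (auto simp: wreath_simps mem_Times_iff)
  have "fst (\<iota>\<^sub>2 u3 \<otimes>\<^bsub>W\<^esub> \<iota>\<^sub>1 a) \<one>\<^bsub>Q\<^esub> = \<theta> (a, u3)"
    using aM u_closed by (simp add: wreath_simps \<iota>\<^sub>1_def \<iota>\<^sub>2_def th)
  moreover have "fst (\<Psi> k \<otimes>\<^bsub>W\<^esub> (\<iota>\<^sub>1 a \<otimes>\<^bsub>W\<^esub> \<iota>\<^sub>2 u3)) \<one>\<^bsub>Q\<^esub> = fst (\<Psi> k) \<one>\<^bsub>Q\<^esub>"
    using aM u_closed fk s1 by (simp add: wreath_simps \<iota>\<^sub>1_def \<iota>\<^sub>2_def th)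
  ultimately show ?thesis using s1 kK eq by auto
qed

text \<open>\<open>N\<close> is the kernel of the projection to \<open>Q\<close>, whose order is a
  power of \<open>p\<close>. On \<open>N\<close> the base coordinates multiply without a shift, so
  evaluation at the identity of \<open>Q\<close> is a homomorphism to the free group, and the
  elements from \<open>commutator_value\<close> hit both free generators.\<close>

lemma onto_free:
  assumes K: "group K" and Psi: "\<Psi> \<in> hom K W"
    and g: "g1 \<in> carrier K" "g2 \<in> carrier K" "g3 \<in> carrier K"
      "\<Psi> g1 = \<iota>\<^sub>1 u1" "\<Psi> g2 = \<iota>\<^sub>1 u2" "\<Psi> g3 = \<iota>\<^sub>2 u3"
    and ord: "prime p" "order M = p ^ m"
  shows "\<exists>N. N \<lhd> K \<and> (\<exists>k. card (rcosets\<^bsub>K\<^esub> N) = p ^ k) \<and> onto_nonabelian_free (K\<lparr>carrier := N\<rparr>)"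
proof -
  interpret K: group K by fact
  interpret W: group W by (rule group_W)
  interpret \<Psi>: group_hom K W \<Psi> using Psi by unfold_locales
  have sQ: "snd \<circ> \<Psi> \<in> hom K Q" by (rule hom_compose[OF Psi Q.snd_wreath_hom])
  interpret s: group_hom K Q "snd \<circ> \<Psi>" using sQ by unfold_locales
  define N where "N = kernel K Q (snd \<circ> \<Psi>)"
  have Nn: "N \<lhd> K" unfolding N_def by (rule s.normal_kernel)
  then have Ns: "subgroup N K" by (rule normal_imp_subgroup)
  interpret N: group "K\<lparr>carrier := N\<rparr>" by (rule K.subgroup_imp_group[OF Ns])
  have oQ: "order Q = p ^ (2 * m)"
    using ord by (simp add: order_def card_cartesian_product power_add mult_2)
  then have "finite (carrier Q)"
    using ord by (metis order_def card.infinite power_not_zero not_prime_0)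
  then have "card (rcosets\<^bsub>K\<^esub> N) dvd p ^ (2 * m)"
    using s.card_rcosets_kernel unfolding N_def oQ by blast
  then have card: "\<exists>k. card (rcosets\<^bsub>K\<^esub> N) = p ^ k"
    using divides_primepow_nat[OF ord(1)] by blast
  define f where "f k = fst (\<Psi> k) \<one>\<^bsub>Q\<^esub>" for k
  have NK: "k \<in> carrier K" "snd (\<Psi> k) = \<one>\<^bsub>Q\<^esub>" if "k \<in> N" for k
    using that by (simp_all add: N_def kernel_def)
  have fh: "f \<in> hom (K\<lparr>carrier := N\<rparr>) free2"
  proof (rule homI)
    fix x assume "x \<in> carrier (K\<lparr>carrier := N\<rparr>)"
    then have x: "x \<in> N" by simp
    have "\<Psi> x \<in> carrier W" using NK(1)[OF x] by simp
    then show "f x \<in> carrier free2" unfolding f_def wreath_simps by (auto simp: mem_Times_iff)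
    fix y assume "y \<in> carrier (K\<lparr>carrier := N\<rparr>)"
    then have y: "y \<in> N" by simp
    show "f (x \<otimes>\<^bsub>K\<lparr>carrier := N\<rparr>\<^esub> y) = f x \<otimes>\<^bsub>free2\<^esub> f y"
      using NK[OF x] NK[OF y] by (simp add: f_def wreath_simps)
  qed
  interpret f: group_hom "K\<lparr>carrier := N\<rparr>" free2 f using fh by unfold_locales
  have sub: "subgroup (f ` N) free2" using f.img_is_subgroup by simp
  have "f ` N = carrier free2"
  proof (rule free2_subgroup_eq[OF sub])
    obtain k where "k \<in> carrier K" "snd (\<Psi> k) = \<one>\<^bsub>Q\<^esub>" "fst (\<Psi> k) \<one>\<^bsub>Q\<^esub> = \<theta> (u1, u3)"
      using commutator_value[OF K Psi g(1,4) _ g(3,6)] by blast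
    then show "free2_x \<in> f ` N" by (intro image_eqI[of _ _ k]) (auto simp: f_def N_def kernel_def \<theta>_def)
    obtain k where "k \<in> carrier K" "snd (\<Psi> k) = \<one>\<^bsub>Q\<^esub>" "fst (\<Psi> k) \<one>\<^bsub>Q\<^esub> = \<theta> (u2, u3)"
      using commutator_value[OF K Psi g(2,5) _ g(3,6)] by blast
    then show "free2_y \<in> f ` N" using u_neq by (intro image_eqI[of _ _ k]) (auto simp: f_def N_def kernel_def \<theta>_def)
  qed
  then have "f \<in> epi (K\<lparr>carrier := N\<rparr>) free2" using fh by (simp add: epi_def)
  then have "onto_nonabelian_free (K\<lparr>carrier := N\<rparr>)"
    unfolding onto_nonabelian_free_def using free2_not_comm unfolding free2_def by blast
  with Nn card show ?thesis by blast
qed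

end

section \<open>Homomorphisms from a finite index subgroup as cocycles\<close>

lemma (in group) rcoset_repr:
  assumes "subgroup H G" "C \<in> rcosets H"
  obtains g where "g \<in> carrier G" "C = H #> g"
  using assms by (auto simp: RCOSETS_def)

lemma (in group) rcosets_right_action:
  assumes "subgroup H G"
  shows "right_action G (rcosets H) (\<lambda>C g. C #> g)"
proof -
  have sub: "H \<subseteq> carrier G" by (rule subgroup.subset[OF assms])
  show ?thesis
  proof unfold_locales
    fix C g assume "C \<in> rcosets H" "g \<in> carrier G"
    then show "C #> g \<in> rcosets H"
      by (elim rcoset_repr[OF assms]) (simp add: coset_mult_assoc sub rcosetsI)
  next
    fix C assume "C \<in> rcosets H"
    then show "C #> \<one> = C"
      by (elim rcoset_repr[OF assms]) (auto simp: coset_mult_assoc sub)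
  next
    fix C g h assume "C \<in> rcosets H" "g \<in> carrier G" "h \<in> carrier G"
    then show "C #> (g \<otimes> h) = C #> g #> h"
      by (elim rcoset_repr[OF assms]) (auto simp: coset_mult_assoc sub m_assoc)
  qed
qed

lemma (in group) subgroup_in_rcosets': "subgroup H G \<Longrightarrow> H \<in> rcosets H"
  using subgroup.subgroup_in_rcosets is_group by blast

lemma (in group) rcoset_eq_iff:
  assumes "subgroup H G" "x \<in> carrier G" "y \<in> carrier G"
  shows "H #> x = H #> y \<longleftrightarrow> x \<otimes> inv y \<in> H"
proof -
  have H: "H \<subseteq> carrier G" by (rule subgroup.subset[OF assms(1)])
  show ?thesis
  proof
    assume "H #> x = H #> y"
    then have "H #> (x \<otimes> inv y) = H" by (rule coset_mult_inv2) (use assms H in auto)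
    then show "x \<otimes> inv y \<in> H" using coset_join1[OF _ _ assms(1)] assms(2,3) by simp
  next
    assume "x \<otimes> inv y \<in> H"
    then have "H #> (x \<otimes> inv y) = H" using coset_join2[of "x \<otimes> inv y" H] assms by simp
    then show "H #> x = H #> y" by (rule coset_mult_inv1) (use assms H in auto)
  qed
qed

text \<open>The normalisation of \<tau> at \<open>H\<close> makes \<open>loop\<close> the identity
  on \<open>H\<close> at the base coset. A homomorphism is thus recovered from its cocycle without a
  conjugation.\<close>

locale transversal = group G for G (structure) +
  fixes H :: "'a set" and \<tau> :: "'a set \<Rightarrow> 'a"
  assumes sub: "subgroup H G"
    and tau_closed: "C \<in> rcosets H \<Longrightarrow> \<tau> C \<in> carrier G"
    and tau_repr: "C \<in> rcosets H \<Longrightarrow> H #> \<tau> C = C"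
    and tau_base: "\<tau> H = \<one>"

lemma (in group) transversal_exists:
  assumes H: "subgroup H G"
  obtains \<tau> where "transversal G H \<tau>"
proof -
  define \<tau> where "\<tau> C = (if C = H then \<one> else SOME g. g \<in> carrier G \<and> H #> g = C)" for C
  have tau: "\<tau> C \<in> carrier G \<and> H #> \<tau> C = C" if C: "C \<in> rcosets H" for C
  proof (cases "C = H")
    case True
    then show ?thesis using subgroup.subset[OF H] by (simp add: \<tau>_def)
  next
    case False
    obtain g where "g \<in> carrier G" "C = H #> g" using rcoset_repr[OF H C] .
    then have "\<exists>g. g \<in> carrier G \<and> H #> g = C" by blast
    from someI_ex[OF this] show ?thesis using False by (simp add: \<tau>_def)
  qed
  have "transversal G H \<tau>"
    by (intro transversal.intro transversal_axioms.intro is_group H) (use tau in \<open>simp_all add: \<tau>_def\<close>)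
  then show ?thesis by (rule that)
qed

context transversal
begin

abbreviation V where "V \<equiv> rcosets H"

sublocale right_action G V "\<lambda>C g. C #> g" by (rule rcosets_right_action[OF sub])

lemma base: "H \<in> V" by (rule subgroup_in_rcosets'[OF sub])

lemma base_stab: "h \<in> H \<Longrightarrow> H #> h = H"
  by (rule coset_join2) (use sub subgroup.mem_carrier[OF sub] in auto)

abbreviation HG where "HG \<equiv> G\<lparr>carrier := H\<rparr>"

lemma group_HG: "group HG" by (rule subgroup_imp_group[OF sub])

text \<open>The Schreier generator of an edge: out along the transversal, across by
  \<open>g\<close>, and back to the base.\<close>

definition loop :: "'a set \<Rightarrow> 'a \<Rightarrow> 'a" where
  "loop C g = \<tau> C \<otimes> g \<otimes> inv (\<tau> (C #> g))"

lemma loop_closed: "C \<in> V \<Longrightarrow> g \<in> carrier G \<Longrightarrow> loop C g \<in> H"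
proof -
  assume C: "C \<in> V" and g: "g \<in> carrier G"
  have t: "\<tau> C \<in> carrier G" "\<tau> (C #> g) \<in> carrier G" using tau_closed C g by auto
  have "H #> (\<tau> C \<otimes> g) = H #> \<tau> (C #> g)"
    using act_mult[OF base t(1) g] tau_repr C g by simp
  then show ?thesis
    using rcoset_eq_iff[OF sub, of "\<tau> C \<otimes> g" "\<tau> (C #> g)"] t g by (simp add: loop_def)
qed

lemma loop_mult:
  assumes C: "C \<in> V" and g: "g \<in> carrier G" "h \<in> carrier G"
  shows "loop C (g \<otimes> h) = loop C g \<otimes> loop (C #> g) h"
proof -
  have t: "\<tau> C \<in> carrier G" "\<tau> (C #> g) \<in> carrier G" "\<tau> (C #> g #> h) \<in> carrier G"
    using tau_closed C g by auto
  have "loop C g \<otimes> loop (C #> g) h =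
      \<tau> C \<otimes> g \<otimes> (inv (\<tau> (C #> g)) \<otimes> \<tau> (C #> g)) \<otimes> h \<otimes> inv (\<tau> (C #> g #> h))"
    unfolding loop_def using t g by (simp only: m_assoc inv_closed m_closed)
  also have "\<dots> = loop C (g \<otimes> h)"
    unfolding loop_def using t g C by (simp add: m_assoc act_mult)
  finally show ?thesis by simp
qed

lemma loop_base: "h \<in> H \<Longrightarrow> loop H h = h"
  using subgroup.mem_carrier[OF sub] by (simp add: loop_def tau_base base_stab)

text \<open>Together with \<open>cocycle_base_hom\<close> this is Shapiro's lemma in degree one:
  homomorphisms from \<open>H\<close> correspond to cocycles over the cosets, up to a change of
  gauge along the transversal.\<close>

lemma cocycle_loop:
  assumes "\<alpha> \<in> hom HG M"
  shows "cocycle M (\<lambda>C g. \<alpha> (loop C g))"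
  unfolding cocycle_def using assms loop_closed by (auto simp: loop_mult hom_def Pi_iff)

lemma cocycle_base_hom:
  assumes "cocycle P \<Phi>"
  shows "\<Phi> H \<in> hom HG P"
proof (rule homI)
  fix x y assume "x \<in> carrier HG" "y \<in> carrier HG"
  then have "x \<in> H" "y \<in> H" "x \<in> carrier G" "y \<in> carrier G"
    using subgroup.mem_carrier[OF sub] by auto
  then show "\<Phi> H (x \<otimes>\<^bsub>HG\<^esub> y) = \<Phi> H x \<otimes>\<^bsub>P\<^esub> \<Phi> H y"
    using cocycle_mult[OF assms base] base_stab by simp
next
  fix x assume "x \<in> carrier HG"
  then show "\<Phi> H x \<in> carrier P"
    using cocycle_closed[OF assms base] subgroup.mem_carrier[OF sub] by auto
qed

end

text \<open>The transversal is a rooted spanning tree of the coset graph: each representative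
  extends the one of a coset of smaller \<open>rank\<close> by a signed generator. Tree edges
  therefore have trivial \<open>loop\<close>.\<close>

locale schreier = transversal G H \<tau> for G (structure) and H \<tau> +
  fixes X :: "'x set" and c :: "'x \<Rightarrow> 'a" and R and rank :: "'a set \<Rightarrow> nat"
  assumes pres: "presents G X c R"
    and tau_step: "C \<in> rcosets H \<Longrightarrow> C \<noteq> H \<Longrightarrow>
      \<exists>C'\<in>rcosets H. \<exists>a\<in>free_alphabet X. rank C' < rank C \<and> C = C' #> signed G c a \<and> \<tau> C = \<tau> C' \<otimes> signed G c a"

lemma (in group) schreier_exists:
  assumes H: "subgroup H G" and pres: "presents G X c R"
  obtains \<tau> rank where "schreier G H \<tau> X c R rank"
proof -
  let ?A = "free_alphabet X" and ?e = "eval_word G (signed G c)"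
  interpret right_action G "rcosets H" "\<lambda>C g. C #> g" by (rule rcosets_right_action[OF H])
  have c: "c \<in> X \<rightarrow> carrier G" and im: "?e ` lists ?A = carrier G"
    using pres[unfolded presents_def] by blast+
  have H0: "H \<in> rcosets H" by (rule subgroup_in_rcosets'[OF H])
  \<comment> \<open>Distance from the base coset; dropping the last letter of a shortest word leads
    to a parent in the tree.\<close>
  define rank where "rank C = (LEAST n. \<exists>w\<in>lists ?A. length w = n \<and> H #> ?e w = C)" for C
  have rank_le: "rank (H #> ?e w) \<le> length w" if "w \<in> lists ?A" for w
    unfolding rank_def by (rule Least_le) (use that in blast)
  have step: "\<exists>C'. \<exists>a\<in>?A. C' \<in> rcosets H \<and> rank C' < rank C \<and> C = C' #> signed G c a"
    if C: "C \<in> rcosets H" "C \<noteq> H" for C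
  proof -
    obtain g where g: "g \<in> carrier G" "C = H #> g" using rcoset_repr[OF H C(1)] by blast
    from g(1) have "g \<in> ?e ` lists ?A" unfolding im .
    then obtain w where "w \<in> lists ?A" "g = ?e w" by blast
    with g(2) have "\<exists>n. \<exists>w\<in>lists ?A. length w = n \<and> H #> ?e w = C" by blast
    from LeastI_ex[OF this] obtain w where w: "w \<in> lists ?A" "length w = rank C" "H #> ?e w = C"
      unfolding rank_def[symmetric] by (elim bexE conjE) (rule that)
    have "w \<noteq> []"
    proof
      assume "w = []"
      then show False using w(3) C(2) act_one[OF H0] by simp
    qed
    then have u0: "w = butlast w @ [last w]" by simp
    then obtain u a where u: "w = u @ [a]" by blast
    have ua: "u \<in> lists ?A" "a \<in> ?A" using w(1) unfolding u by simp_all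
    have cl: "?e u \<in> carrier G" "signed G c a \<in> carrier G"
      using eval_word_closed[OF signed_closed[OF c] ua(1)] funcset_mem[OF signed_closed[OF c] ua(2)]
      by blast+
    have "?e w = ?e u \<otimes> signed G c a"
    proof -
      have "[a] \<in> lists ?A" using ua(2) by simp
      from eval_word_append[OF signed_closed[OF c] ua(1) this] show ?thesis
        unfolding u using cl(2) by (simp only: eval_word_Cons eval_word_Nil r_one)
    qed
    then have "C = (H #> ?e u) #> signed G c a"
      using w(3) act_mult[OF H0 cl] by simp
    moreover have "rank (H #> ?e u) < rank C"
      using rank_le[OF ua(1)] w(2) u by simp
    moreover have "H #> ?e u \<in> rcosets H" using H0 cl by simp
    ultimately show ?thesis using ua(2) by blast
  qed
  define par where "par C = (SOME q. fst q \<in> rcosets H \<and> snd q \<in> ?A \<and> rank (fst q) < rank C \<and> C = fst q #> signed G c (snd q))" for C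
  have par: "fst (par C) \<in> rcosets H" "snd (par C) \<in> ?A" "rank (fst (par C)) < rank C"
      "C = fst (par C) #> signed G c (snd (par C))"
    if C: "C \<in> rcosets H" "C \<noteq> H" for C
  proof -
    obtain C' a where "a \<in> ?A" "C' \<in> rcosets H" "rank C' < rank C" "C = C' #> signed G c a"
      using step[OF C] by (elim exE bexE conjE) (rule that)
    then have "\<exists>q. fst q \<in> rcosets H \<and> snd q \<in> ?A \<and> rank (fst q) < rank C \<and> C = fst q #> signed G c (snd q)"
      by (intro exI[of _ "(C', a)"] conjI) (simp_all only: fst_conv snd_conv)
    then have "fst (par C) \<in> rcosets H \<and> snd (par C) \<in> ?A \<and> rank (fst (par C)) < rank C \<and>
        C = fst (par C) #> signed G c (snd (par C))"
      unfolding par_def by (rule someI_ex)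
    then show "fst (par C) \<in> rcosets H" "snd (par C) \<in> ?A" "rank (fst (par C)) < rank C"
      "C = fst (par C) #> signed G c (snd (par C))"
      by simp_all
  qed
  define \<tau> where "\<tau> = wfrec (measure rank)
      (\<lambda>f C. if C = H then \<one> else f (fst (par C)) \<otimes> signed G c (snd (par C)))"
  have tau: "\<tau> C = \<tau> (fst (par C)) \<otimes> signed G c (snd (par C))" if C: "C \<in> rcosets H" "C \<noteq> H" for C
    using wfrec[OF wf_measure, of rank "\<lambda>f C. if C = H then \<one> else f (fst (par C)) \<otimes> signed G c (snd (par C))" C]
      par(3)[OF C] C(2) unfolding \<tau>_def by (simp add: cut_apply)
  have tauH: "\<tau> H = \<one>"
    using wfrec[OF wf_measure, of rank "\<lambda>f C. if C = H then \<one> else f (fst (par C)) \<otimes> signed G c (snd (par C))" H]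
    unfolding \<tau>_def by simp
  have all: "\<tau> C \<in> carrier G \<and> H #> \<tau> C = C" if "C \<in> rcosets H" for C
    using that
  proof (induction C rule: measure_induct_rule[of rank])
    case (less C)
    show ?case
    proof (cases "C = H")
      case True
      then show ?thesis using tauH H0 by simp
    next
      case False
      note p = par[OF less.prems False]
      have s: "signed G c (snd (par C)) \<in> carrier G" using signed_closed[OF c] p(2) by auto
      have "\<tau> (fst (par C)) \<in> carrier G \<and> H #> \<tau> (fst (par C)) = fst (par C)"
        by (rule less.IH[OF p(3,1)])
      then have t: "\<tau> (fst (par C)) \<in> carrier G" and h: "H #> \<tau> (fst (par C)) = fst (par C)" by blast+
      show ?thesis
        unfolding tau[OF less.prems False] act_mult[OF H0 t s] h p(4)[symmetric]
        using t s by simp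
    qed
  qed
  have "schreier G H \<tau> X c R rank"
  proof (intro schreier.intro schreier_axioms.intro transversal.intro transversal_axioms.intro is_group H pres tauH)
    fix C assume C: "C \<in> rcosets H"
    from all[OF C] show "\<tau> C \<in> carrier G" "H #> \<tau> C = C" by blast+
    assume "C \<noteq> H"
    note p = par[OF C this] and t = tau[OF C this]
    show "\<exists>C'\<in>rcosets H. \<exists>a\<in>?A. rank C' < rank C \<and> C = C' #> signed G c a \<and>
        \<tau> C = \<tau> C' \<otimes> signed G c a"
      by (rule bexI[OF _ p(1)], rule bexI[OF _ p(2)]) (intro conjI p(3,4) t)
  qed
  then show ?thesis by (rule that)
qed

context schreier
begin

lemma c_closed: "x \<in> X \<Longrightarrow> c x \<in> carrier G"
  using pres by (auto simp: presents_def)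

text \<open>Displacements between two vertices of the closed path traced by a relator. Any coset on
  a relator path that crosses a cut belongs to the \<open>bdry\<close> of the cut with respect to
  this set.\<close>

definition relator_differences :: "'a set" where
  "relator_differences =
    {inv (eval_word G (signed G c) (take k r)) \<otimes> eval_word G (signed G c) (take l r) | k l r.
       r \<in> R \<and> k \<le> length r \<and> l \<le> length r}"

definition bdry :: "'a set set \<Rightarrow> 'a set \<Rightarrow> 'a set set" where
  "bdry D T = {C \<in> V. \<exists>t\<in>T. (C \<in> D) \<noteq> (C #> t \<in> D)}"

text \<open>The cut cocycle is restricted to the base coset. Along tree edges \<alpha> is trivial
  and \<open>\<iota>\<^sub>1\<close>, \<open>\<iota>\<^sub>2\<close> preserve the identity, so the
  cut cocycle is trivial on every representative \<open>\<tau> C\<close>. Its value on a Schreier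
  generator is therefore its value on the edge itself, without a gauge correction.\<close>

lemma cut_hom:
  assumes P: "group P" and M: "group M"
    and alpha: "\<alpha> \<in> hom HG M" and iD: "\<iota>\<^sub>1 \<in> hom M P" and iE: "\<iota>\<^sub>2 \<in> hom M P"
    and triv: "\<And>C x. C \<in> bdry D relator_differences \<Longrightarrow> x \<in> X \<Longrightarrow> \<alpha> (loop C (c x)) = \<one>\<^bsub>M\<^esub>"
  obtains \<Psi> where "\<Psi> \<in> hom HG P"
    "\<And>C x. C \<in> V \<Longrightarrow> x \<in> X \<Longrightarrow> \<Psi> (loop C (c x)) = (if C \<in> D then \<iota>\<^sub>1 else \<iota>\<^sub>2) (\<alpha> (loop C (c x)))"
proof -
  interpret P: group P by fact
  interpret HG: group HG by (rule group_HG)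
  interpret \<alpha>: group_hom HG M \<alpha> using alpha M group_HG by (simp add: group_hom_def group_hom_axioms_def)
  interpret i1: group_hom M P \<iota>\<^sub>1 using iD M P by (simp add: group_hom_def group_hom_axioms_def)
  interpret i2: group_hom M P \<iota>\<^sub>2 using iE M P by (simp add: group_hom_def group_hom_axioms_def)
  obtain \<Phi> where Phi: "cocycle P \<Phi>" and
    val: "\<And>C x. C \<in> V \<Longrightarrow> x \<in> X \<Longrightarrow> \<Phi> C (c x) = (if C \<in> D then \<iota>\<^sub>1 else \<iota>\<^sub>2) (\<alpha> (loop C (c x)))"
  proof (rule cut_cocycle[OF pres P M cocycle_loop[OF alpha] iD iE])
    fix C x r k l
    assume *: "C \<in> V" "x \<in> X" "r \<in> R" "k \<le> length r" "l \<le> length r"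
       "(C \<in> D) \<noteq> (C #> (inv (eval_word G (signed G c) (take k r)) \<otimes> eval_word G (signed G c) (take l r)) \<in> D)"
    have "C \<in> bdry D relator_differences"
      unfolding bdry_def relator_differences_def using * by blast
    then show "\<alpha> (loop C (c x)) = \<one>\<^bsub>M\<^esub>" by (rule triv[OF _ *(2)])
  qed (rule that)
  have al1: "\<alpha> \<one> = \<one>\<^bsub>M\<^esub>" using \<alpha>.hom_one by simp
  have tree: "\<Phi> H (\<tau> C) = \<one>\<^bsub>P\<^esub>" if "C \<in> V" for C
    using that
  proof (induction C rule: measure_induct_rule[of rank])
    case (less C)
    show ?case
    proof (cases "C = H")
      case True
      then show ?thesis using cocycle_one[OF P Phi base] by (simp add: tau_base)
    next
      case False
      obtain C' x b where C': "C' \<in> V" "x \<in> X" "rank C' < rank C" "C = C' #> signed G c (x, b)"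
          "\<tau> C = \<tau> C' \<otimes> signed G c (x, b)"
        using tau_step[OF less.prems False] by auto
      have s: "signed G c (x, b) \<in> carrier G" using c_closed[OF C'(2)] by (simp add: signed_def)
      have t: "\<tau> C' \<in> carrier G" "\<tau> C \<in> carrier G"
        by (rule tau_closed[OF C'(1)], rule tau_closed[OF less.prems])
      have e: "\<Phi> C' (signed G c (x, b)) = \<one>\<^bsub>P\<^esub>"
      proof (cases b)
        case True
        then have "loop C' (c x) = \<one>"
          using C' t c_closed[OF C'(2)] by (simp add: loop_def signed_def)
        then show ?thesis using val[OF C'(1,2)] True al1 by (simp add: signed_def)
      next
        case False
        \<comment> \<open>The tree edge is traversed against its direction, so the labelled edge
          starts at the child \<open>C\<close>.\<close>
        have CC: "C #> c x = C'" using C' c_closed[OF C'(2)] False by (simp add: signed_def)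
        have "\<tau> C \<otimes> c x = \<tau> C'"
          using C'(5) t c_closed[OF C'(2)] False by (simp add: signed_def m_assoc)
        then have "loop C (c x) = \<one>" using t CC by (simp add: loop_def)
        then have "\<Phi> C (c x) = \<one>\<^bsub>P\<^esub>" using val[OF less.prems C'(2)] al1 by simp
        then show ?thesis
          using cocycle_inv[OF P Phi C'(1) c_closed[OF C'(2)]] C'(4) False by (simp add: signed_def)
      qed
      have "\<Phi> H (\<tau> C) = \<Phi> H (\<tau> C') \<otimes>\<^bsub>P\<^esub> \<Phi> (H #> \<tau> C') (signed G c (x, b))"
        unfolding C'(5) by (rule cocycle_mult[OF Phi base t(1) s])
      then show ?thesis using less.IH[OF C'(3,1)] e tau_repr[OF C'(1)] by simp
    qed
  qed
  have "\<Phi> H (loop C (c x)) = (if C \<in> D then \<iota>\<^sub>1 else \<iota>\<^sub>2) (\<alpha> (loop C (c x)))"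
    if Cx: "C \<in> V" "x \<in> X" for C x
  proof -
    let ?C = "C #> c x"
    have cx: "c x \<in> carrier G" by (rule c_closed[OF Cx(2)])
    have C: "?C \<in> V" using Cx cx by simp
    have t: "\<tau> C \<in> carrier G" "\<tau> ?C \<in> carrier G" using tau_closed Cx C by auto
    have "\<Phi> H (\<tau> C \<otimes> c x) = \<Phi> H (loop C (c x) \<otimes> \<tau> ?C)"
      using t cx by (simp add: loop_def m_assoc)
    also have "\<dots> = \<Phi> H (loop C (c x)) \<otimes>\<^bsub>P\<^esub> \<Phi> H (\<tau> ?C)"
      using cocycle_mult[OF Phi base _ t(2)] subgroup.mem_carrier[OF sub] loop_closed[OF Cx(1) cx]
        base_stab by simp
    also have "\<dots> = \<Phi> H (loop C (c x))"
      using tree[OF C] cocycle_closed[OF Phi base] subgroup.mem_carrier[OF sub loop_closed[OF Cx(1) cx]] by simp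
    also have "\<Phi> H (\<tau> C \<otimes> c x) = \<Phi> C (c x)"
      using cocycle_mult[OF Phi base t(1) cx] tree[OF Cx(1)] tau_repr[OF Cx(1)] cocycle_closed[OF Phi Cx(1) cx] by simp
    finally show ?thesis using val[OF Cx] by simp
  qed
  with cocycle_base_hom[OF Phi] show ?thesis by (rule that)
qed

section \<open>Quotients obtained by cutting homomorphisms to groups of exponent
  \<open>p\<close>\<close>

abbreviation Zp :: "nat \<Rightarrow> int monoid" where "Zp \<equiv> integer_mod_group"

text \<open>A non-zero element generates a group of prime order, so one non-zero value of \<alpha>
  on each side of \<open>D\<close> already puts both free factors into the image.\<close>

lemma epi_free_product:
  assumes p: "prime p"
    and alpha: "\<alpha> \<in> hom HG (Zp p)"
    and triv: "\<And>C x. C \<in> bdry D relator_differences \<Longrightarrow> x \<in> X \<Longrightarrow> \<alpha> (loop C (c x)) = 0"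
    and C1: "C1 \<in> V" "C1 \<in> D" "x1 \<in> X" "\<alpha> (loop C1 (c x1)) \<noteq> 0"
    and C2: "C2 \<in> V" "C2 \<notin> D" "x2 \<in> X" "\<alpha> (loop C2 (c x2)) \<noteq> 0"
  shows "epi HG (free_product (Zp p) (Zp p)) \<noteq> {}"
proof -
  let ?P = "free_product (Zp p) (Zp p)"
  have P: "group ?P" by (rule group_free_product) auto
  interpret P: group ?P by (rule P)
  note il = inl_hom[of "Zp p" "Zp p", OF group_integer_mod_group group_integer_mod_group]
  note ir = inr_hom[of "Zp p" "Zp p", OF group_integer_mod_group group_integer_mod_group]
  have tr: "\<alpha> (loop C (c x)) = \<one>\<^bsub>Zp p\<^esub>" if "C \<in> bdry D relator_differences" "x \<in> X" for C x
    using triv[OF that] by simp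
  obtain \<Psi> where Psi: "\<Psi> \<in> hom HG ?P"
    and val: "\<And>C x. C \<in> V \<Longrightarrow> x \<in> X \<Longrightarrow> \<Psi> (loop C (c x)) =
        (if C \<in> D then (\<lambda>x. prod_letter (Zp p) (Zp p) (Inl x)) else (\<lambda>x. prod_letter (Zp p) (Zp p) (Inr x)))
          (\<alpha> (loop C (c x)))"
    by (rule cut_hom[where D = D, OF P group_integer_mod_group alpha il ir])
      (erule (1) tr, rule that, assumption+)
  interpret \<Psi>: group_hom HG ?P \<Psi> using Psi P group_HG by (simp add: group_hom_def group_hom_axioms_def)
  have sub: "subgroup (\<Psi> ` carrier HG) ?P" by (rule \<Psi>.img_is_subgroup)
  interpret Z: group "Zp p" by simp
  have all: "f u \<in> \<Psi> ` carrier HG"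
    if f: "f \<in> hom (Zp p) ?P" and v: "f v \<in> \<Psi> ` carrier HG" "v \<in> carrier (Zp p)" "v \<noteq> 0"
      and u: "u \<in> carrier (Zp p)" for f u v
  proof -
    interpret f: group_hom "Zp p" ?P f using f P by (simp add: group_hom_def group_hom_axioms_def)
    interpret S: subgroup "\<Psi> ` carrier HG" ?P by (rule sub)
    have p0: "p > 0" using p prime_gt_0_nat by blast
    then have v': "0 < v" "v < int p" and u': "0 \<le> u" "u < int p"
      using v u by (auto simp: carrier_integer_mod_group)
    have "coprime v (int p)"
    proof -
      have "\<not> int p dvd v" using v' zdvd_not_zless by blast
      moreover have "prime (int p)" using p by simp
      ultimately have "coprime (int p) v" by (rule prime_imp_coprime[rotated])
      then show ?thesis by (simp add: coprime_commute)
    qed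
    then obtain w where w: "[v * w = 1] (mod int p)" using cong_solve_coprime_int by blast
    have "f (v [^]\<^bsub>Zp p\<^esub> nat ((w * u) mod int p)) = f v [^]\<^bsub>?P\<^esub> nat ((w * u) mod int p)"
      by (rule f.hom_nat_pow[OF v(2)])
    moreover have "v [^]\<^bsub>Zp p\<^esub> nat ((w * u) mod int p) = u"
    proof -
      have "v [^]\<^bsub>Zp p\<^esub> nat ((w * u) mod int p) = ((w * u) mod int p * v) mod int p"
        using p0 by simp
      also have "\<dots> = (w * u * v) mod int p" by (rule mod_mult_left_eq)
      also have "\<dots> = (v * w * u) mod int p" by (simp only: mult_ac)
      also have "\<dots> = (1 * u) mod int p"
        using cong_scalar_right[OF w, of u] by (simp add: cong_def)
      finally show ?thesis using u' by simp
    qed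
    moreover have "f v [^]\<^bsub>?P\<^esub> n \<in> \<Psi> ` carrier HG" for n :: nat
      by (induction n) (simp_all only: P.nat_pow_0 P.nat_pow_Suc S.one_closed S.m_closed v(1))
    ultimately show ?thesis by simp
  qed
  have al: "\<alpha> (loop C (c x)) \<in> carrier (Zp p)" if "C \<in> V" "x \<in> X" for C x
    using alpha loop_closed c_closed that by (auto simp: hom_def)
  have "\<Psi> (loop C1 (c x1)) \<in> \<Psi> ` carrier HG" "\<Psi> (loop C2 (c x2)) \<in> \<Psi> ` carrier HG"
    using loop_closed c_closed C1 C2 by auto
  then have m: "prod_letter (Zp p) (Zp p) (Inl (\<alpha> (loop C1 (c x1)))) \<in> \<Psi> ` carrier HG"
    "prod_letter (Zp p) (Zp p) (Inr (\<alpha> (loop C2 (c x2)))) \<in> \<Psi> ` carrier HG"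
    using val[OF C1(1,3)] val[OF C2(1,3)] C1(2) C2(2) by simp_all
  have "\<Psi> ` carrier HG = carrier ?P"
    unfolding free_product_eq
  proof (rule word_quotient_subgroup_eq)
    show "subgroup (\<Psi> ` carrier HG) (word_quotient (prod_alphabet (Zp p) (Zp p)) (prod_relations (Zp p) (Zp p)))"
      using sub by (simp only: free_product_eq)
    fix a assume "a \<in> prod_alphabet (Zp p) (Zp p)"
    then consider u where "u \<in> carrier (Zp p)" "a = Inl u" | u where "u \<in> carrier (Zp p)" "a = Inr u"
      by (auto simp: prod_alphabet_def)
    then show "prod_letter (Zp p) (Zp p) a \<in> \<Psi> ` carrier HG"
    proof cases
      case 1
      then show ?thesis using all[OF il m(1) al[OF C1(1,3)] C1(4)] by blast
    next
      case 2
      then show ?thesis using all[OF ir m(2) al[OF C2(1,3)] C2(4)] by blast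
    qed
  qed
  then have "\<Psi> \<in> epi HG ?P" using Psi by (simp add: epi_def)
  then show ?thesis by blast
qed

text \<open>The pair of \<alpha> and \<beta> takes values in a group of order \<open>p ^ 2\<close>.
  Cutting it with \<open>\<iota>\<^sub>1\<close> inside \<open>D\<close> and
  \<open>\<iota>\<^sub>2\<close> outside provides the elements over \<open>u1\<close>,
  \<open>u2\<close> and \<open>u3\<close> from which \<open>free_target\<close> builds the two
  commutators.\<close>

lemma normal_onto_free:
  assumes p: "prime p"
    and alpha: "\<alpha> \<in> hom HG (Zp p)" "\<beta> \<in> hom HG (Zp p)"
    and triv: "\<And>C x. C \<in> bdry D relator_differences \<Longrightarrow> x \<in> X \<Longrightarrow> \<alpha> (loop C (c x)) = 0"
      "\<And>C x. C \<in> bdry D relator_differences \<Longrightarrow> x \<in> X \<Longrightarrow> \<beta> (loop C (c x)) = 0"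
    and C1: "C1 \<in> V" "C1 \<in> D" "x1 \<in> X" "u1 = (\<alpha> (loop C1 (c x1)), \<beta> (loop C1 (c x1)))"
    and C2: "C2 \<in> V" "C2 \<in> D" "x2 \<in> X" "u2 = (\<alpha> (loop C2 (c x2)), \<beta> (loop C2 (c x2)))"
    and C3: "C3 \<in> V" "C3 \<notin> D" "x3 \<in> X" "u3 = (\<alpha> (loop C3 (c x3)), \<beta> (loop C3 (c x3)))"
    and u: "u1 \<noteq> (0, 0)" "u2 \<noteq> (0, 0)" "u3 \<noteq> (0, 0)" "u1 \<noteq> u2"
  shows "\<exists>N. N \<lhd> HG \<and> (\<exists>k. card (rcosets\<^bsub>HG\<^esub> N) = p ^ k) \<and> onto_nonabelian_free (HG\<lparr>carrier := N\<rparr>)"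
proof -
  let ?M = "Zp p \<times>\<times> Zp p"
  have ab: "(\<alpha> h, \<beta> h) \<in> carrier ?M" if "h \<in> H" for h
    using alpha that by (auto simp: hom_def)
  interpret Z: comm_group "Zp p" by simp
  have cM: "comm_group ?M"
    by (rule group.group_comm_groupI) (auto intro: DirProd_group simp: add.commute)
  interpret M: comm_group ?M by (rule cM)
  have uM: "u1 \<in> carrier ?M" "u2 \<in> carrier ?M" "u3 \<in> carrier ?M"
    unfolding C1(4) C2(4) C3(4)
    by (intro ab loop_closed c_closed C1(1,3) C2(1,3) C3(1,3))+
  have "\<one>\<^bsub>?M\<^esub> = (0, 0)" by simp
  then have T: "free_target ?M u1 u2 u3"
    by (intro free_target.intro free_target_axioms.intro cM uM) (simp_all only: u not_False_eq_True)
  have ah: "(\<lambda>h. (\<alpha> h, \<beta> h)) \<in> hom HG ?M"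
    using alpha by (auto simp: hom_def)
  have tr: "(\<alpha> (loop C (c x)), \<beta> (loop C (c x))) = \<one>\<^bsub>?M\<^esub>"
    if "C \<in> bdry D relator_differences" "x \<in> X" for C x
    using triv(1)[OF that] triv(2)[OF that] by simp
  let ?W = "wreath free2 (?M \<times>\<times> ?M) (carrier ?M \<times> carrier ?M) (\<otimes>\<^bsub>?M \<times>\<times> ?M\<^esub>)"
  obtain \<Psi> where Psi: "\<Psi> \<in> hom HG ?W"
    and val: "\<And>C x. C \<in> V \<Longrightarrow> x \<in> X \<Longrightarrow> \<Psi> (loop C (c x)) =
        (if C \<in> D then free_target.\<iota>\<^sub>1 ?M u1 u2 u3 else free_target.\<iota>\<^sub>2 ?M) (\<alpha> (loop C (c x)), \<beta> (loop C (c x)))"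
    by (rule cut_hom[where D = D, OF free_target.group_W[OF T] M.is_group ah free_target.iota1_hom[OF T]
          free_target.iota2_hom[OF T]]) (erule (1) tr, rule that, assumption+)
  show ?thesis
  proof (rule free_target.onto_free[OF T group_HG Psi])
    show "loop C1 (c x1) \<in> carrier HG" "loop C2 (c x2) \<in> carrier HG" "loop C3 (c x3) \<in> carrier HG"
      using loop_closed c_closed C1 C2 C3 by auto
    show "\<Psi> (loop C1 (c x1)) = free_target.\<iota>\<^sub>1 ?M u1 u2 u3 u1" using val[OF C1(1,3)] C1 by simp
    show "\<Psi> (loop C2 (c x2)) = free_target.\<iota>\<^sub>1 ?M u1 u2 u3 u2" using val[OF C2(1,3)] C2 by simp
    show "\<Psi> (loop C3 (c x3)) = free_target.\<iota>\<^sub>2 ?M u3" using val[OF C3(1,3)] C3 by simp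
    show "order ?M = p ^ 2"
      using prime_gt_0_nat[OF p]
      by (simp add: order_def card_cartesian_product carrier_integer_mod_group power2_eq_square)
  qed (rule p)
qed

end

text \<open>Every coset of \<open>N\<close> in \<open>G\<close> is a coset of \<open>N\<close> in
  \<open>H\<close>, translated by the representative of a coset of \<open>H\<close>.\<close>

lemma (in group) finite_rcosets_trans:
  assumes H: "subgroup H G" "finite (rcosets H)"
    and N: "subgroup N (G\<lparr>carrier := H\<rparr>)" "finite (rcosets\<^bsub>G\<lparr>carrier := H\<rparr>\<^esub> N)"
  shows "subgroup N G" "finite (rcosets N)"
proof -
  show NG: "subgroup N G" using N(1) H(1) incl_subgroup by blast
  define t where "t C = (SOME g. g \<in> carrier G \<and> C = H #> g)" for C
  have t: "t C \<in> carrier G \<and> C = H #> t C" if "C \<in> rcosets H" for C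
  proof -
    have "\<exists>g. g \<in> carrier G \<and> C = H #> g" using rcoset_repr[OF H(1) that] by blast
    from someI_ex[OF this] show ?thesis by (simp add: t_def)
  qed
  have "rcosets N \<subseteq> (\<lambda>(K, C). K #> t C) ` ((rcosets\<^bsub>G\<lparr>carrier := H\<rparr>\<^esub> N) \<times> rcosets H)"
  proof
    fix K assume "K \<in> rcosets N"
    then obtain g where g: "g \<in> carrier G" "K = N #> g" by (rule rcoset_repr[OF NG])
    let ?C = "H #> g"
    have C: "?C \<in> rcosets H" using g H(1) by (intro rcosetsI) (auto dest: subgroup.subset)
    note tC = t[OF C]
    have h: "g \<otimes> inv (t ?C) \<in> H" using rcoset_eq_iff[OF H(1) g(1)] tC by blast
    have "N #> (g \<otimes> inv (t ?C)) \<in> rcosets\<^bsub>G\<lparr>carrier := H\<rparr>\<^esub> N"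
      using h by (auto simp: RCOSETS_def r_coset_def)
    moreover have "K = (N #> (g \<otimes> inv (t ?C))) #> t ?C"
      using g tC subgroup.subset[OF NG] by (simp add: coset_mult_assoc m_assoc)
    ultimately show "K \<in> (\<lambda>(K, C). K #> t C) ` ((rcosets\<^bsub>G\<lparr>carrier := H\<rparr>\<^esub> N) \<times> rcosets H)"
      using C by force
  qed
  then show "finite (rcosets N)" using H(2) N(2) by (meson finite_SigmaI finite_imageI finite_subset)
qed

section \<open>Homomorphisms to a group of prime order\<close>

text \<open>With value zero outside the carrier, such a function is determined by its values on the
  group, so \<open>card (homs p K)\<close> counts homomorphisms. The set is a vector space over the
  field with \<open>p\<close> elements, and its dimension is read off as the exponent in its
  cardinality.\<close>

definition homs :: "nat \<Rightarrow> ('a, 'b) monoid_scheme \<Rightarrow> ('a \<Rightarrow> int) set" where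
  "homs p K = {\<alpha> \<in> hom K (integer_mod_group p). \<forall>x. x \<notin> carrier K \<longrightarrow> \<alpha> x = 0}"

lemma homs_eqI:
  assumes "\<alpha> \<in> homs p K" "\<beta> \<in> homs p K" "\<And>x. x \<in> carrier K \<Longrightarrow> \<alpha> x = \<beta> x"
  shows "\<alpha> = \<beta>"
proof
  show "\<alpha> x = \<beta> x" for x
    using assms by (cases "x \<in> carrier K") (simp_all add: homs_def)
qed

lemma homs_hom: "\<alpha> \<in> homs p K \<Longrightarrow> \<alpha> \<in> hom K (integer_mod_group p)"
  by (simp add: homs_def)

lemma homs_range:
  assumes "p > 0" "\<alpha> \<in> homs p K"
  shows "0 \<le> \<alpha> x \<and> \<alpha> x < int p"
proof (cases "x \<in> carrier K")
  case True
  then have "\<alpha> x \<in> carrier (integer_mod_group p)" using assms(2) by (auto simp: homs_def hom_def)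
  then show ?thesis using assms(1) by (simp add: carrier_integer_mod_group)
qed (use assms in \<open>simp add: homs_def\<close>)

lemma homs_lincomb:
  assumes "p > 0" "monoid K" "\<alpha> \<in> homs p K" "\<beta> \<in> homs p K"
  shows "(\<lambda>x. (a * \<alpha> x + b * \<beta> x) mod int p) \<in> homs p K"
proof -
  interpret K: monoid K by fact
  have m: "\<alpha> (x \<otimes>\<^bsub>K\<^esub> y) = (\<alpha> x + \<alpha> y) mod int p" "\<beta> (x \<otimes>\<^bsub>K\<^esub> y) = (\<beta> x + \<beta> y) mod int p"
    if "x \<in> carrier K" "y \<in> carrier K" for x y
    using that hom_mult[OF homs_hom[OF assms(3)]] hom_mult[OF homs_hom[OF assms(4)]] by simp_all
  have e: "(a * ((u + v) mod int p) + b * ((s + t) mod int p)) mod int p =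
      ((a * u + b * s) mod int p + (a * v + b * t) mod int p) mod int p" for u v s t
  proof -
    have "[a * ((u + v) mod int p) + b * ((s + t) mod int p) = a * (u + v) + b * (s + t)] (mod int p)"
      by (intro cong_add cong_mult cong_refl) (simp_all add: cong_def)
    then show ?thesis unfolding cong_def mod_add_eq by (simp add: algebra_simps)
  qed
  have "(\<lambda>x. (a * \<alpha> x + b * \<beta> x) mod int p) \<in> hom K (integer_mod_group p)"
    by (rule homI) (use assms(1) in \<open>simp_all add: carrier_integer_mod_group m e\<close>)
  then show ?thesis using assms(3,4) by (simp add: homs_def)
qed

text \<open>Gaussian elimination, one coordinate at a time.\<close>

lemma finite_function_family:
  fixes L :: "('d \<Rightarrow> int) set"
  assumes p: "prime p"
    and "finite L" "L \<noteq> {}" "\<And>f x. f \<in> L \<Longrightarrow> 0 \<le> f x \<and> f x < int p"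
    and "\<And>f g a b. f \<in> L \<Longrightarrow> g \<in> L \<Longrightarrow> (\<lambda>x. (a * f x + b * g x) mod int p) \<in> L"
  shows "\<exists>xs. card L = p ^ length xs \<and> (\<forall>f\<in>L. (\<forall>x\<in>set xs. f x = 0) \<longrightarrow> (\<forall>x. f x = 0)) \<and>
    (\<forall>x\<in>set xs. \<exists>f\<in>L. f x \<noteq> 0)"
  using assms(2-)
proof (induction "card L" arbitrary: L rule: less_induct)
  case less
  note fin = less.prems(1) and ne = less.prems(2) and rng = less.prems(3) and lin = less.prems(4)
  have p1: "int p > 1" using prime_gt_1_nat[OF p] by simp
  obtain f0 where f0: "f0 \<in> L" using ne by blast
  have zero: "(\<lambda>x. 0) \<in> L" using lin[OF f0 f0, of 0 0] by simp
  show ?case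
  proof (cases "\<exists>f\<in>L. \<exists>x. f x \<noteq> 0")
    case False
    then have "L = {\<lambda>x. 0}" using zero by (auto intro!: ext)
    then show ?thesis by (intro exI[of _ "[]"]) simp
  next
    case True
    then obtain f x where f: "f \<in> L" "f x \<noteq> 0" by blast
    have "\<not> int p dvd f x" using rng[OF f(1), of x] f(2) zdvd_not_zless[of "f x" "int p"] by linarith
    moreover have "prime (int p)" using p by simp
    ultimately have "coprime (int p) (f x)" by (rule prime_imp_coprime[rotated])
    then have "coprime (f x) (int p)" by (simp add: coprime_commute)
    then obtain w where w: "[f x * w = 1] (mod int p)" using cong_solve_coprime_int by blast
    \<comment> \<open>Scaled to have value 1 at \<open>x\<close>; then \<open>L\<close> is the
      direct sum of the line through \<open>g\<close> and the members vanishing at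
      \<open>x\<close>.\<close>
    define g where "g y = (w * f y + 0 * f y) mod int p" for y
    have g: "g \<in> L" unfolding g_def by (rule lin[OF f(1) f(1)])
    have gx: "g x = 1" using w p1 by (simp add: g_def cong_def mult.commute)
    define L0 where "L0 = {h \<in> L. h x = 0}"
    define F where "F = (\<lambda>(a, h). (\<lambda>y. (a * g y + 1 * h y) mod int p) :: 'd \<Rightarrow> int)"
    have Fx: "F (a, h) x = a" if "a \<in> {0..<int p}" "h \<in> L0" for a h
      using that gx by (simp add: F_def L0_def)
    have bij: "bij_betw F ({0..<int p} \<times> L0) L"
    proof (rule bij_betw_imageI)
      show "inj_on F ({0..<int p} \<times> L0)"
      proof (rule inj_onI, clarify)
        fix a h a' h' assume *: "a \<in> {0..<int p}" "h \<in> L0" "a' \<in> {0..<int p}" "h' \<in> L0" "F (a, h) = F (a', h')"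
        then have a: "a = a'" using Fx by metis
        have "h y = h' y" for y
        proof -
          have "(a * g y + h y) mod int p = (a * g y + h' y) mod int p"
            using fun_cong[OF *(5), of y] a by (simp add: F_def)
          then have "h y mod int p = h' y mod int p" by (simp add: mod_eq_dvd_iff)
          moreover have "0 \<le> h y \<and> h y < int p" "0 \<le> h' y \<and> h' y < int p"
            using rng *(2,4) by (auto simp: L0_def)
          ultimately show ?thesis by simp
        qed
        then show "a = a' \<and> h = h'" using a by blast
      qed
      show "F ` ({0..<int p} \<times> L0) = L"
      proof
        show "F ` ({0..<int p} \<times> L0) \<subseteq> L"
        proof
          fix k assume "k \<in> F ` ({0..<int p} \<times> L0)"
          then obtain a h where ah: "h \<in> L0" "k = F (a, h)" by blast
          have "(\<lambda>y. (a * g y + 1 * h y) mod int p) \<in> L" by (rule lin[OF g]) (use ah in \<open>simp add: L0_def\<close>)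
          then show "k \<in> L" unfolding ah(2) F_def by simp
        qed
        show "L \<subseteq> F ` ({0..<int p} \<times> L0)"
        proof
          fix k assume k: "k \<in> L"
          define h where "h y = (1 * k y + (- k x) * g y) mod int p" for y
          have "h \<in> L" unfolding h_def by (rule lin[OF k g])
          then have h: "h \<in> L0" using gx by (simp add: L0_def h_def)
          have "F (k x, h) = k"
          proof
            fix y
            have "F (k x, h) y = (k x * g y + (k y - k x * g y)) mod int p"
              unfolding F_def h_def by (simp add: mod_add_right_eq)
            then show "F (k x, h) y = k y" using rng[OF k, of y] by simp
          qed
          then show "k \<in> F ` ({0..<int p} \<times> L0)" using h rng[OF k, of x] by (intro image_eqI[of _ _ "(k x, h)"]) auto
        qed
      qed
    qed
    have card: "card L = p * card L0" using bij_betw_same_card[OF bij] by (simp add: card_cartesian_product)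
    have "L0 \<subset> L" using f by (auto simp: L0_def)
    then have "card L0 < card L" by (rule psubset_card_mono[OF fin])
    moreover have "finite L0" "L0 \<noteq> {}" using fin zero by (auto simp: L0_def)
    moreover have "(\<lambda>y. (a * f y + b * g y) mod int p) \<in> L0" if "f \<in> L0" "g \<in> L0" for f g a b
      using that lin[of f g a b] by (simp add: L0_def)
    ultimately have "\<exists>xs. card L0 = p ^ length xs \<and> (\<forall>f\<in>L0. (\<forall>x\<in>set xs. f x = 0) \<longrightarrow> (\<forall>x. f x = 0)) \<and>
        (\<forall>x\<in>set xs. \<exists>f\<in>L0. f x \<noteq> 0)"
      using less.hyps[of L0] rng by (simp add: L0_def)
    then obtain xs where xs: "card L0 = p ^ length xs" "\<forall>f\<in>L0. (\<forall>x\<in>set xs. f x = 0) \<longrightarrow> (\<forall>x. f x = 0)"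
      "\<forall>x\<in>set xs. \<exists>f\<in>L0. f x \<noteq> 0"
      by blast
    show ?thesis
    proof (intro exI[of _ "x # xs"] conjI ballI impI)
      show "card L = p ^ length (x # xs)" using card xs(1) by simp
      fix h assume h: "h \<in> L" "\<forall>z\<in>set (x # xs). h z = 0"
      then have "h \<in> L0" "\<forall>z\<in>set xs. h z = 0" by (simp_all add: L0_def)
      then show "\<forall>z. h z = 0" using xs(2) by blast
    next
      fix z assume "z \<in> set (x # xs)"
      then consider "z = x" | "z \<in> set xs" by auto
      then show "\<exists>h\<in>L. h z \<noteq> 0"
      proof cases
        case 1
        then show ?thesis using f by blast
      next
        case 2
        then obtain h where "h \<in> L0" "h z \<noteq> 0" using xs(3) by blast
        then show ?thesis by (intro bexI[of _ h]) (simp_all add: L0_def)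
      qed
    qed
  qed
qed

lemma homs_zero: "p > 0 \<Longrightarrow> (\<lambda>x. 0) \<in> homs p K"
  by (auto simp: homs_def hom_def carrier_integer_mod_group)

text \<open>Evaluation at these elements is injective on a space of dimension
  \<open>length xs\<close>. They lie in the group because at each of them some homomorphism is
  non-zero.\<close>

lemma homs_separating:
  assumes "prime p" "monoid K" "finite (homs p K)"
  obtains xs where "card (homs p K) = p ^ length xs" "set xs \<subseteq> carrier K"
    "\<And>\<alpha>. \<alpha> \<in> homs p K \<Longrightarrow> (\<And>x. x \<in> set xs \<Longrightarrow> \<alpha> x = 0) \<Longrightarrow> \<alpha> = (\<lambda>x. 0)"
proof -
  have p0: "p > 0" using prime_gt_0_nat[OF assms(1)] .
  have "\<exists>xs. card (homs p K) = p ^ length xs \<and>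
      (\<forall>f\<in>homs p K. (\<forall>x\<in>set xs. f x = 0) \<longrightarrow> (\<forall>x. f x = 0)) \<and> (\<forall>x\<in>set xs. \<exists>f\<in>homs p K. f x \<noteq> 0)"
    using homs_zero[OF p0, of K]
    by (intro finite_function_family assms(1,3) homs_range[OF p0] homs_lincomb[OF p0 assms(2)]) blast+
  then obtain xs where xs: "card (homs p K) = p ^ length xs"
    "\<forall>f\<in>homs p K. (\<forall>x\<in>set xs. f x = 0) \<longrightarrow> (\<forall>x. f x = 0)" "\<forall>x\<in>set xs. \<exists>f\<in>homs p K. f x \<noteq> 0"
    by (elim exE conjE)
  show ?thesis
  proof (rule that[OF xs(1)])
    show "set xs \<subseteq> carrier K" using xs(3) by (force simp: homs_def)
  qed (use xs(2) in blast)
qed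

section \<open>Cocycles that are trivial on the edges of a path\<close>

context right_action
begin

text \<open>Triviality is assumed only on edges starting at vertices of the path. This local form
  will be applied to paths that avoid the support of a homomorphism.\<close>

lemma cocycle_path_trivial:
  assumes c: "c \<in> X \<rightarrow> carrier G" and M: "group M" and phi: "cocycle M \<phi>"
    and w: "w \<in> lists (free_alphabet X)" and v: "v \<in> V"
    and path: "\<And>k x. k \<le> length w \<Longrightarrow> x \<in> X \<Longrightarrow>
       \<phi> (act v (eval_word G (signed G c) (take k w))) (c x) = \<one>\<^bsub>M\<^esub>"
  shows "\<phi> v (eval_word G (signed G c) w) = \<one>\<^bsub>M\<^esub>"
  using w v path
proof (induction w arbitrary: v)
  case Nil
  show ?case using cocycle_one[OF M phi Nil(1)] by simp
next
  case (Cons a w)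
  interpret M: group M by (rule M)
  obtain x b where a: "a = (x, b)" "x \<in> X" using Cons.hyps(1) by auto
  have cx: "c x \<in> carrier G" using c a by auto
  have tk: "eval_word G (signed G c) (take k w) \<in> carrier G" for k
    by (rule eval_word_closed[OF signed_closed[OF c]]) (use Cons.hyps(2) in \<open>auto dest: in_set_takeD\<close>)
  have wG: "eval_word G (signed G c) w \<in> carrier G" using tk[of "length w"] by simp
  have sa: "signed G c a \<in> carrier G" using signed_closed[OF c] Cons.hyps(1) by (rule funcset_mem)
  note v = \<open>v \<in> V\<close>
  have IH: "\<phi> (act v (signed G c a)) (eval_word G (signed G c) w) = \<one>\<^bsub>M\<^esub>"
  proof (rule Cons.IH)
    show "act v (signed G c a) \<in> V" using v sa by simp
    fix k y assume "k \<le> length w" "y \<in> X"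
    then show "\<phi> (act (act v (signed G c a)) (eval_word G (signed G c) (take k w))) (c y) = \<one>\<^bsub>M\<^esub>"
      using Cons.prems(2)[of "Suc k" y] tk[of k] v sa by (simp add: act_mult)
  qed
  have e: "\<phi> v (signed G c a) = \<one>\<^bsub>M\<^esub>"
  proof (cases b)
    case True
    then show ?thesis using Cons.prems(2)[of 0 x] a v by (simp add: signed_def)
  next
    case False
    then have "\<phi> (act v (inv (c x))) (c x) = \<one>\<^bsub>M\<^esub>"
      using Cons.prems(2)[of 1 x] a v cx by (simp add: signed_def)
    then show ?thesis using False cocycle_inv[OF M phi v cx] a by (simp add: signed_def)
  qed
  show ?case using cocycle_mult[OF phi v sa wG] e IH by simp
qed

lemma cocycle_trivial:
  assumes pres: "presents G X c R" and M: "group M" and phi: "cocycle M \<phi>"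
    and gen: "\<And>v x. v \<in> V \<Longrightarrow> x \<in> X \<Longrightarrow> \<phi> v (c x) = \<one>\<^bsub>M\<^esub>"
    and v: "v \<in> V" and g: "g \<in> carrier G"
  shows "\<phi> v g = \<one>\<^bsub>M\<^esub>"
proof -
  have c: "c \<in> X \<rightarrow> carrier G"
    and im: "eval_word G (signed G c) ` lists (free_alphabet X) = carrier G"
    using pres[unfolded presents_def] by blast+
  obtain w where w: "w \<in> lists (free_alphabet X)" "g = eval_word G (signed G c) w" using im g by blast
  have tk: "eval_word G (signed G c) (take k w) \<in> carrier G" for k
    by (rule eval_word_closed[OF signed_closed[OF c]]) (use w in \<open>auto dest: in_set_takeD\<close>)
  show ?thesis
    unfolding w(2) by (rule cocycle_path_trivial[OF c M phi w(1) v]) (use gen tk v in simp)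
qed

end

lemma (in transversal) homs_cocycle:
  "\<alpha> \<in> homs p HG \<Longrightarrow> cocycle (integer_mod_group p) (\<lambda>C g. \<alpha> (loop C g))"
  by (rule cocycle_loop[OF homs_hom])

text \<open>The difference of \<alpha> and \<beta> gives a cocycle trivial on all generator edges,
  hence trivial everywhere; at the base coset this covers all of \<open>H\<close>. It is the
  statement that Schreier generators generate.\<close>

lemma (in schreier) homs_eq_generators:
  assumes "p > 0" "\<alpha> \<in> homs p HG" "\<beta> \<in> homs p HG"
    and eq: "\<And>C x. C \<in> V \<Longrightarrow> x \<in> X \<Longrightarrow> \<alpha> (loop C (c x)) = \<beta> (loop C (c x))"
  shows "\<alpha> = \<beta>"
proof (rule homs_eqI[OF assms(2,3)])
  fix h assume "h \<in> carrier HG"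
  then have h: "h \<in> H" by simp
  let ?\<gamma> = "\<lambda>x. (1 * \<alpha> x + (- 1) * \<beta> x) mod int p"
  have g: "?\<gamma> \<in> homs p HG" by (rule homs_lincomb[OF assms(1) group.is_monoid[OF group_HG] assms(2,3)])
  have "?\<gamma> (loop H h) = \<one>\<^bsub>integer_mod_group p\<^esub>"
    by (rule cocycle_trivial[OF pres group_integer_mod_group homs_cocycle[OF g]])
      (use eq base h subgroup.mem_carrier[OF sub] in simp_all)
  then have "(\<alpha> h - \<beta> h) mod int p = 0" unfolding loop_base[OF h] by simp
  then have "int p dvd \<alpha> h - \<beta> h" by (rule mod_0_imp_dvd)
  then have "\<alpha> h mod int p = \<beta> h mod int p" by (simp only: mod_eq_dvd_iff)
  then show "\<alpha> h = \<beta> h"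
    using homs_range[OF assms(1,2), of h] homs_range[OF assms(1,3), of h] by simp
qed

lemma (in schreier) finite_homs:
  assumes "p > 0" "finite X" "finite V"
  shows "finite (homs p HG)"
proof -
  let ?r = "\<lambda>\<alpha>. \<lambda>q\<in>V \<times> X. \<alpha> (loop (fst q) (c (snd q)))"
  have "inj_on ?r (homs p HG)"
  proof (rule inj_onI)
    fix \<alpha> \<beta> assume *: "\<alpha> \<in> homs p HG" "\<beta> \<in> homs p HG" "?r \<alpha> = ?r \<beta>"
    show "\<alpha> = \<beta>"
    proof (rule homs_eq_generators[OF assms(1) *(1,2)])
      fix C x assume "C \<in> V" "x \<in> X"
      then show "\<alpha> (loop C (c x)) = \<beta> (loop C (c x))" using fun_cong[OF *(3), of "(C, x)"] by simp
    qed
  qed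
  moreover have "?r ` homs p HG \<subseteq> (V \<times> X) \<rightarrow>\<^sub>E {0..<int p}"
    by (intro image_subsetI) (simp add: restrict_PiE_iff homs_range[OF assms(1)])
  moreover have "finite ((V \<times> X) \<rightarrow>\<^sub>E {0..<int p})" using assms by (intro finite_PiE) auto
  ultimately show ?thesis by (meson finite_imageD finite_subset)
qed

section \<open>Finite \<open>p\<close>-groups\<close>

lemma finite_card_prime_power:
  assumes "prime (p::nat)" "card A = p ^ k"
  shows "finite A"
proof -
  have "card A > 0" using assms prime_gt_0_nat by simp
  then show ?thesis by (rule card_ge_0_finite)
qed

text \<open>Orbit sizes are powers of \<open>p\<close>. The known fixed point contributes 1 to a
  total divisible by \<open>p\<close>, so the other orbits cannot all have size divisible by
  \<open>p\<close>.\<close>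

lemma (in right_action) fixed_point:
  assumes p: "prime p" and ord: "order G = p ^ k" and fin: "finite V" and dv: "p dvd card V"
    and x: "x \<in> V" "\<And>g. g \<in> carrier G \<Longrightarrow> act x g = x"
  shows "\<exists>y\<in>V. y \<noteq> x \<and> (\<forall>g\<in>carrier G. act y g = y)"
proof (rule ccontr)
  assume "\<not> ?thesis"
  then have nofix: "\<exists>g\<in>carrier G. act y g \<noteq> y" if "y \<in> V" "y \<noteq> x" for y using that by blast
  \<comment> \<open>The orbit-stabiliser theorem is available for left actions, hence the
    inverse.\<close>
  define \<phi> where "\<phi> g = (\<lambda>v\<in>V. act v (inv g))" for g
  have bij: "\<phi> g \<in> Bij V" if g: "g \<in> carrier G" for g
  proof -
    have "bij_betw (\<phi> g) V V"
      by (rule bij_betw_byWitness[of _ "\<lambda>v. act v g"]) (use g in \<open>auto simp: \<phi>_def\<close>)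
    then show ?thesis by (simp add: Bij_def \<phi>_def)
  qed
  have "\<phi> \<in> hom G (BijGroup V)"
  proof (rule homI)
    fix a b assume ab: "a \<in> carrier G" "b \<in> carrier G"
    show "\<phi> a \<in> carrier (BijGroup V)" using bij[OF ab(1)] by (simp add: BijGroup_def)
    show "\<phi> (a \<otimes> b) = \<phi> a \<otimes>\<^bsub>BijGroup V\<^esub> \<phi> b"
      using bij ab by (auto simp: BijGroup_def compose_def \<phi>_def inv_mult_group act_mult fun_eq_iff)
  qed
  then interpret A: group_action G V \<phi>
    by (simp add: group_action_def group_hom_def group_hom_axioms_def is_group group_BijGroup)
  let ?O = "orbits G V \<phi>"
  have orbx: "orbit G \<phi> x = {x}" unfolding orbit_def using x by (force simp: \<phi>_def)
  have xO: "{x} \<in> ?O" unfolding orbits_def using x(1) orbx by force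
  have "?O \<subseteq> Pow V" using A.orbits_coverture by blast
  then have finO: "finite ?O" using fin by (meson finite_Pow_iff finite_subset)
  have pd: "p dvd card q" if q: "q \<in> ?O" "q \<noteq> {x}" for q
  proof -
    obtain y where y: "y \<in> V" "q = orbit G \<phi> y" using q(1) by (auto simp: orbits_def)
    have "y \<noteq> x" using q(2) y(2) orbx by blast
    then obtain g where g: "g \<in> carrier G" "act y g \<noteq> y" using nofix y(1) by blast
    have "card q dvd p ^ k" unfolding y(2) ord[symmetric] A.orbit_stabilizer_theorem[OF y(1), symmetric] by simp
    then obtain j where j: "card q = p ^ j" using divides_primepow_nat[OF p] by blast
    have "j \<noteq> 0"
    proof
      assume "j = 0"
      then have "card q = 1" using j by simp
      then obtain z where z: "q = {z}" by (rule card_1_singletonE)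
      have "\<phi> \<one> y \<in> q" "\<phi> (inv g) y \<in> q" unfolding y(2) orbit_def using g by blast+
      then show False using z y g by (simp add: \<phi>_def)
    qed
    then show ?thesis using j by simp
  qed
  have "card V = (\<Sum>q\<in>?O. card q)" using A.disjoint_sum[OF fin, of "\<lambda>_. 1 :: nat"] by simp
  also have "\<dots> = 1 + (\<Sum>q\<in>?O - {{x}}. card q)" using sum.remove[OF finO xO, of card] by simp
  finally have "p dvd 1 + (\<Sum>q\<in>?O - {{x}}. card q)" using dv by simp
  moreover have "p dvd (\<Sum>q\<in>?O - {{x}}. card q)" by (rule dvd_sum) (use pd in blast)
  ultimately have "p dvd 1" by (simp only: dvd_add_left_iff)
  then show False using p not_prime_unit by blast
qed

lemma homs_from_hom:
  assumes "group K" "\<chi> \<in> hom K (integer_mod_group p)"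
  shows "(\<lambda>x. if x \<in> carrier K then \<chi> x else 0) \<in> homs p K"
proof -
  interpret K: group K by fact
  show ?thesis using assms(2) by (auto simp: homs_def hom_def)
qed

text \<open>The quotient has prime order, so the powers of any non-trivial coset identify it with
  the integers modulo \<open>p\<close>.\<close>

lemma index_p_homs:
  assumes p: "prime p" and M: "M \<lhd> K" and ind: "card (rcosets\<^bsub>K\<^esub> M) = p"
  obtains \<chi> where "\<chi> \<in> homs p K" "\<And>x. x \<in> carrier K \<Longrightarrow> \<chi> x = 0 \<longleftrightarrow> x \<in> M"
proof -
  interpret M: normal M K by fact
  interpret Q: group "K Mod M" by (rule M.factorgroup_is_group)
  let ?Q = "K Mod M"
  have p0: "p > 1" using prime_gt_1_nat[OF p] .
  have oQ: "order ?Q = p" using ind by (simp add: order_def FactGroup_def)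
  then have finQ: "finite (carrier ?Q)" by (intro finite_card_prime_power[OF p, of _ 1]) (simp add: order_def)
  have "\<not> carrier ?Q \<subseteq> {\<one>\<^bsub>?Q\<^esub>}"
    using oQ p0 card_mono[of "{\<one>\<^bsub>?Q\<^esub>}" "carrier ?Q"] by (auto simp: order_def)
  then obtain q where q: "q \<in> carrier ?Q" "q \<noteq> \<one>\<^bsub>?Q\<^esub>" by blast
  have "Q.ord q dvd p" using Q.ord_dvd_group_order[OF q(1)] oQ by simp
  moreover have "Q.ord q \<noteq> 1" using Q.ord_eq_1[OF q(1)] q(2) by simp
  ultimately have oq: "Q.ord q = p" using p unfolding prime_nat_iff by blast
  define f where "f k = q [^]\<^bsub>?Q\<^esub> (k::int)" for k
  have fh: "f \<in> hom (integer_mod_group p) ?Q"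
  proof (rule homI)
    fix a b
    show "f a \<in> carrier ?Q" using q by (simp add: f_def)
    have "f ((a + b) mod int p) = f (a + b)"
      unfolding f_def using q(1) oq by (simp add: Q.int_pow_eq dvd_minus_mod)
    also have "\<dots> = f a \<otimes>\<^bsub>?Q\<^esub> f b" unfolding f_def by (rule Q.int_pow_mult[OF q(1)])
    finally show "f (a \<otimes>\<^bsub>integer_mod_group p\<^esub> b) = f a \<otimes>\<^bsub>?Q\<^esub> f b" by simp
  qed
  have inj: "inj_on f (carrier (integer_mod_group p))"
  proof (rule inj_onI)
    fix a b assume ab: "a \<in> carrier (integer_mod_group p)" "b \<in> carrier (integer_mod_group p)" "f a = f b"
    have "int p dvd b - a" using ab(3) q(1) oq by (simp add: f_def Q.int_pow_eq)
    then have "b mod int p = a mod int p" by (simp add: mod_eq_dvd_iff)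
    then show "a = b" using ab(1,2) p0 by (simp add: carrier_integer_mod_group)
  qed
  have "f ` carrier (integer_mod_group p) = carrier ?Q"
  proof (rule card_subset_eq[OF finQ])
    show "f ` carrier (integer_mod_group p) \<subseteq> carrier ?Q" using fh by (auto simp: hom_def)
    show "card (f ` carrier (integer_mod_group p)) = card (carrier ?Q)"
      using card_image[OF inj] oQ p0 by (simp add: order_def carrier_integer_mod_group)
  qed
  then have fi: "f \<in> iso (integer_mod_group p) ?Q" using fh inj by (simp add: iso_def bij_betw_def)
  define g where "g = inv_into (carrier (integer_mod_group p)) f"
  have gi: "g \<in> iso ?Q (integer_mod_group p)"
    unfolding g_def by (rule group.iso_set_sym[OF group_integer_mod_group fi])
  then have gh: "g \<in> hom ?Q (integer_mod_group p)" by (simp add: iso_def)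
  interpret g: group_hom ?Q "integer_mod_group p" g
    using gh by (simp add: group_hom_def group_hom_axioms_def Q.is_group)
  have g0: "g y = 0 \<longleftrightarrow> y = M" if "y \<in> carrier ?Q" for y
    using g.iso_iff gi that g.hom_one by auto
  have ch: "g \<circ> (\<lambda>x. M #>\<^bsub>K\<^esub> x) \<in> hom K (integer_mod_group p)"
    by (rule hom_compose[OF M.r_coset_hom_Mod gh])
  show ?thesis
  proof (rule that[OF homs_from_hom[OF M.is_group ch]])
    fix x assume x: "x \<in> carrier K"
    then have "M #>\<^bsub>K\<^esub> x \<in> carrier ?Q" by (auto simp: carrier_FactGroup)
    from g0[OF this] have "g (M #>\<^bsub>K\<^esub> x) = 0 \<longleftrightarrow> M #>\<^bsub>K\<^esub> x = M" .
    also have "\<dots> \<longleftrightarrow> x \<in> M"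
      using M.coset_join1 M.coset_join2 x M.subgroup_axioms by blast
    finally show "(if x \<in> carrier K then (g \<circ> (\<lambda>x. M #>\<^bsub>K\<^esub> x)) x else 0) = 0 \<longleftrightarrow> x \<in> M"
      using x by simp
  qed
qed

text \<open>An injective self-map of a finite set is onto, so conjugation into \<open>M\<close> is
  conjugation onto \<open>M\<close>.\<close>

lemma (in group) conj_subgroup_finite:
  assumes M: "subgroup M G" "finite M" and g: "g \<in> carrier G" and le: "\<And>m. m \<in> M \<Longrightarrow> g \<otimes> m \<otimes> inv g \<in> M"
  shows "m \<in> M \<Longrightarrow> inv g \<otimes> m \<otimes> g \<in> M"
proof -
  assume m: "m \<in> M"
  let ?f = "\<lambda>m. g \<otimes> m \<otimes> inv g"
  have Mc: "\<And>m. m \<in> M \<Longrightarrow> m \<in> carrier G" using subgroup.mem_carrier[OF M(1)] .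
  have "inj_on ?f M" by (rule inj_onI) (use Mc g in simp)
  then have "?f ` M = M" using le M(2) by (intro card_subset_eq card_image) auto
  then obtain n where n: "n \<in> M" "m = ?f n" using m by blast
  have "inv g \<otimes> m \<otimes> g = n" unfolding n(2) using Mc[OF n(1)] g by (simp add: m_assoc) (simp flip: m_assoc)
  then show ?thesis using n(1) by simp
qed

text \<open>A proper subgroup of a finite \<open>p\<close>-group lies in a normal subgroup of index \<open>p\<close>.\<close>

lemma (in group) p_group_homs:
  assumes p: "prime p" and ord: "order G = p ^ k" and W: "subgroup W G" "W \<noteq> carrier G"
  obtains \<chi> x where "\<chi> \<in> homs p G" "\<And>w. w \<in> W \<Longrightarrow> \<chi> w = 0" "x \<in> carrier G" "\<chi> x \<noteq> 0"
proof -
  have fin: "finite (carrier G)" using finite_card_prime_power[OF p, of "carrier G" k] ord by (simp add: order_def)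
  let ?S = "{S. subgroup S G \<and> W \<subseteq> S \<and> S \<noteq> carrier G}"
  have "?S \<subseteq> Pow (carrier G)"
  proof
    fix S assume "S \<in> ?S"
    then have "subgroup S G" by simp
    from subgroup.subset[OF this] show "S \<in> Pow (carrier G)" by simp
  qed
  then have finS: "finite ?S" by (rule finite_subset) (simp add: fin)
  have "W \<in> ?S" using W by simp
  then have neS: "?S \<noteq> {}" by (metis empty_iff)
  \<comment> \<open>This maximal proper subgroup above \<open>W\<close> will turn out to be normal
    of index \<open>p\<close>.\<close>
  obtain M where "M \<in> ?S" "\<forall>b\<in>?S. M \<le> b \<longrightarrow> M = b"
    using finite_has_maximal[OF finS neS] by (elim bexE)
  then have M: "subgroup M G" "W \<subseteq> M" "M \<noteq> carrier G" and mx: "\<forall>b\<in>?S. M \<subseteq> b \<longrightarrow> M = b"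
    by simp_all
  have max: "S = carrier G" if S: "subgroup S G" "M \<subseteq> S" "S \<noteq> M" for S
  proof (rule ccontr)
    assume "S \<noteq> carrier G"
    then have "S \<in> ?S" using S M(2) by simp
    then have "M = S" using mx S(2) by blast
    then show False using S(3) by simp
  qed
  have Mc: "M \<subseteq> carrier G" by (rule subgroup.subset[OF M(1)])
  have finM: "finite M" using fin Mc finite_subset by blast
  have lag: "card (rcosets M) * card M = p ^ k" using lagrange[OF M(1)] ord by simp
  then have "card (rcosets M) dvd p ^ k" unfolding lag[symmetric] by simp
  then obtain j where j: "card (rcosets M) = p ^ j" using divides_primepow_nat[OF p] by blast
  have j0: "j \<noteq> 0"
  proof
    assume "j = 0"
    then have "card M = card (carrier G)" using lag j ord by (simp add: order_def)
    then show False using card_subset_eq[OF fin Mc] M(3) by blast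
  qed
  have "card M dvd p ^ k" unfolding lag[symmetric] by simp
  then obtain k' where k': "card M = p ^ k'" using divides_primepow_nat[OF p] by blast
  let ?M = "G\<lparr>carrier := M\<rparr>"
  interpret Mg: group ?M by (rule subgroup_imp_group[OF M(1)])
  interpret R: right_action G "rcosets M" "\<lambda>C g. C #> g" by (rule rcosets_right_action[OF M(1)])
  interpret RM: right_action ?M "rcosets M" "\<lambda>C g. C #> g"
    using Mc R.act_mult[OF _ subsetD[OF Mc] subsetD[OF Mc]] R.act_closed[OF _ subsetD[OF Mc]] R.act_one
    by unfold_locales simp_all
  \<comment> \<open>\<open>M\<close> acts on its own cosets, whose number is divisible by
    \<open>p\<close>, and fixes the base coset. A second fixed coset \<open>M #> g\<close> means
    that \<open>g\<close> normalises \<open>M\<close>.\<close>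
  have "\<exists>y\<in>rcosets M. y \<noteq> M \<and> (\<forall>g\<in>carrier ?M. y #> g = y)"
  proof (rule RM.fixed_point[OF p])
    show "order ?M = p ^ k'" using k' by (simp add: order_def)
    show "finite (rcosets M)" by (rule finite_card_prime_power[OF p j])
    show "p dvd card (rcosets M)" using j j0 by simp
    show "M \<in> rcosets M" by (rule subgroup_in_rcosets'[OF M(1)])
    show "M #> g = M" if "g \<in> carrier ?M" for g
      using coset_join2[OF _ M(1)] that Mc by auto
  qed
  then obtain y where "y \<in> rcosets M" "y \<noteq> M" "\<forall>g\<in>carrier ?M. y #> g = y" by (elim bexE conjE)
  then have y: "y \<in> rcosets M" "y \<noteq> M" "\<And>m. m \<in> M \<Longrightarrow> y #> m = y" by simp_all
  obtain g where g: "g \<in> carrier G" "y = M #> g" using rcoset_repr[OF M(1) y(1)] .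
  have gM: "g \<notin> M" using y(2) g coset_join2[OF g(1) M(1)] by blast
  have conj: "g \<otimes> m \<otimes> inv g \<in> M" if m: "m \<in> M" for m
  proof -
    have mc: "m \<in> carrier G" using m Mc by blast
    have "M #> (g \<otimes> m) = M #> g" using y(3)[OF m] g mc Mc by (simp add: coset_mult_assoc)
    then show ?thesis using rcoset_eq_iff[OF M(1), of "g \<otimes> m" g] g mc by simp
  qed
  \<comment> \<open>The normaliser contains \<open>M\<close> and the element \<open>g\<close>
    outside \<open>M\<close>; by maximality it is the whole group.\<close>
  define N where "N = {g \<in> carrier G. \<forall>m\<in>M. g \<otimes> m \<otimes> inv g \<in> M}"
  have "subgroup N G"
  proof (rule subgroupI)
    show "N \<subseteq> carrier G" by (auto simp: N_def)
    have "\<one> \<in> N" using Mc by (auto simp: N_def)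
    then show "N \<noteq> {}" by blast
    fix a assume a: "a \<in> N"
    then show "inv a \<in> N"
      using conj_subgroup_finite[OF M(1) finM, of a] by (simp add: N_def)
    fix b assume b: "b \<in> N"
    have ac: "a \<in> carrier G" and bc: "b \<in> carrier G" using a b by (simp_all add: N_def)
    show "a \<otimes> b \<in> N"
      unfolding N_def
    proof (intro CollectI conjI ballI)
      fix m assume m: "m \<in> M"
      then have mc: "m \<in> carrier G" using Mc by blast
      have "a \<otimes> (b \<otimes> m \<otimes> inv b) \<otimes> inv a \<in> M" using a b m by (simp add: N_def)
      then show "a \<otimes> b \<otimes> m \<otimes> inv (a \<otimes> b) \<in> M" using ac bc mc by (simp add: inv_mult_group m_assoc)
    qed (use ac bc in simp)
  qed
  moreover have "M \<subseteq> N"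
  proof
    fix x assume "x \<in> M"
    then show "x \<in> N"
      using Mc subgroup.m_closed[OF M(1)] subgroup.m_inv_closed[OF M(1)] unfolding N_def by blast
  qed
  moreover have "N \<noteq> M"
  proof -
    have "g \<in> N" using g(1) conj by (simp add: N_def)
    then show ?thesis using gM by blast
  qed
  ultimately have NG: "N = carrier G" by (rule max)
  have Mn: "M \<lhd> G"
    unfolding normal_inv_iff
  proof (intro conjI M(1) ballI)
    fix x m assume "x \<in> carrier G" "m \<in> M"
    then show "x \<otimes> m \<otimes> inv x \<in> M" unfolding NG[symmetric] by (simp add: N_def)
  qed
  interpret Mn: normal M G by fact
  interpret Q: group "G Mod M" by (rule Mn.factorgroup_is_group)
  let ?Q = "G Mod M"
  have oQ: "order ?Q = p ^ 1 * p ^ (j - 1)"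
    using j j0 by (cases j) (simp_all add: order_def FactGroup_def)
  then have finQ: "finite (carrier ?Q)" using finite_card_prime_power[OF p, of "carrier ?Q" "1 + (j - 1)"] by (simp only: order_def power_add)
  \<comment> \<open>The preimage of a subgroup of order \<open>p\<close> is strictly larger than
    \<open>M\<close>, hence everything; so the quotient itself has order \<open>p\<close>.\<close>
  obtain H where H: "subgroup H ?Q" "card H = p ^ 1" using sylow_thm[OF p Q.is_group oQ finQ] by blast
  interpret k: group_hom G ?Q "\<lambda>x. M #> x"
    using Mn.r_coset_hom_Mod by (simp add: group_hom_def group_hom_axioms_def is_group Q.is_group)
  define M' where "M' = {x \<in> carrier G. M #> x \<in> H}"
  have M's: "subgroup M' G"
  proof (rule subgroupI)
    show "M' \<subseteq> carrier G" by (auto simp: M'_def)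
    have "M #> \<one> \<in> H" using subgroup.one_closed[OF H(1)] Mc by simp
    then show "M' \<noteq> {}" unfolding M'_def by blast
    fix a assume "a \<in> M'"
    then have a: "a \<in> carrier G" "M #> a \<in> H" by (simp_all add: M'_def)
    from subgroup.m_inv_closed[OF H(1) a(2)] show "inv a \<in> M'"
      unfolding k.hom_inv[OF a(1), symmetric] using a(1) by (simp add: M'_def)
    fix b assume "b \<in> M'"
    then have b: "b \<in> carrier G" "M #> b \<in> H" by (simp_all add: M'_def)
    from subgroup.m_closed[OF H(1) a(2) b(2)] show "a \<otimes> b \<in> M'"
      unfolding k.hom_mult[OF a(1) b(1), symmetric] using a(1) b(1) by (simp add: M'_def)
  qed
  have "M \<subseteq> M'"
    using Mc coset_join2[OF _ M(1)] subgroup.one_closed[OF H(1)] by (auto simp: M'_def)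
  moreover have "M' \<noteq> M"
  proof
    assume eq: "M' = M"
    have "H \<subseteq> {M}"
    proof
      fix C assume C: "C \<in> H"
      then have "C \<in> carrier ?Q" using subgroup.subset[OF H(1)] by blast
      then obtain x where x: "x \<in> carrier G" "C = M #> x" by (auto simp: carrier_FactGroup)
      then have "x \<in> M'" using C by (simp add: M'_def)
      then show "C \<in> {M}" using coset_join2[OF x(1) M(1)] eq x(2) by simp
    qed
    then have "card H \<le> 1" using card_mono[of "{M}" H] by simp
    then show False using H(2) prime_gt_1_nat[OF p] by simp
  qed
  ultimately have M'G: "M' = carrier G" using max[OF M's] by blast
  have "carrier ?Q \<subseteq> H"
  proof
    fix C assume "C \<in> carrier ?Q"
    then obtain x where "x \<in> carrier G" "C = M #> x" unfolding carrier_FactGroup by blast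
    then show "C \<in> H" unfolding M'G[symmetric] by (simp add: M'_def)
  qed
  then have "H = carrier ?Q" using subgroup.subset[OF H(1)] by blast
  then have "card (rcosets M) = p" using H(2) by (simp add: FactGroup_def)
  then obtain \<chi> where chi: "\<chi> \<in> homs p G" "\<And>x. x \<in> carrier G \<Longrightarrow> \<chi> x = 0 \<longleftrightarrow> x \<in> M"
    using index_p_homs[OF p Mn] by blast
  have "\<chi> w = 0" if "w \<in> W" for w using chi(2) M(2) Mc that by blast
  moreover have "\<chi> g \<noteq> 0" using chi(2) g(1) gM by blast
  ultimately show ?thesis using that chi(1) g(1) by blast
qed

text \<open>Frattini's argument: a homomorphism on the normal subgroup \<open>K\<close> of \<open>p\<close>-power index induces a
  homomorphism of the whole group to the wreath product of \<open>\<int>/p\<close> with the quotient, a finite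
  \<open>p\<close>-group.\<close>

lemma (in group) homs_vanish_normal:
  assumes p: "prime p" and K: "K \<lhd> G" and ind: "card (rcosets K) = p ^ k" and U: "subgroup U G"
    and van: "\<And>\<chi>. \<chi> \<in> homs p G \<Longrightarrow> (\<And>u. u \<in> U \<Longrightarrow> \<chi> u = 0) \<Longrightarrow> \<chi> = (\<lambda>x. 0)"
    and alpha: "\<alpha> \<in> homs p (G\<lparr>carrier := K\<rparr>)" "\<And>u. u \<in> U \<Longrightarrow> u \<in> K \<Longrightarrow> \<alpha> u = 0"
  shows "\<alpha> = (\<lambda>x. 0)"
proof -
  interpret K: normal K G by fact
  interpret Q: group "G Mod K" by (rule K.factorgroup_is_group)
  let ?Q = "G Mod K" and ?Z = "integer_mod_group p"
  obtain \<tau> where "transversal G K \<tau>" using transversal_exists[OF K.subgroup_axioms] .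
  then interpret T: transversal G K \<tau> .
  interpret R: right_action ?Q "carrier ?Q" "(\<otimes>\<^bsub>?Q\<^esub>)" by unfold_locales (simp_all only: Q.m_assoc Q.m_closed Q.r_one)
  let ?W = "wreath ?Z ?Q (carrier ?Q) (\<otimes>\<^bsub>?Q\<^esub>)"
  interpret W: group ?W by (rule R.group_wreath) simp
  have cQ: "carrier ?Q = rcosets K" by (simp add: FactGroup_def)
  have KcQ: "K #> g \<in> carrier ?Q" if "g \<in> carrier G" for g using that by (auto simp: carrier_FactGroup)
  have act: "v \<otimes>\<^bsub>?Q\<^esub> (K #> g) = v #> g" if v: "v \<in> carrier ?Q" and g: "g \<in> carrier G" for v g
  proof -
    obtain x where x: "x \<in> carrier G" "v = K #> x" using v by (auto simp: carrier_FactGroup)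
    show ?thesis using x g K.rcos_sum K.subset by (simp add: coset_mult_assoc)
  qed
  have cl: "\<alpha> (T.loop v g) \<in> carrier ?Z" if "v \<in> carrier ?Q" "g \<in> carrier G" for v g
    using homs_hom[OF alpha(1)] T.loop_closed that by (auto simp: hom_def cQ)
  \<comment> \<open>The induced homomorphism: the cocycle of \<alpha> in the base and the quotient
    map on top.\<close>
  define h where "h g = (\<lambda>v\<in>carrier ?Q. \<alpha> (T.loop v g), K #> g)" for g
  have hh: "h \<in> hom G ?W"
  proof (rule homI)
    fix a b assume a: "a \<in> carrier G" and b: "b \<in> carrier G"
    show "h a \<in> carrier ?W" using a cl KcQ by (simp add: h_def wreath_simps)
    show "h (a \<otimes> b) = h a \<otimes>\<^bsub>?W\<^esub> h b"
    proof (rule prod_eqI)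
      show "snd (h (a \<otimes> b)) = snd (h a \<otimes>\<^bsub>?W\<^esub> h b)"
        using a b K.rcos_sum by (simp add: h_def wreath_simps)
      show "fst (h (a \<otimes> b)) = fst (h a \<otimes>\<^bsub>?W\<^esub> h b)"
      proof
        fix v show "fst (h (a \<otimes> b)) v = fst (h a \<otimes>\<^bsub>?W\<^esub> h b) v"
        proof (cases "v \<in> carrier ?Q")
          case True
          have e: "\<alpha> (T.loop v (a \<otimes> b)) = \<alpha> (T.loop v a) \<otimes>\<^bsub>?Z\<^esub> \<alpha> (T.loop (v #> a) b)"
            using T.cocycle_mult[OF T.homs_cocycle[OF alpha(1)]] True a b by (simp add: cQ)
          have va: "v #> a \<in> carrier ?Q" using True a T.act_closed by (simp add: cQ)
          show ?thesis
            using True va by (simp only: h_def wreath_simps fst_conv snd_conv restrict_apply'[OF True]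
                act[OF True a] restrict_apply'[OF va] e)
        qed (simp add: h_def wreath_simps)
      qed
    qed
  qed
  interpret h: group_hom G ?W h by (intro group_hom.intro group_hom_axioms.intro is_group W.is_group hh)
  have p0: "p > 0" using prime_gt_0_nat[OF p] .
  have cardQ: "card (carrier ?Q) = p ^ k" using ind by (simp add: cQ)
  then have finQ: "finite (carrier ?Q)" by (rule finite_card_prime_power[OF p])
  have oW: "order ?W = p ^ (card (carrier ?Q) + k)"
    using finQ p0 cardQ by (simp add: order_def wreath_simps card_cartesian_product card_PiE power_add carrier_integer_mod_group)
  have sub: "subgroup (h ` carrier G) ?W" by (rule h.img_is_subgroup)
  let ?P = "?W\<lparr>carrier := h ` carrier G\<rparr>"
  interpret P: group ?P by (rule W.subgroup_imp_group[OF sub])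
  have "card (h ` carrier G) dvd p ^ (card (carrier ?Q) + k)"
    using W.lagrange[OF sub] oW by (metis dvd_triv_right)
  then obtain n where n: "order ?P = p ^ n" using divides_primepow_nat[OF p] by (auto simp: order_def)
  have subU: "subgroup (h ` U) ?W" by (rule h.subgroup_img_is_subgroup[OF U])
  have subUP: "subgroup (h ` U) ?P"
    by (rule W.subgroup_incl[OF subU sub]) (use subgroup.subset[OF U] in blast)
  \<comment> \<open>A proper subgroup of the image, a finite \<open>p\<close>-group, would be killed
    by a non-zero homomorphism to the integers modulo \<open>p\<close>. Composed with
    \<open>h\<close>, it would contradict \<open>van\<close>.\<close>
  have hU: "h ` U = h ` carrier G"
  proof (rule ccontr)
    assume "h ` U \<noteq> h ` carrier G"
    then have ne: "h ` U \<noteq> carrier ?P" by simp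
    obtain \<chi> y where chi: "\<chi> \<in> homs p ?P" "\<And>w. w \<in> h ` U \<Longrightarrow> \<chi> w = 0" "y \<in> carrier ?P" "\<chi> y \<noteq> 0"
      using P.p_group_homs[OF p n subUP ne] by blast
    have hP: "h \<in> hom G ?P" using hh by (auto simp: hom_def)
    have ch: "\<chi> \<circ> h \<in> hom G ?Z" by (rule Group.hom_compose[OF hP homs_hom[OF chi(1)]])
    from homs_from_hom[OF is_group ch]
    have "(\<lambda>x. if x \<in> carrier G then (\<chi> \<circ> h) x else 0) = (\<lambda>x. 0)"
      by (rule van) (use chi(2) in simp)
    moreover obtain x where "x \<in> carrier G" "y = h x" using chi(3) by auto
    ultimately show False using chi(4) by (metis comp_apply)
  qed
  show ?thesis
  proof
    fix x
    show "\<alpha> x = 0"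
    proof (cases "x \<in> K")
      case True
      then have xG: "x \<in> carrier G" by simp
      \<comment> \<open>The top coordinate of \<open>h x = h u\<close> places \<open>u\<close> in
        \<open>K\<close>, and the base coordinate at the coset \<open>K\<close> gives
        \<open>\<alpha> x = \<alpha> u\<close>.\<close>
      then obtain u where u: "u \<in> U" "h x = h u" using hU by blast
      have uG: "u \<in> carrier G" using u(1) subgroup.mem_carrier[OF U] by blast
      have "K #> u = K" using arg_cong[OF u(2), of snd] T.base_stab[OF True] by (simp add: h_def)
      then have uK: "u \<in> K" using coset_join1 uG K.subgroup_axioms by blast
      have "\<alpha> (T.loop K x) = \<alpha> (T.loop K u)"
        using fun_cong[OF arg_cong[OF u(2), of fst], of K] T.base by (simp add: h_def cQ)
      then show ?thesis using alpha(2)[OF u(1) uK] T.loop_base True uK by simp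
    qed (use alpha(1) in \<open>simp add: homs_def\<close>)
  qed
qed

text \<open>The conclusion of \<open>homs_vanish_normal\<close> for \<open>U \<inter> Gs j\<close>
  is its hypothesis one step further down, so detection by \<open>U\<close> passes along the whole
  chain.\<close>

lemma (in group) homs_vanish_chain:
  assumes p: "prime p" and sub: "\<And>j. subgroup (Gs j) G"
    and nor: "\<And>j. Gs (Suc j) \<lhd> G\<lparr>carrier := Gs j\<rparr>"
    and ind: "\<And>j. \<exists>k. card (rcosets\<^bsub>G\<lparr>carrier := Gs j\<rparr>\<^esub> (Gs (Suc j))) = p ^ k"
    and U: "subgroup U G"
    and van: "\<And>\<chi>. \<chi> \<in> homs p (G\<lparr>carrier := Gs i\<rparr>) \<Longrightarrow> (\<And>u. u \<in> U \<inter> Gs i \<Longrightarrow> \<chi> u = 0) \<Longrightarrow> \<chi> = (\<lambda>x. 0)"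
    and "i \<le> j" "\<alpha> \<in> homs p (G\<lparr>carrier := Gs j\<rparr>)" "\<And>u. u \<in> U \<inter> Gs j \<Longrightarrow> \<alpha> u = 0"
  shows "\<alpha> = (\<lambda>x. 0)"
  using assms(7-9)
proof (induction arbitrary: \<alpha> rule: dec_induct)
  case base
  then show ?case using van by blast
next
  case (step j)
  let ?A = "G\<lparr>carrier := Gs j\<rparr>"
  interpret A: group ?A by (rule subgroup_imp_group[OF sub])
  obtain k where k: "card (rcosets\<^bsub>?A\<^esub> (Gs (Suc j))) = p ^ k" using ind by blast
  have UA: "subgroup (U \<inter> Gs j) ?A"
    by (rule subgroup_incl[OF subgroups_Inter_pair[OF U sub] sub]) simp
  show ?case
  proof (rule A.homs_vanish_normal[OF p nor k UA])
    fix \<chi> assume "\<chi> \<in> homs p ?A" "\<And>u. u \<in> U \<inter> Gs j \<Longrightarrow> \<chi> u = 0"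
    then show "\<chi> = (\<lambda>x. 0)" by (rule step.IH)
  next
    show "\<alpha> \<in> homs p (?A\<lparr>carrier := Gs (Suc j)\<rparr>)" using step.prems(1) by simp
    fix u assume "u \<in> U \<inter> Gs j" "u \<in> Gs (Suc j)"
    then show "\<alpha> u = 0" using step.prems(2) by blast
  qed
qed

section \<open>First homology and homomorphisms to \<open>\<int>/p\<close>\<close>

lemma (in group_hom) subgroup_preimage:
  assumes "subgroup S H"
  shows "subgroup {x \<in> carrier G. h x \<in> S} G"
  using subgroup.one_closed[OF assms] subgroup.m_closed[OF assms] subgroup.m_inv_closed[OF assms]
  by (intro G.subgroupI) (auto intro: exI[of _ "\<one>"])

text \<open>Modulo \<Phi> the group is elementary abelian but possibly infinite, so Zorn's lemma
  supplies a subgroup maximal among those above \<Phi> that avoid \<open>x\<close>. In the quotient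
  by it, every non-trivial subgroup contains the image of \<open>x\<close>; as non-trivial elements
  have order \<open>p\<close>, the quotient is cyclic of order \<open>p\<close>.\<close>

lemma (in group) homs_separate:
  assumes p: "prime p" and Phi: "subgroup \<Phi> G"
    and pow: "\<And>y. y \<in> carrier G \<Longrightarrow> y [^] p \<in> \<Phi>"
    and comm: "\<And>y z. y \<in> carrier G \<Longrightarrow> z \<in> carrier G \<Longrightarrow> y \<otimes> z \<otimes> inv y \<otimes> inv z \<in> \<Phi>"
    and x: "x \<in> carrier G" "x \<notin> \<Phi>"
  obtains \<chi> where "\<chi> \<in> homs p G" "\<And>y. y \<in> \<Phi> \<Longrightarrow> \<chi> y = 0" "\<chi> x \<noteq> 0"
proof -
  let ?A = "{S. subgroup S G \<and> \<Phi> \<subseteq> S \<and> x \<notin> S}"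
  have "\<exists>M\<in>?A. \<forall>S\<in>?A. M \<subseteq> S \<longrightarrow> S = M"
  proof (rule subset_Zorn_nonempty)
    have "\<Phi> \<in> ?A" using Phi x by simp
    then show "?A \<noteq> {}" by (rule ex_in_conv[THEN iffD1, OF exI])
    fix \<C> assume ne: "\<C> \<noteq> {}" and ch: "subset.chain ?A \<C>"
    have sub: "\<And>S. S \<in> \<C> \<Longrightarrow> S \<in> ?A" and lin: "\<And>S T. S \<in> \<C> \<Longrightarrow> T \<in> \<C> \<Longrightarrow> S \<subseteq> T \<or> T \<subseteq> S"
      using ch unfolding subset.chain_def by blast+
    obtain S0 where S0: "S0 \<in> \<C>" using ne by blast
    have sg: "\<And>S. S \<in> \<C> \<Longrightarrow> subgroup S G" using sub by blast
    have "subgroup (\<Union>\<C>) G"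
    proof (rule subgroupI)
      show "\<Union>\<C> \<subseteq> carrier G" using sg subgroup.subset by blast
      show "\<Union>\<C> \<noteq> {}" using S0 sg[OF S0] subgroup.one_closed by blast
      fix a assume "a \<in> \<Union>\<C>"
      then obtain S where S: "S \<in> \<C>" "a \<in> S" by blast
      then show "inv a \<in> \<Union>\<C>" using subgroup.m_inv_closed[OF sg[OF S(1)]] by blast
      fix b assume "b \<in> \<Union>\<C>"
      then obtain T where T: "T \<in> \<C>" "b \<in> T" by blast
      show "a \<otimes> b \<in> \<Union>\<C>"
      proof (cases "S \<subseteq> T")
        case True
        then have "a \<otimes> b \<in> T" using subgroup.m_closed[OF sg[OF T(1)]] S(2) T(2) by blast
        then show ?thesis using T(1) by blast
      next
        case False
        then have "T \<subseteq> S" using lin[OF S(1) T(1)] by blast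
        then have "a \<otimes> b \<in> S" using subgroup.m_closed[OF sg[OF S(1)]] S(2) T(2) by blast
        then show ?thesis using S(1) by blast
      qed
    qed
    moreover have "\<Phi> \<subseteq> \<Union>\<C>" using S0 sub[OF S0] by blast
    moreover have "x \<notin> \<Union>\<C>" using sub by blast
    ultimately show "\<Union>\<C> \<in> ?A" by simp
  qed
  then obtain M where "M \<in> ?A" and mx: "\<forall>S\<in>?A. M \<subseteq> S \<longrightarrow> S = M" by (elim bexE)
  then have M: "subgroup M G" "\<Phi> \<subseteq> M" "x \<notin> M" by simp_all
  have Mc: "M \<subseteq> carrier G" by (rule subgroup.subset[OF M(1)])
  have max: "x \<in> S" if S: "subgroup S G" "M \<subseteq> S" "S \<noteq> M" for S
  proof (rule ccontr)
    assume "x \<notin> S"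
    then have "S \<in> ?A" using S M(2) by simp
    then have "S = M" using mx S(2) by blast
    then show False using S(3) by simp
  qed
  have Mn: "M \<lhd> G"
    unfolding normal_inv_iff
  proof (intro conjI M(1) ballI)
    fix y m assume y: "y \<in> carrier G" and m: "m \<in> M"
    have mc: "m \<in> carrier G" using m Mc by blast
    have "y \<otimes> m \<otimes> inv y \<otimes> inv m \<in> M" using comm[OF y mc] M(2) by blast
    from subgroup.m_closed[OF M(1) this m] show "y \<otimes> m \<otimes> inv y \<in> M"
      using y mc by (simp add: m_assoc)
  qed
  interpret Mn: normal M G by fact
  interpret Q: group "G Mod M" by (rule Mn.factorgroup_is_group)
  let ?Q = "G Mod M"
  have kh: "(\<lambda>a. M #> a) \<in> hom G ?Q" by (rule Mn.r_coset_hom_Mod)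
  interpret k: group_hom G ?Q "\<lambda>a. M #> a"
    by (intro group_hom.intro group_hom_axioms.intro is_group Q.is_group kh)
  have cQ: "\<exists>y\<in>carrier G. q = M #> y" if "q \<in> carrier ?Q" for q
    using that unfolding carrier_FactGroup by blast
  have inM: "M #> y = \<one>\<^bsub>?Q\<^esub> \<longleftrightarrow> y \<in> M" if y: "y \<in> carrier G" for y
    using coset_join1[OF _ y M(1)] coset_join2[OF y M(1)] by auto
  have ordQ: "Q.ord q = p" if q: "q \<in> carrier ?Q" "q \<noteq> \<one>\<^bsub>?Q\<^esub>" for q
  proof -
    obtain y where y: "y \<in> carrier G" "q = M #> y" using cQ[OF q(1)] by blast
    have "q [^]\<^bsub>?Q\<^esub> p = M #> (y [^] p)" unfolding y(2) by (rule k.hom_nat_pow[OF y(1), symmetric])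
    also have "\<dots> = \<one>\<^bsub>?Q\<^esub>" using inM[of "y [^] p"] pow[OF y(1)] M(2) y(1) by blast
    finally have "Q.ord q dvd p" using Q.pow_eq_id[OF q(1)] by blast
    moreover have "Q.ord q \<noteq> 1" using Q.ord_eq_1[OF q(1)] q(2) by blast
    ultimately show ?thesis using p unfolding prime_nat_iff by blast
  qed
  have cardgen: "card (generate ?Q {q}) = p" if q: "q \<in> carrier ?Q" "q \<noteq> \<one>\<^bsub>?Q\<^esub>" for q
    using Q.generate_pow_card[OF q(1)] ordQ[OF q] by simp
  let ?x = "M #> x"
  have xQ: "?x \<in> carrier ?Q" using k.hom_closed[OF x(1)] .
  have x1: "?x \<noteq> \<one>\<^bsub>?Q\<^esub>" using inM[OF x(1)] M(3) by blast
  have all: "q \<in> generate ?Q {?x}" if q: "q \<in> carrier ?Q" for q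
  proof (cases "q = \<one>\<^bsub>?Q\<^esub>")
    case True
    then show ?thesis using generate.one[of ?Q] by simp
  next
    case False
    have sg: "subgroup (generate ?Q {q}) ?Q" using Q.generate_is_subgroup q by blast
    let ?S = "{a \<in> carrier G. M #> a \<in> generate ?Q {q}}"
    have S: "subgroup ?S G" by (rule k.subgroup_preimage[OF sg])
    have MS: "M \<subseteq> ?S"
    proof
      fix m assume m: "m \<in> M"
      then have mc: "m \<in> carrier G" using Mc by blast
      then have "M #> m = \<one>\<^bsub>?Q\<^esub>" using inM m by blast
      then show "m \<in> ?S" using mc generate.one[of ?Q "{q}"] by simp
    qed
    obtain y where y: "y \<in> carrier G" "q = M #> y" using cQ[OF q] by blast
    have "y \<in> ?S" using y generate.incl[of q "{q}" ?Q] by simp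
    moreover have "y \<notin> M" using False y inM by blast
    ultimately have "?S \<noteq> M" by blast
    then have "x \<in> ?S" by (rule max[OF S MS])
    then have "?x \<in> generate ?Q {q}" by simp
    then have "generate ?Q {?x} \<subseteq> generate ?Q {q}" using Q.generate_subgroup_incl[OF _ sg, of "{?x}"] by simp
    moreover have "finite (generate ?Q {q})"
      using cardgen[OF q False] prime_gt_0_nat[OF p] by (intro card_ge_0_finite) simp
    ultimately have geq: "generate ?Q {?x} = generate ?Q {q}"
      by (intro card_subset_eq) (simp_all add: cardgen[OF q False] cardgen[OF xQ x1])
    show ?thesis unfolding geq by (intro generate.incl) simp
  qed
  have "carrier ?Q = generate ?Q {?x}"
    using all Q.generate_incl[of "{?x}"] xQ by blast
  then have "card (rcosets M) = p" using cardgen[OF xQ x1] by (simp add: FactGroup_def)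
  then obtain \<chi> where chi: "\<chi> \<in> homs p G" "\<And>y. y \<in> carrier G \<Longrightarrow> \<chi> y = 0 \<longleftrightarrow> y \<in> M"
    using index_p_homs[OF p Mn] by blast
  show ?thesis
  proof (rule that[OF chi(1)])
    show "\<chi> y = 0" if "y \<in> \<Phi>" for y using chi(2) M(2) Mc that by blast
    show "\<chi> x \<noteq> 0" using chi(2)[OF x(1)] M(3) by simp
  qed
qed

lemma quotient_module_is_module:
  assumes M: "module K M" and B: "subgroup B (add_monoid M)"
    and smB: "\<forall>a\<in>carrier K. \<forall>b\<in>B. a \<odot>\<^bsub>M\<^esub> b \<in> B"
  shows "module K (quotient_module M B)"
    and "\<And>v. v \<in> carrier M \<Longrightarrow> B +>\<^bsub>M\<^esub> v \<in> carrier (quotient_module M B)"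
    and "carrier (quotient_module M B) = (\<lambda>v. B +>\<^bsub>M\<^esub> v) ` carrier M"
    and "\<And>u v. u \<in> carrier M \<Longrightarrow> v \<in> carrier M \<Longrightarrow>
      (B +>\<^bsub>M\<^esub> u) \<oplus>\<^bsub>quotient_module M B\<^esub> (B +>\<^bsub>M\<^esub> v) = B +>\<^bsub>M\<^esub> (u \<oplus>\<^bsub>M\<^esub> v)"
    and "\<And>a v. a \<in> carrier K \<Longrightarrow> v \<in> carrier M \<Longrightarrow>
      a \<odot>\<^bsub>quotient_module M B\<^esub> (B +>\<^bsub>M\<^esub> v) = B +>\<^bsub>M\<^esub> (a \<odot>\<^bsub>M\<^esub> v)"
    and "\<And>v. v \<in> B \<Longrightarrow> B +>\<^bsub>M\<^esub> v = \<zero>\<^bsub>quotient_module M B\<^esub>"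
proof -
  interpret M: module K M by (rule M)
  interpret B: abelian_subgroup B M
    by (rule abelian_subgroupI3) (simp_all add: additive_subgroup_def B M.abelian_group_axioms)
  let ?Q = "quotient_module M B"
  have Bc: "B \<subseteq> carrier M" using subgroup.subset[OF B] by simp
  have car: "carrier ?Q = (\<lambda>v. B +>\<^bsub>M\<^esub> v) ` carrier M"
    by (auto simp: quotient_module_def A_RCOSETS_def' )
  then show "carrier ?Q = (\<lambda>v. B +>\<^bsub>M\<^esub> v) ` carrier M" .
  show cl: "B +>\<^bsub>M\<^esub> v \<in> carrier ?Q" if "v \<in> carrier M" for v using that car by simp
  show add: "(B +>\<^bsub>M\<^esub> u) \<oplus>\<^bsub>?Q\<^esub> (B +>\<^bsub>M\<^esub> v) = B +>\<^bsub>M\<^esub> (u \<oplus>\<^bsub>M\<^esub> v)"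
    if "u \<in> carrier M" "v \<in> carrier M" for u v
    using B.a_rcos_sum[OF that] by (simp add: quotient_module_def)
  have zero: "\<zero>\<^bsub>?Q\<^esub> = B" by (simp add: quotient_module_def)
  show jB: "B +>\<^bsub>M\<^esub> v = \<zero>\<^bsub>?Q\<^esub>" if "v \<in> B" for v
    using M.a_coset_join2[of v B] that Bc B zero by auto
  have zero': "B +>\<^bsub>M\<^esub> \<zero>\<^bsub>M\<^esub> = \<zero>\<^bsub>?Q\<^esub>" by (rule jB) (use B.zero_closed in simp)
  show sm: "a \<odot>\<^bsub>?Q\<^esub> (B +>\<^bsub>M\<^esub> v) = B +>\<^bsub>M\<^esub> (a \<odot>\<^bsub>M\<^esub> v)" if a: "a \<in> carrier K" and v: "v \<in> carrier M" for a v
  proof -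
    have "B <+>\<^bsub>M\<^esub> (\<lambda>v. a \<odot>\<^bsub>M\<^esub> v) ` (B +>\<^bsub>M\<^esub> v) = B +>\<^bsub>M\<^esub> (a \<odot>\<^bsub>M\<^esub> v)"
    proof
      show "B <+>\<^bsub>M\<^esub> (\<lambda>v. a \<odot>\<^bsub>M\<^esub> v) ` (B +>\<^bsub>M\<^esub> v) \<subseteq> B +>\<^bsub>M\<^esub> (a \<odot>\<^bsub>M\<^esub> v)"
      proof
        fix z assume "z \<in> B <+>\<^bsub>M\<^esub> (\<lambda>v. a \<odot>\<^bsub>M\<^esub> v) ` (B +>\<^bsub>M\<^esub> v)"
        then obtain b b' where b: "b \<in> B" "b' \<in> B" "z = b \<oplus>\<^bsub>M\<^esub> (a \<odot>\<^bsub>M\<^esub> (b' \<oplus>\<^bsub>M\<^esub> v))"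
          by (auto simp: set_add_def set_mult_def a_r_coset_def r_coset_def)
        have "z = (b \<oplus>\<^bsub>M\<^esub> a \<odot>\<^bsub>M\<^esub> b') \<oplus>\<^bsub>M\<^esub> a \<odot>\<^bsub>M\<^esub> v"
          using b a v subsetD[OF Bc] by (simp add: M.smult_r_distr M.a_assoc)
        moreover have "b \<oplus>\<^bsub>M\<^esub> a \<odot>\<^bsub>M\<^esub> b' \<in> B" using b smB[rule_format, OF a b(2)] by (simp add: B.a_closed)
        ultimately show "z \<in> B +>\<^bsub>M\<^esub> (a \<odot>\<^bsub>M\<^esub> v)" by (auto simp: a_r_coset_def r_coset_def)
      qed
      show "B +>\<^bsub>M\<^esub> (a \<odot>\<^bsub>M\<^esub> v) \<subseteq> B <+>\<^bsub>M\<^esub> (\<lambda>v. a \<odot>\<^bsub>M\<^esub> v) ` (B +>\<^bsub>M\<^esub> v)"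
      proof
        fix z assume "z \<in> B +>\<^bsub>M\<^esub> (a \<odot>\<^bsub>M\<^esub> v)"
        then obtain b where b: "b \<in> B" "z = b \<oplus>\<^bsub>M\<^esub> a \<odot>\<^bsub>M\<^esub> v" by (auto simp: a_r_coset_def r_coset_def)
        have "v \<in> B +>\<^bsub>M\<^esub> v"
          using B.zero_closed v by (auto simp: a_r_coset_def r_coset_def intro!: bexI[of _ "\<zero>\<^bsub>M\<^esub>"])
        then show "z \<in> B <+>\<^bsub>M\<^esub> (\<lambda>v. a \<odot>\<^bsub>M\<^esub> v) ` (B +>\<^bsub>M\<^esub> v)"
          using b by (auto simp: set_add_def set_mult_def)
      qed
    qed
    then show ?thesis by (simp add: quotient_module_def)
  qed
  have rep: "\<exists>v\<in>carrier M. C = B +>\<^bsub>M\<^esub> v" if "C \<in> carrier ?Q" for C using that unfolding car by blast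
  show "module K ?Q"
  proof (rule moduleI)
    show "cring K" by (rule M.is_cring)
    show "abelian_group ?Q"
    proof (rule abelian_groupI)
      show "\<zero>\<^bsub>?Q\<^esub> \<in> carrier ?Q" using cl[of "\<zero>\<^bsub>M\<^esub>"] zero' by simp
      fix x assume "x \<in> carrier ?Q"
      then obtain u where u: "u \<in> carrier M" "x = B +>\<^bsub>M\<^esub> u" using rep by blast
      show "\<zero>\<^bsub>?Q\<^esub> \<oplus>\<^bsub>?Q\<^esub> x = x" unfolding zero'[symmetric] u(2) using add u(1) by simp
      have "(B +>\<^bsub>M\<^esub> (\<ominus>\<^bsub>M\<^esub> u)) \<oplus>\<^bsub>?Q\<^esub> x = \<zero>\<^bsub>?Q\<^esub>"
        unfolding u(2) using add[of "\<ominus>\<^bsub>M\<^esub> u" u] u(1) M.l_neg zero' by simp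
      then show "\<exists>y\<in>carrier ?Q. y \<oplus>\<^bsub>?Q\<^esub> x = \<zero>\<^bsub>?Q\<^esub>" by (rule bexI) (use cl u(1) in simp)
      fix y assume "y \<in> carrier ?Q"
      then obtain v where v: "v \<in> carrier M" "y = B +>\<^bsub>M\<^esub> v" using rep by blast
      show "x \<oplus>\<^bsub>?Q\<^esub> y \<in> carrier ?Q" unfolding u(2) v(2) using add cl u(1) v(1) by simp
      show "x \<oplus>\<^bsub>?Q\<^esub> y = y \<oplus>\<^bsub>?Q\<^esub> x" unfolding u(2) v(2) using add u(1) v(1) M.a_comm by simp
      fix z assume "z \<in> carrier ?Q"
      then obtain w where w: "w \<in> carrier M" "z = B +>\<^bsub>M\<^esub> w" using rep by blast
      show "x \<oplus>\<^bsub>?Q\<^esub> y \<oplus>\<^bsub>?Q\<^esub> z = x \<oplus>\<^bsub>?Q\<^esub> (y \<oplus>\<^bsub>?Q\<^esub> z)"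
        unfolding u(2) v(2) w(2) using add u(1) v(1) w(1) M.a_assoc by simp
    qed
    fix a x assume a: "a \<in> carrier K" and "x \<in> carrier ?Q"
    then obtain u where u: "u \<in> carrier M" "x = B +>\<^bsub>M\<^esub> u" using rep by blast
    show "a \<odot>\<^bsub>?Q\<^esub> x \<in> carrier ?Q" unfolding u(2) using sm cl a u(1) by simp
    {
      fix b assume b: "b \<in> carrier K"
      show "(a \<oplus>\<^bsub>K\<^esub> b) \<odot>\<^bsub>?Q\<^esub> x = a \<odot>\<^bsub>?Q\<^esub> x \<oplus>\<^bsub>?Q\<^esub> b \<odot>\<^bsub>?Q\<^esub> x"
        unfolding u(2) using sm add a b u(1) M.smult_l_distr by simp
      show "(a \<otimes>\<^bsub>K\<^esub> b) \<odot>\<^bsub>?Q\<^esub> x = a \<odot>\<^bsub>?Q\<^esub> (b \<odot>\<^bsub>?Q\<^esub> x)"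
        unfolding u(2) using sm a b u(1) M.smult_assoc1 by simp
    }
    fix y assume "y \<in> carrier ?Q"
    then obtain v where v: "v \<in> carrier M" "y = B +>\<^bsub>M\<^esub> v" using rep by blast
    show "a \<odot>\<^bsub>?Q\<^esub> (x \<oplus>\<^bsub>?Q\<^esub> y) = a \<odot>\<^bsub>?Q\<^esub> x \<oplus>\<^bsub>?Q\<^esub> a \<odot>\<^bsub>?Q\<^esub> y"
      unfolding u(2) v(2) using sm add a u(1) v(1) M.smult_r_distr by simp
  next
    fix x assume "x \<in> carrier ?Q"
    then obtain u where u: "u \<in> carrier M" "x = B +>\<^bsub>M\<^esub> u" using rep by blast
    show "\<one>\<^bsub>K\<^esub> \<odot>\<^bsub>?Q\<^esub> x = x" unfolding u(2) using sm u(1) by simp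
  qed
qed

section \<open>The bar complex in low degrees\<close>

locale bar = K: cring K + G: group G
  for K :: "('r, 'm) ring_scheme" (structure) and G :: "('g, 'b) monoid_scheme"
begin

abbreviation chains where "chains n \<equiv> bar_chains K G n"
abbreviation bd where "bd n \<equiv> bar_boundary K G n"

lemma chains_carrier:
  "c \<in> carrier (chains n) \<longleftrightarrow> (\<forall>w. c w \<in> carrier K) \<and> finite {w. c w \<noteq> \<zero>} \<and>
     (\<forall>w. c w \<noteq> \<zero> \<longrightarrow> w \<in> lists (carrier G) \<and> length w = n)"
  by (auto simp: bar_chains_def)

lemma chains_simps:
  "\<zero>\<^bsub>chains n\<^esub> = (\<lambda>w. \<zero>)" "c \<oplus>\<^bsub>chains n\<^esub> d = (\<lambda>w. c w \<oplus> d w)" "a \<odot>\<^bsub>chains n\<^esub> c = (\<lambda>w. a \<otimes> c w)"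
  by (simp_all add: bar_chains_def)

lemma chains_closed:
  assumes "c \<in> carrier (chains n)"
  shows "d \<in> carrier (chains n) \<Longrightarrow> (\<lambda>w. c w \<oplus> d w) \<in> carrier (chains n)"
    and "a \<in> carrier K \<Longrightarrow> (\<lambda>w. a \<otimes> c w) \<in> carrier (chains n)"
proof -
  note c = assms[unfolded chains_carrier]
  show "(\<lambda>w. c w \<oplus> d w) \<in> carrier (chains n)" if "d \<in> carrier (chains n)"
  proof -
    note d = that[unfolded chains_carrier]
    have "{w. c w \<oplus> d w \<noteq> \<zero>} \<subseteq> {w. c w \<noteq> \<zero>} \<union> {w. d w \<noteq> \<zero>}" by auto
    then have fin: "finite {w. c w \<oplus> d w \<noteq> \<zero>}" using c d by (meson finite_UnI finite_subset)
    have "c w \<noteq> \<zero> \<or> d w \<noteq> \<zero>" if "c w \<oplus> d w \<noteq> \<zero>" for w using that by auto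
    then show ?thesis unfolding chains_carrier using c d fin by (metis K.a_closed)
  qed
  show "(\<lambda>w. a \<otimes> c w) \<in> carrier (chains n)" if a: "a \<in> carrier K"
  proof -
    have "{w. a \<otimes> c w \<noteq> \<zero>} \<subseteq> {w. c w \<noteq> \<zero>}" using a by auto
    then have fin: "finite {w. a \<otimes> c w \<noteq> \<zero>}" using c by (meson finite_subset)
    have "c w \<noteq> \<zero>" if "a \<otimes> c w \<noteq> \<zero>" for w using that a by auto
    then show ?thesis unfolding chains_carrier using c a fin by (metis K.m_closed)
  qed
qed

lemma chains_module: "module K (chains n)"
proof (rule moduleI)
  show "cring K" by (rule K.is_cring)
  have cK: "c w \<in> carrier K" if "c \<in> carrier (chains n)" for c w using that by (simp add: chains_carrier)
  show "abelian_group (chains n)"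
  proof (rule abelian_groupI)
    show "\<zero>\<^bsub>chains n\<^esub> \<in> carrier (chains n)" by (simp add: chains_carrier chains_simps)
    fix x assume x: "x \<in> carrier (chains n)"
    have "(\<lambda>w. \<ominus> \<one> \<otimes> x w) \<oplus>\<^bsub>chains n\<^esub> x = \<zero>\<^bsub>chains n\<^esub>"
      using cK[OF x] by (simp add: chains_simps K.l_minus K.l_neg)
    moreover have "(\<lambda>w. \<ominus> \<one> \<otimes> x w) \<in> carrier (chains n)" by (rule chains_closed(2)[OF x]) simp
    ultimately show "\<exists>y\<in>carrier (chains n). y \<oplus>\<^bsub>chains n\<^esub> x = \<zero>\<^bsub>chains n\<^esub>"
      by (rule bexI)
    show "\<zero>\<^bsub>chains n\<^esub> \<oplus>\<^bsub>chains n\<^esub> x = x" using cK[OF x] by (simp add: chains_simps)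
    fix y assume y: "y \<in> carrier (chains n)"
    show "x \<oplus>\<^bsub>chains n\<^esub> y \<in> carrier (chains n)" using chains_closed(1)[OF x y] by (simp add: chains_simps)
    show "x \<oplus>\<^bsub>chains n\<^esub> y = y \<oplus>\<^bsub>chains n\<^esub> x" using cK[OF x] cK[OF y] by (simp add: chains_simps K.a_comm)
    fix z assume z: "z \<in> carrier (chains n)"
    show "x \<oplus>\<^bsub>chains n\<^esub> y \<oplus>\<^bsub>chains n\<^esub> z = x \<oplus>\<^bsub>chains n\<^esub> (y \<oplus>\<^bsub>chains n\<^esub> z)"
      using cK[OF x] cK[OF y] cK[OF z] by (simp add: chains_simps K.a_assoc)
  qed
next
  fix a x assume "a \<in> carrier K" "x \<in> carrier (chains n)"
  then show "a \<odot>\<^bsub>chains n\<^esub> x \<in> carrier (chains n)" using chains_closed(2) by (simp add: chains_simps)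
qed (simp_all add: chains_simps chains_carrier K.l_distr K.r_distr K.m_assoc)

text \<open>The coefficient of the tuple \<open>v\<close> in the boundary of the basis chain
  \<open>w\<close>, with coinciding faces added up.\<close>

definition face_sum :: "nat \<Rightarrow> 'g list \<Rightarrow> 'g list \<Rightarrow> 'r" where
  "face_sum n w v = (\<Oplus>i\<in>{..n}. if bar_face G i w = v then (\<ominus> \<one>) [^] i else \<zero>)"

lemma face_sum_closed [simp]: "face_sum n w v \<in> carrier K"
  unfolding face_sum_def by (rule K.finsum_closed) auto

lemma finsum_product:
  assumes "finite S" "finite T" "\<And>w i. w \<in> S \<Longrightarrow> i \<in> T \<Longrightarrow> f (w, i) \<in> carrier K"
  shows "finsum K f (S \<times> T) = (\<Oplus>w\<in>S. \<Oplus>i\<in>T. f (w, i))"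
  using assms(1,3)
proof (induction S rule: finite_induct)
  case (insert w S)
  have "insert w S \<times> T = (Pair w ` T) \<union> (S \<times> T)" by blast
  then have "finsum K f (insert w S \<times> T) = finsum K f (Pair w ` T) \<oplus> finsum K f (S \<times> T)"
    using insert assms(2) by (simp only:) (rule K.add.finprod_Un_disjoint; auto)
  also have "finsum K f (Pair w ` T) = (\<Oplus>i\<in>T. f (w, i))"
    by (rule K.add.finprod_reindex) (use insert in \<open>auto simp: inj_on_def\<close>)
  also have "finsum K f (S \<times> T) = (\<Oplus>w\<in>S. \<Oplus>i\<in>T. f (w, i))"
    using insert by blast
  finally show ?case
    using insert by (subst K.finsum_insert) (auto intro!: K.finsum_closed)
qed simp

text \<open>\<open>S\<close> may exceed the support, so that two chains can be expanded over a
  common index set when linearity is proved.\<close>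

lemma boundary_eq:
  assumes c: "\<And>w. c w \<in> carrier K" and S: "finite S" "{w. c w \<noteq> \<zero>} \<subseteq> S"
  shows "bd n c v = (\<Oplus>w\<in>S. c w \<otimes> face_sum n w v)"
proof -
  let ?g = "\<lambda>(w, i). if bar_face G i w = v then (\<ominus> \<one>) [^] i \<otimes> c w else \<zero>"
  have "bd n c v = finsum K ?g (S \<times> {..n})"
    unfolding bar_boundary_def
    by (rule K.add.finprod_mono_neutral_cong_left)
      (use S c in \<open>auto split: if_splits\<close>)
  also have "\<dots> = (\<Oplus>w\<in>S. \<Oplus>i\<in>{..n}. ?g (w, i))"
    using S(1) c by (intro finsum_product) auto
  also have "\<dots> = (\<Oplus>w\<in>S. c w \<otimes> face_sum n w v)"
  proof (rule K.finsum_cong')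
    fix w assume "w \<in> S"
    have "(\<Oplus>i\<in>{..n}. ?g (w, i)) = (\<Oplus>i\<in>{..n}. c w \<otimes> (if bar_face G i w = v then (\<ominus> \<one>) [^] i else \<zero>))"
      by (rule K.finsum_cong') (use c K.m_comm in auto)
    also have "\<dots> = c w \<otimes> face_sum n w v"
      unfolding face_sum_def by (rule K.finsum_rdistr[symmetric]) (use c in auto)
    finally show "(\<Oplus>i\<in>{..n}. ?g (w, i)) = c w \<otimes> face_sum n w v" .
  qed (use c in auto)
  finally show ?thesis .
qed

lemma boundary_add:
  assumes "c \<in> carrier (chains n)" "d \<in> carrier (chains n)"
  shows "bd n (\<lambda>w. c w \<oplus> d w) = (\<lambda>v. bd n c v \<oplus> bd n d v)"
proof
  fix v
  let ?S = "{w. c w \<noteq> \<zero>} \<union> {w. d w \<noteq> \<zero>}"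
  have c: "\<And>w. c w \<in> carrier K" and d: "\<And>w. d w \<in> carrier K" and S: "finite ?S"
    using assms by (simp_all add: chains_carrier)
  have "bd n (\<lambda>w. c w \<oplus> d w) v = (\<Oplus>w\<in>?S. (c w \<oplus> d w) \<otimes> face_sum n w v)"
    by (rule boundary_eq) (use c d S in auto)
  also have "\<dots> = (\<Oplus>w\<in>?S. c w \<otimes> face_sum n w v \<oplus> d w \<otimes> face_sum n w v)"
    by (rule K.finsum_cong') (use c d in \<open>auto simp: K.l_distr\<close>)
  also have "\<dots> = (\<Oplus>w\<in>?S. c w \<otimes> face_sum n w v) \<oplus> (\<Oplus>w\<in>?S. d w \<otimes> face_sum n w v)"
    by (rule K.finsum_addf) (use c d in auto)
  also have "\<dots> = bd n c v \<oplus> bd n d v"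
    using boundary_eq[OF c S, where n = n and v = v] boundary_eq[OF d S, where n = n and v = v] by simp
  finally show "bd n (\<lambda>w. c w \<oplus> d w) v = bd n c v \<oplus> bd n d v" .
qed

lemma boundary_smult:
  assumes "c \<in> carrier (chains n)" and a: "a \<in> carrier K"
  shows "bd n (\<lambda>w. a \<otimes> c w) = (\<lambda>v. a \<otimes> bd n c v)"
proof
  fix v
  let ?S = "{w. c w \<noteq> \<zero>}"
  have c: "\<And>w. c w \<in> carrier K" and S: "finite ?S"
    using assms by (simp_all add: chains_carrier)
  have "bd n (\<lambda>w. a \<otimes> c w) v = (\<Oplus>w\<in>?S. a \<otimes> c w \<otimes> face_sum n w v)"
    by (rule boundary_eq) (use c a S in auto)
  also have "\<dots> = (\<Oplus>w\<in>?S. a \<otimes> (c w \<otimes> face_sum n w v))"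
    by (rule K.finsum_cong') (use c a in \<open>auto simp: K.m_assoc\<close>)
  also have "\<dots> = a \<otimes> (\<Oplus>w\<in>?S. c w \<otimes> face_sum n w v)"
    by (rule K.finsum_rdistr[symmetric]) (use c a S in auto)
  also have "\<dots> = a \<otimes> bd n c v" using boundary_eq[OF c S, where n = n and v = v] by simp
  finally show "bd n (\<lambda>w. a \<otimes> c w) v = a \<otimes> bd n c v" .
qed

text \<open>Both faces of a 1-tuple are the empty tuple and enter with opposite signs. With trivial
  coefficients every 1-chain is thus a cycle, and \<open>H1\<close> consists of chains modulo
  boundaries.\<close>

lemma boundary1: "c \<in> carrier (chains 1) \<Longrightarrow> bd 1 c = (\<lambda>v. \<zero>)"
proof
  fix v assume c: "c \<in> carrier (chains 1)"
  have fs: "face_sum 1 w v = \<zero>" if len: "length w = 1" for w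
  proof -
    obtain g where w: "w = [g]" using len by (auto simp: length_Suc_conv)
    have "{..1::nat} = {0, 1}" by auto
    then show ?thesis by (simp add: face_sum_def bar_face_def w K.r_neg)
  qed
  have "bd 1 c v = (\<Oplus>w\<in>{w. c w \<noteq> \<zero>}. c w \<otimes> face_sum 1 w v)"
    by (rule boundary_eq) (use c in \<open>simp_all add: chains_carrier\<close>)
  also have "\<dots> = (\<Oplus>w\<in>{w. c w \<noteq> \<zero>}. \<zero>)"
    by (rule K.finsum_cong') (use c fs in \<open>auto simp: chains_carrier\<close>)
  finally show "bd 1 c v = \<zero>" by simp
qed

lemma face_closed:
  assumes "w \<in> lists (carrier G)" "length w = Suc n" "n > 0" "i \<le> Suc n"
  shows "bar_face G i w \<in> lists (carrier G) \<and> length (bar_face G i w) = n"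
proof -
  have tk: "take j w \<in> lists (carrier G)" "drop j w \<in> lists (carrier G)" for j
    using assms(1) by (auto dest: in_set_takeD in_set_dropD)
  consider "i = 0" | "i = Suc n" | "0 < i" "i < Suc n" using assms(4) by linarith
  then show ?thesis
  proof cases
    case 1
    then show ?thesis using tk(2)[of 1] assms(2) by (simp add: bar_face_def drop_Suc)
  next
    case 2
    then show ?thesis using tk(1)[of n] assms(2) by (simp add: bar_face_def butlast_conv_take)
  next
    case 3
    have "w ! (i - 1) \<in> carrier G" "w ! i \<in> carrier G" using assms(1,2) 3 by auto
    then show ?thesis using 3 tk assms(2) by (simp add: bar_face_def)
  qed
qed

lemma boundary2_closed:
  assumes c: "c \<in> carrier (chains 2)"
  shows "bd 2 c \<in> carrier (chains 1)"
proof -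
  let ?S = "{w. c w \<noteq> \<zero>}"
  have cK: "\<And>w. c w \<in> carrier K" and fin: "finite ?S"
    and supp: "\<And>w. c w \<noteq> \<zero> \<Longrightarrow> w \<in> lists (carrier G) \<and> length w = 2"
    using c unfolding chains_carrier by blast+
  have eq: "bd 2 c v = (\<Oplus>w\<in>?S. c w \<otimes> face_sum 2 w v)" for v
    by (rule boundary_eq) (use cK fin in auto)
  have cl: "bd 2 c v \<in> carrier K" for v
    unfolding eq by (rule K.finsum_closed) (use cK in auto)
  have out: "\<exists>w\<in>?S. \<exists>i\<in>{..2}. v = bar_face G i w" if nz: "bd 2 c v \<noteq> \<zero>" for v
  proof (rule ccontr)
    assume no: "\<not> ?thesis"
    have "face_sum 2 w v = \<zero>" if "w \<in> ?S" for w
    proof -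
      have "face_sum 2 w v = (\<Oplus>i\<in>{..2::nat}. \<zero>)"
        unfolding face_sum_def by (rule K.finsum_cong') (use no that in auto)
      then show ?thesis by simp
    qed
    then have "bd 2 c v = (\<Oplus>w\<in>?S. \<zero>)"
      unfolding eq by (intro K.finsum_cong') (use cK in auto)
    then show False using nz by simp
  qed
  have "{v. bd 2 c v \<noteq> \<zero>} \<subseteq> (\<lambda>(w, i). bar_face G i w) ` (?S \<times> {..2})"
    using out by fastforce
  then have "finite {v. bd 2 c v \<noteq> \<zero>}"
    by (rule finite_subset) (use fin in simp)
  moreover have "v \<in> lists (carrier G) \<and> length v = 1" if nz: "bd 2 c v \<noteq> \<zero>" for v
  proof -
    obtain w i where w: "c w \<noteq> \<zero>" "i \<le> 2" "v = bar_face G i w" using out[OF nz] by auto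
    show ?thesis unfolding w(3) using face_closed[of w 1 i] supp[OF w(1)] w(2) by (simp add: numeral_2_eq_2)
  qed
  ultimately show ?thesis using cl unfolding chains_carrier by blast
qed

definition single :: "'g list \<Rightarrow> 'g list \<Rightarrow> 'r" where
  "single w = (\<lambda>v. if v = w then \<one> else \<zero>)"

lemma single_closed: "w \<in> lists (carrier G) \<Longrightarrow> length w = n \<Longrightarrow> single w \<in> carrier (chains n)"
  unfolding chains_carrier single_def by (auto intro: finite_subset[of _ "{w}"])

lemma boundary_single2:
  assumes "g \<in> carrier G" "h \<in> carrier G"
  shows "bd 2 (single [g, h]) = (\<lambda>v. single [h] v \<ominus> single [g \<otimes>\<^bsub>G\<^esub> h] v \<oplus> single [g] v)"
proof
  fix v
  have "bd 2 (single [g, h]) v = (\<Oplus>w\<in>{[g, h]}. single [g, h] w \<otimes> face_sum 2 w v)"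
    by (rule boundary_eq) (auto simp: single_def)
  also have "\<dots> = face_sum 2 [g, h] v" by (simp add: single_def)
  also have "\<dots> = single [h] v \<ominus> single [g \<otimes>\<^bsub>G\<^esub> h] v \<oplus> single [g] v"
  proof -
    have s: "{..2::nat} = {0, 1, 2}" by auto
    have sq: "(\<ominus> \<one>) [^] (2::nat) = \<one>" by (simp add: numeral_2_eq_2 K.l_minus)
    show ?thesis
      unfolding face_sum_def s
      by (simp add: bar_face_def single_def sq a_minus_def K.a_ac eq_commute[of v])
  qed
  finally show "bd 2 (single [g, h]) v = single [h] v \<ominus> single [g \<otimes>\<^bsub>G\<^esub> h] v \<oplus> single [g] v" .
qed

abbreviation B where "B \<equiv> bd 2 ` carrier (chains 2)"
abbreviation H1 where "H1 \<equiv> group_homology_1 K G"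
abbreviation cls where "cls c \<equiv> B +>\<^bsub>chains 1\<^esub> c"

lemma H1_eq: "H1 = quotient_module (chains 1) B"
proof -
  have "{c \<in> carrier (chains 1). bd 1 c = \<zero>\<^bsub>chains 0\<^esub>} = carrier (chains 1)"
    using boundary1 by (auto simp: chains_simps)
  then show ?thesis by (simp add: group_homology_1_def)
qed

lemma B_subgroup: "subgroup B (add_monoid (chains 1))"
proof -
  interpret C1: module K "chains 1" by (rule chains_module)
  interpret C2: module K "chains 2" by (rule chains_module)
  show ?thesis
  proof (rule C1.add.subgroupI)
    show "B \<subseteq> carrier (chains 1)" using boundary2_closed by blast
    have "\<zero>\<^bsub>chains 2\<^esub> \<in> carrier (chains 2)" by simp
    then show "B \<noteq> {}" by blast
    fix a assume "a \<in> B"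
    then obtain c where c: "c \<in> carrier (chains 2)" "a = bd 2 c" by blast
    have "\<ominus>\<^bsub>chains 1\<^esub> a = (\<ominus> \<one>) \<odot>\<^bsub>chains 1\<^esub> a"
      using C1.smult_l_minus[of "\<one>" a] boundary2_closed[OF c(1)] c(2) by (simp del: One_nat_def)
    also have "\<dots> = bd 2 (\<lambda>w. \<ominus> \<one> \<otimes> c w)" using boundary_smult[OF c(1)] c(2) by (simp add: chains_simps)
    finally show "\<ominus>\<^bsub>chains 1\<^esub> a \<in> B"
      using chains_closed(2)[OF c(1), of "\<ominus> \<one>"] by blast
    fix b assume "b \<in> B"
    then obtain d where d: "d \<in> carrier (chains 2)" "b = bd 2 d" by blast
    have "a \<oplus>\<^bsub>chains 1\<^esub> b = bd 2 (\<lambda>w. c w \<oplus> d w)"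
      unfolding c(2) d(2) chains_simps using boundary_add[OF c(1) d(1)] by simp
    then show "a \<oplus>\<^bsub>chains 1\<^esub> b \<in> B"
      using chains_closed(1)[OF c(1) d(1)] by blast
  qed
qed

lemma B_smult: "\<forall>a\<in>carrier K. \<forall>b\<in>B. a \<odot>\<^bsub>chains 1\<^esub> b \<in> B"
proof (intro ballI)
  fix a b assume a: "a \<in> carrier K" and "b \<in> B"
  then obtain c where c: "c \<in> carrier (chains 2)" "b = bd 2 c" by blast
  have "a \<odot>\<^bsub>chains 1\<^esub> b = bd 2 (\<lambda>w. a \<otimes> c w)"
    unfolding c(2) chains_simps boundary_smult[OF c(1) a] ..
  then show "a \<odot>\<^bsub>chains 1\<^esub> b \<in> B" using chains_closed(2)[OF c(1) a] by blast
qed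

lemmas H1_facts = quotient_module_is_module[OF chains_module B_subgroup B_smult, folded H1_eq]

text \<open>The boundary of the 2-chain \<open>[g, h]\<close> is
  \<open>[h] - [g h] + [g]\<close>.\<close>

lemma class_mult:
  assumes g: "g \<in> carrier G" "h \<in> carrier G"
  shows "cls (single [g \<otimes>\<^bsub>G\<^esub> h]) = cls (single [g]) \<oplus>\<^bsub>H1\<^esub> cls (single [h])"
proof -
  interpret H: module K H1 by (rule H1_facts(1))
  let ?b = "bd 2 (single [g, h])"
  have s: "single [g] \<in> carrier (chains 1)" "single [h] \<in> carrier (chains 1)" "single [g \<otimes>\<^bsub>G\<^esub> h] \<in> carrier (chains 1)"
    by (rule single_closed; use g in simp)+
  have sgh: "single [g, h] \<in> carrier (chains 2)" by (rule single_closed) (use g in simp_all)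
  have bB: "?b \<in> B" using sgh by blast
  have bc: "?b \<in> carrier (chains 1)" by (rule boundary2_closed[OF sgh])
  have sK: "single w v \<in> carrier K" for w v by (simp add: single_def)
  have e: "x \<ominus> y \<oplus> z \<oplus> y = z \<oplus> x" if "x \<in> carrier K" "y \<in> carrier K" "z \<in> carrier K" for x y z
  proof -
    have "x \<ominus> y \<oplus> z \<oplus> y = x \<oplus> (\<ominus> y \<oplus> (y \<oplus> z))"
      using that by (simp add: K.minus_eq K.a_assoc K.a_comm[of z])
    also have "\<dots> = z \<oplus> x" using that by (simp add: K.r_neg1 K.a_comm)
    finally show ?thesis .
  qed
  have "?b \<oplus>\<^bsub>chains 1\<^esub> single [g \<otimes>\<^bsub>G\<^esub> h] = single [g] \<oplus>\<^bsub>chains 1\<^esub> single [h]"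
    unfolding chains_simps boundary_single2[OF g] by (intro ext e sK)
  then have "cls ?b \<oplus>\<^bsub>H1\<^esub> cls (single [g \<otimes>\<^bsub>G\<^esub> h]) = cls (single [g]) \<oplus>\<^bsub>H1\<^esub> cls (single [h])"
    unfolding H1_facts(4)[OF bc s(3)] H1_facts(4)[OF s(1,2)] by simp
  then show ?thesis using H1_facts(6)[OF bB] H1_facts(2)[OF s(3)] by simp
qed

lemma class_hom: "(\<lambda>g. cls (single [g])) \<in> hom G (add_monoid H1)"
proof (rule homI)
  fix x y assume "x \<in> carrier G" "y \<in> carrier G"
  then show "cls (single [x \<otimes>\<^bsub>G\<^esub> y]) = cls (single [x]) \<otimes>\<^bsub>add_monoid H1\<^esub> cls (single [y])"
    using class_mult by simp
next
  fix x assume "x \<in> carrier G"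
  then have "single [x] \<in> carrier (chains 1)" by (intro single_closed) simp_all
  from H1_facts(2)[OF this] show "cls (single [x]) \<in> carrier (add_monoid H1)" by simp
qed

lemma class_in_span:
  assumes N: "\<zero>\<^bsub>H1\<^esub> \<in> N" "\<And>x y. x \<in> N \<Longrightarrow> y \<in> N \<Longrightarrow> x \<oplus>\<^bsub>H1\<^esub> y \<in> N"
      "\<And>a x. a \<in> carrier K \<Longrightarrow> x \<in> N \<Longrightarrow> a \<odot>\<^bsub>H1\<^esub> x \<in> N"
    and gen: "\<And>g. g \<in> carrier G \<Longrightarrow> cls (single [g]) \<in> N"
  shows "carrier H1 \<subseteq> N"
proof -
  have "cls c \<in> N" if fin: "finite S" and c: "c \<in> carrier (chains 1)" "{w. c w \<noteq> \<zero>} \<subseteq> S" for S c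
    using fin c
  proof (induction S arbitrary: c rule: finite_induct)
    case empty
    interpret C1: module K "chains 1" by (rule chains_module)
    have "c = \<zero>\<^bsub>chains 1\<^esub>" using empty by (auto simp: chains_simps)
    then have "c \<in> B" using subgroup.one_closed[OF B_subgroup] by simp
    from H1_facts(6)[OF this] show ?case using N(1) by (rule ssubst)
  next
    case (insert w S)
    show ?case
    proof (cases "c w = \<zero>")
      case True
      then have "{w. c w \<noteq> \<zero>} \<subseteq> S" using insert.prems(2) by blast
      then show ?thesis by (rule insert.IH[OF insert.prems(1)])
    next
      case False
      then have wl: "w \<in> lists (carrier G)" "length w = 1" and cK: "\<And>v. c v \<in> carrier K"
        using insert.prems(1) unfolding chains_carrier by blast+
      then obtain g where g: "w = [g]" "g \<in> carrier G" by (auto simp: length_Suc_conv)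
      define d where "d = (\<lambda>v. if v = w then \<zero> else c v)"
      have dsub: "{v. d v \<noteq> \<zero>} \<subseteq> {v. c v \<noteq> \<zero>} - {w}" by (auto simp: d_def)
      have dc: "d \<in> carrier (chains 1)"
        unfolding chains_carrier
      proof (intro conjI allI)
        show "d v \<in> carrier K" for v using cK by (simp add: d_def)
        show "finite {w. d w \<noteq> \<zero>}"
          using dsub insert.prems(1) unfolding chains_carrier by (meson finite_Diff finite_subset)
        show "d v \<noteq> \<zero> \<longrightarrow> v \<in> lists (carrier G) \<and> length v = 1" for v
          using insert.prems(1) unfolding chains_carrier d_def by simp
      qed
      have dN: "cls d \<in> N" by (rule insert.IH[OF dc]) (use dsub insert.prems(2) in blast)
      have sc: "single w \<in> carrier (chains 1)" by (rule single_closed[OF wl])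
      have smc: "c w \<odot>\<^bsub>chains 1\<^esub> single w \<in> carrier (chains 1)"
        using chains_closed(2)[OF sc cK] by (simp add: chains_simps)
      have "c = d \<oplus>\<^bsub>chains 1\<^esub> (c w \<odot>\<^bsub>chains 1\<^esub> single w)"
        using cK by (auto simp: chains_simps d_def single_def)
      then have "cls c = cls d \<oplus>\<^bsub>H1\<^esub> (c w \<odot>\<^bsub>H1\<^esub> cls (single w))"
        using H1_facts(4)[OF dc smc] H1_facts(5)[OF cK sc] by simp
      then show ?thesis using N(2)[OF dN N(3)[OF cK[of w] gen[OF g(2)]]] g(1) by simp
    qed
  qed
  note cl = this
  show ?thesis
  proof
    fix x assume "x \<in> carrier H1"
    then obtain c where c: "c \<in> carrier (chains 1)" "x = cls c" unfolding H1_facts(3) by (rule imageE)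
    have "finite {w. c w \<noteq> \<zero>}" using c(1) unfolding chains_carrier by (rule conjunct1[OF conjunct2])
    from cl[OF this c(1) order_refl] show "x \<in> N" using c(2) by simp
  qed
qed

end

text \<open>The elements whose class lies in the span of the classes of \<open>xs\<close> form a
  subgroup containing all commutators and \<open>p\<close>-th powers. Were it proper,
  \<open>homs_separate\<close> would yield a non-zero homomorphism vanishing on \<open>xs\<close>;
  so these classes span. The inequality passes linear growth, a lower bound on
  \<open>dim_H1_mod\<close>, on to the number of homomorphisms.\<close>

lemma dim_H1_mod_le:
  assumes p: "prime p" and G: "group G" and xs: "set xs \<subseteq> carrier G"
    and sep: "\<And>\<alpha>. \<alpha> \<in> homs p G \<Longrightarrow> (\<And>x. x \<in> set xs \<Longrightarrow> \<alpha> x = 0) \<Longrightarrow> \<alpha> = (\<lambda>x. 0)"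
  shows "dim_H1_mod p G \<le> length xs"
proof -
  define K where "K = residue_ring (int p)"
  have rp: "residues_prime p" using p by (simp add: residues_prime_def)
  have fK: "field K" unfolding K_def by (rule residues_prime.is_field[OF rp])
  interpret K: field K by (rule fK)
  interpret bar K G by (intro bar.intro K.is_cring G)
  interpret H: module K H1 by (rule H1_facts(1))
  interpret V: vectorspace K H1 by (intro vectorspace.intro H1_facts(1) fK)
  interpret k: group_hom G "add_monoid H1" "\<lambda>g. cls (single [g])"
    by (intro group_hom.intro group_hom_axioms.intro G H.add.is_group class_hom)
  define A where "A = (\<lambda>g. cls (single [g])) ` set xs"
  have Ac: "A \<subseteq> carrier H1" unfolding A_def using k.hom_closed xs by auto
  have spm: "LinearCombinations.submodule K (H.span A) H1" by (rule H.span_is_submodule[OF Ac])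
  have spc: "H.span A \<subseteq> carrier H1" by (rule H.span_is_subset2[OF Ac])
  have sp0: "\<zero>\<^bsub>H1\<^esub> \<in> H.span A"
    and spa: "\<And>x y. x \<in> H.span A \<Longrightarrow> y \<in> H.span A \<Longrightarrow> x \<oplus>\<^bsub>H1\<^esub> y \<in> H.span A"
    and sps: "\<And>a x. a \<in> carrier K \<Longrightarrow> x \<in> H.span A \<Longrightarrow> a \<odot>\<^bsub>H1\<^esub> x \<in> H.span A"
    using spm unfolding LinearCombinations.submodule_def by blast+
  have spi: "\<ominus>\<^bsub>H1\<^esub> x \<in> H.span A" if x: "x \<in> H.span A" for x
  proof -
    have "\<ominus>\<^bsub>H1\<^esub> x = (\<ominus>\<^bsub>K\<^esub> \<one>\<^bsub>K\<^esub>) \<odot>\<^bsub>H1\<^esub> x"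
      using H.smult_l_minus[of "\<one>\<^bsub>K\<^esub>" x] subsetD[OF spc x] by simp
    then show ?thesis using sps[OF _ x, of "\<ominus>\<^bsub>K\<^esub> \<one>\<^bsub>K\<^esub>"] by simp
  qed
  have sub: "subgroup (H.span A) (add_monoid H1)"
    by (rule H.add.subgroupI) (use spc sp0 spa spi in blast)+
  define \<Phi> where "\<Phi> = {g \<in> carrier G. cls (single [g]) \<in> H.span A}"
  have Phi: "subgroup \<Phi> G" unfolding \<Phi>_def by (rule k.subgroup_preimage[OF sub])
  have PhiG: "\<Phi> = carrier G"
  proof (rule ccontr)
    assume "\<Phi> \<noteq> carrier G"
    then obtain x where x: "x \<in> carrier G" "x \<notin> \<Phi>" using subgroup.subset[OF Phi] by blast
    have ker: "g \<in> \<Phi>" if "g \<in> carrier G" "cls (single [g]) = \<zero>\<^bsub>H1\<^esub>" for g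
      using that sp0 by (simp add: \<Phi>_def)
    have pow: "y [^]\<^bsub>G\<^esub> p \<in> \<Phi>" if y: "y \<in> carrier G" for y
    proof (rule ker)
      let ?c = "cls (single [y])"
      have yc: "?c \<in> carrier H1" using k.hom_closed[OF y] by simp
      have "[p] \<cdot>\<^bsub>K\<^esub> \<one>\<^bsub>K\<^esub> = \<zero>\<^bsub>K\<^esub>"
      proof -
        have "[n] \<cdot>\<^bsub>K\<^esub> \<one>\<^bsub>K\<^esub> = int n mod int p" for n
          using prime_gt_1_nat[OF p]
          by (induction n) (simp_all add: K_def residue_ring_def add_pow_def nat_pow_def mod_simps add.commute)
        then show ?thesis by (simp add: K_def residue_ring_def)
      qed
      moreover have "[n] \<cdot>\<^bsub>H1\<^esub> ?c = ([n] \<cdot>\<^bsub>K\<^esub> \<one>\<^bsub>K\<^esub>) \<odot>\<^bsub>H1\<^esub> ?c" for n :: nat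
        using yc by (induction n) (simp_all add: H.smult_l_distr)
      ultimately have "[p] \<cdot>\<^bsub>H1\<^esub> ?c = \<zero>\<^bsub>H1\<^esub>" using yc by simp
      then show "cls (single [y [^]\<^bsub>G\<^esub> p]) = \<zero>\<^bsub>H1\<^esub>"
        using k.hom_nat_pow[OF y, of p] by (simp add: add_pow_def)
    qed (use y in simp)
    have comm: "y \<otimes>\<^bsub>G\<^esub> z \<otimes>\<^bsub>G\<^esub> inv\<^bsub>G\<^esub> y \<otimes>\<^bsub>G\<^esub> inv\<^bsub>G\<^esub> z \<in> \<Phi>" if y: "y \<in> carrier G" and z: "z \<in> carrier G" for y z
    proof (rule ker)
      have "cls (single [y \<otimes>\<^bsub>G\<^esub> z \<otimes>\<^bsub>G\<^esub> inv\<^bsub>G\<^esub> y \<otimes>\<^bsub>G\<^esub> inv\<^bsub>G\<^esub> z]) =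
          cls (single [y]) \<oplus>\<^bsub>H1\<^esub> cls (single [z]) \<oplus>\<^bsub>H1\<^esub> (\<ominus>\<^bsub>H1\<^esub> cls (single [y])) \<oplus>\<^bsub>H1\<^esub> (\<ominus>\<^bsub>H1\<^esub> cls (single [z]))"
        using y z k.hom_mult k.hom_inv by (simp add: a_inv_def)
      also have "\<dots> = \<zero>\<^bsub>H1\<^esub>"
      proof -
        have c: "cls (single [y]) \<in> carrier H1" "cls (single [z]) \<in> carrier H1"
          using k.hom_closed[OF y] k.hom_closed[OF z] by simp_all
        have "a \<oplus>\<^bsub>H1\<^esub> b \<oplus>\<^bsub>H1\<^esub> (\<ominus>\<^bsub>H1\<^esub> a) \<oplus>\<^bsub>H1\<^esub> (\<ominus>\<^bsub>H1\<^esub> b) = \<zero>\<^bsub>H1\<^esub>"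
          if a: "a \<in> carrier H1" "b \<in> carrier H1" for a b
        proof -
          have "a \<oplus>\<^bsub>H1\<^esub> b \<oplus>\<^bsub>H1\<^esub> (\<ominus>\<^bsub>H1\<^esub> a) = b"
            using a by (simp add: H.a_assoc H.a_comm[of b] H.r_neg2)
          then show ?thesis using a H.r_neg by simp
        qed
        from this[OF c] show ?thesis .
      qed
      finally show "cls (single [y \<otimes>\<^bsub>G\<^esub> z \<otimes>\<^bsub>G\<^esub> inv\<^bsub>G\<^esub> y \<otimes>\<^bsub>G\<^esub> inv\<^bsub>G\<^esub> z]) = \<zero>\<^bsub>H1\<^esub>" .
    qed (use y z in simp)
    obtain \<chi> where chi: "\<chi> \<in> homs p G" "\<And>y. y \<in> \<Phi> \<Longrightarrow> \<chi> y = 0" "\<chi> x \<noteq> 0"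
      using G.homs_separate[OF p Phi pow comm x] by blast
    have "y \<in> \<Phi>" if "y \<in> set xs" for y
    proof -
      have "cls (single [y]) \<in> A" using that by (simp add: A_def)
      then have "cls (single [y]) \<in> H.span A" using H.in_own_span[OF Ac] by blast
      then show ?thesis using that xs by (auto simp: \<Phi>_def)
    qed
    then have "\<chi> = (\<lambda>x. 0)" using sep[OF chi(1)] chi(2) by blast
    then show False using chi(3) by simp
  qed
  have "carrier H1 \<subseteq> H.span A"
    by (rule class_in_span[OF sp0 spa sps]) (use PhiG in \<open>auto simp: \<Phi>_def\<close>)
  then have "H.span A = carrier H1" using spc by blast
  then have "\<exists>A'. finite A' \<and> card A' = card A \<and> A' \<subseteq> carrier H1 \<and> H.span A' = carrier H1"
    using Ac by (intro exI[of _ A]) (simp add: A_def)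
  then have "V.dim \<le> card A" unfolding V.dim_def by (rule Least_le)
  also have "\<dots> \<le> card (set xs)" unfolding A_def by (rule card_image_le) simp
  also have "\<dots> \<le> length xs" by (rule card_length)
  finally show ?thesis by (simp add: dim_H1_mod_def K_def)
qed

section \<open>Almost invariant sets of cosets\<close>

definition coset_boundary :: "('g, 'b) monoid_scheme \<Rightarrow> 'g set \<Rightarrow> 'g set \<Rightarrow> 'g set set \<Rightarrow> ('g set \<times> 'g) set" where
  "coset_boundary G H S D = {(C, s). C \<in> rcosets\<^bsub>G\<^esub> H \<and> s \<in> S \<and> (C \<in> D) \<noteq> (C #>\<^bsub>G\<^esub> s \<in> D)}"

lemma edge_boundary_schreier: "edge_boundary (schreier_graph G H S) D = coset_boundary G H S D"
  by (auto simp: edge_boundary_def schreier_graph_def coset_boundary_def)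

definition small_sets :: "('g, 'b) monoid_scheme \<Rightarrow> 'g set \<Rightarrow> 'g set set set" where
  "small_sets G H = {A. A \<subseteq> rcosets\<^bsub>G\<^esub> H \<and> 0 < card A \<and> 2 * card A \<le> card (rcosets\<^bsub>G\<^esub> H)}"

lemma cheeger_schreier:
  "cheeger (schreier_graph G H S) =
     (INF A\<in>small_sets G H. ereal (real (card (coset_boundary G H S A)) / real (card A)))"
proof -
  have "{A. A \<subseteq> verts (schreier_graph G H S) \<and> 0 < card A \<and>
      real (card A) \<le> real (card (verts (schreier_graph G H S))) / 2} = small_sets G H"
    by (auto simp: small_sets_def schreier_graph_def)
  then show ?thesis by (simp add: cheeger_def edge_boundary_schreier)
qed

section \<open>Edge boundaries in a single coset graph\<close>

locale coset_graph = group G for G (structure) +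
  fixes H S
  assumes sub: "subgroup H G" and fin: "finite (rcosets H)" and S: "finite S" "S \<subseteq> carrier G"
begin

abbreviation "V \<equiv> rcosets H"
abbreviation "bd \<equiv> coset_boundary G H S"

sublocale right_action G V "\<lambda>C g. C #> g" by (rule rcosets_right_action[OF sub])

lemma act_cancel:
  assumes "C \<in> V" "C' \<in> V" "g \<in> carrier G" "C #> g = C' #> g"
  shows "C = C'"
proof -
  have "C = C #> g #> inv g" using act_inv(1)[OF assms(1,3)] by simp
  also have "\<dots> = C' #> g #> inv g" using assms(4) by (rule arg_cong)
  also have "\<dots> = C'" by (rule act_inv(1)[OF assms(2,3)])
  finally show ?thesis .
qed

lemma finite_bd: "finite (bd D)"
  by (rule finite_subset[of _ "V \<times> S"]) (use fin S in \<open>auto simp: coset_boundary_def\<close>)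

lemma small_sets_finite: "finite (small_sets G H)"
  by (rule finite_subset[of _ "Pow V"]) (use fin in \<open>auto simp: small_sets_def\<close>)

lemma cheeger_le:
  "A \<in> small_sets G H \<Longrightarrow> cheeger (schreier_graph G H S) \<le> ereal (real (card (bd A)) / real (card A))"
  unfolding cheeger_schreier by (rule INF_lower)

lemma cheeger_attained:
  assumes "small_sets G H \<noteq> {}"
  obtains A where "A \<in> small_sets G H" "cheeger (schreier_graph G H S) = ereal (real (card (bd A)) / real (card A))"
proof -
  let ?f = "\<lambda>A. ereal (real (card (bd A)) / real (card A))"
  have f: "finite (?f ` small_sets G H)" "?f ` small_sets G H \<noteq> {}" using small_sets_finite assms by simp_all
  have "Inf (?f ` small_sets G H) = Min (?f ` small_sets G H)" using Min_Inf[OF f] by simp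
  then have "cheeger (schreier_graph G H S) \<in> ?f ` small_sets G H"
    unfolding cheeger_schreier using Min_in[OF f] by simp
  then show ?thesis using that by blast
qed

lemma bdI: "C \<in> V \<Longrightarrow> s \<in> S \<Longrightarrow> (C \<in> D) \<noteq> (C #> s \<in> D) \<Longrightarrow> (C, s) \<in> bd D"
  unfolding coset_boundary_def by (intro CollectI case_prodI conjI)

lemma bdD: "(C, s) \<in> bd D \<Longrightarrow> C \<in> V \<and> s \<in> S \<and> (C \<in> D) \<noteq> (C #> s \<in> D)"
  unfolding coset_boundary_def by (drule CollectD, drule case_prodD)

text \<open>Checked arc by arc: an arc cut by the union or by the intersection is cut by
  \<open>A\<close> or by \<open>B\<close>, and an arc cut by both of the former is cut by both of
  the latter.\<close>

lemma bd_submodular: "card (bd (A \<union> B)) + card (bd (A \<inter> B)) \<le> card (bd A) + card (bd B)"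
proof -
  have "card (bd (A \<union> B)) + card (bd (A \<inter> B)) = card (bd (A \<union> B) \<union> bd (A \<inter> B)) + card (bd (A \<union> B) \<inter> bd (A \<inter> B))"
    by (rule card_Un_Int[OF finite_bd finite_bd])
  also have "\<dots> \<le> card (bd A \<union> bd B) + card (bd A \<inter> bd B)"
    by (intro add_mono card_mono finite_UnI finite_Int finite_bd disjI1) (auto simp: coset_boundary_def)
  also have "\<dots> = card (bd A) + card (bd B)" by (rule card_Un_Int[OF finite_bd finite_bd, symmetric])
  finally show ?thesis .
qed

text \<open>If no arc is cut, the group elements that preserve membership in \<open>A\<close> at
  every coset form a subgroup containing \<open>S\<close>, hence all of \<open>G\<close>.
  Transitivity of the action then leaves no proper non-empty \<open>A\<close>.\<close>

lemma bd_nonempty: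
  assumes gen: "generate G S = carrier G" and A: "A \<subseteq> V" "A \<noteq> {}" "A \<noteq> V"
  shows "0 < card (bd A)"
proof (rule ccontr)
  assume "\<not> ?thesis"
  then have e: "bd A = {}" using finite_bd[of A] by (simp add: card_eq_0_iff)
  define K where "K = {g \<in> carrier G. \<forall>C\<in>V. (C \<in> A) = (C #> g \<in> A)}"
  have Kd: "g \<in> carrier G \<and> (\<forall>C\<in>V. (C \<in> A) = (C #> g \<in> A))" if "g \<in> K" for g
    using that unfolding K_def by (rule CollectD)
  note Kc = Kd[THEN conjunct1] and Ki = Kd[THEN conjunct2, rule_format]
  have KI: "g \<in> K" if "g \<in> carrier G" "\<And>C. C \<in> V \<Longrightarrow> (C \<in> A) = (C #> g \<in> A)" for g
    unfolding K_def by (rule CollectI, rule conjI, rule that(1), rule ballI, rule that(2))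
  have "subgroup K G"
  proof (rule subgroupI)
    show "K \<subseteq> carrier G" using Kc by (rule subsetI)
    have "\<one> \<in> K" by (rule KI) simp_all
    then show "K \<noteq> {}" by (rule ex_in_conv[THEN iffD1, OF exI])
    fix a assume a: "a \<in> K"
    note aG = Kc[OF a]
    show "inv a \<in> K"
    proof (rule KI)
      show "inv a \<in> carrier G" using aG by simp
      fix C assume C: "C \<in> V"
      have i: "C #> inv a \<in> V" "C #> inv a #> a = C" using aG C by simp_all
      show "(C \<in> A) = (C #> inv a \<in> A)" using Ki[OF a i(1)] unfolding i(2) by (rule HOL.sym)
    qed
    fix b assume b: "b \<in> K"
    note bG = Kc[OF b]
    show "a \<otimes> b \<in> K"
    proof (rule KI)
      show "a \<otimes> b \<in> carrier G" using aG bG by simp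
      fix C assume C: "C \<in> V"
      have "(C \<in> A) = (C #> a #> b \<in> A)"
        using Ki[OF a C] Ki[OF b act_closed[OF C aG]] by (rule HOL.trans)
      then show "(C \<in> A) = (C #> (a \<otimes> b) \<in> A)" unfolding act_mult[OF C aG bG] .
    qed
  qed
  moreover have "S \<subseteq> K"
  proof
    fix s assume s: "s \<in> S"
    show "s \<in> K"
    proof (rule KI)
      show "s \<in> carrier G" using s S(2) by blast
      fix C assume "C \<in> V"
      show "(C \<in> A) = (C #> s \<in> A)"
      proof (rule ccontr)
        assume "\<not> ?thesis"
        from bdI[OF \<open>C \<in> V\<close> s this] have "(C, s) \<in> bd A" .
        then show False unfolding e by (rule emptyE)
      qed
    qed
  qed
  ultimately have "generate G S \<subseteq> K" by (rule generate_subgroup_incl[rotated])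
  then have GK: "g \<in> K" if "g \<in> carrier G" for g using that unfolding gen by (rule subsetD)
  obtain C where C: "C \<in> A" using A(2) by blast
  have CV: "C \<in> V" using C A(1) by blast
  obtain x where x: "x \<in> carrier G" "C = H #> x" using rcoset_repr[OF sub CV] .
  have HV: "H \<in> V" by (rule subgroup_in_rcosets'[OF sub])
  have "D \<in> A" if D: "D \<in> V" for D
  proof -
    obtain y where y: "y \<in> carrier G" "D = H #> y" using rcoset_repr[OF sub D] .
    have "inv x \<otimes> y \<in> K" by (rule GK) (use x(1) y(1) in simp)
    from iffD1[OF Ki[OF this CV] C] have inA: "H #> x #> (inv x \<otimes> y) \<in> A" unfolding x(2) .
    have "H #> x #> (inv x \<otimes> y) = H #> x #> inv x #> y"
      by (rule act_mult[OF act_closed[OF HV x(1)] inv_closed[OF x(1)] y(1)])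
    then have "H #> x #> (inv x \<otimes> y) = D" unfolding act_inv(1)[OF HV x(1)] y(2) .
    from inA[unfolded this] show ?thesis .
  qed
  then have "A = V" by (intro equalityI[OF A(1)] subsetI)
  then show False using A(3) by (rule notE[rotated])
qed

text \<open>With finitely many indices the minimum stays positive, so an infimum of zero has to be
  approached beyond any given index.\<close>

lemma cheeger_pos:
  assumes gen: "generate G S = carrier G"
  shows "0 < cheeger (schreier_graph G H S)"
proof (cases "small_sets G H = {}")
  case True
  then show ?thesis by (simp add: cheeger_schreier top_ereal_def)
next
  case False
  then obtain A where A: "A \<in> small_sets G H" "cheeger (schreier_graph G H S) = ereal (real (card (bd A)) / real (card A))"
    by (rule cheeger_attained)
  have c: "A \<subseteq> V" "0 < card A" "2 * card A \<le> card V" using A(1) by (simp_all add: small_sets_def)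
  have "A \<noteq> {}" "A \<noteq> V" using c(2,3) by auto
  from bd_nonempty[OF gen c(1) this] show ?thesis unfolding A(2) using c(2) by simp
qed

text \<open>Two nearby cosets are separated by \<open>D\<close> only if some edge of a path between them is.\<close>

lemma bd_word:
  assumes c: "c \<in> X \<rightarrow> carrier G" "c ` X \<subseteq> S" and w: "w \<in> lists (free_alphabet X)"
  shows "card {C \<in> V. (C \<in> D) \<noteq> (C #> eval_word G (signed G c) w \<in> D)} \<le> length w * card (bd D)"
  using w
proof (induction w)
  case Nil
  have e: "{C \<in> V. (C \<in> D) \<noteq> (C #> \<one> \<in> D)} = {}" using act_one by auto
  show ?case by (simp only: eval_word_Nil e card.empty le0)
next
  case (Cons a w)
  let ?g = "eval_word G (signed G c) w" and ?s = "signed G c a"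
  have wG: "?g \<in> carrier G" by (rule eval_word_closed[OF signed_closed[OF c(1)]]) (rule Cons.hyps(2))
  have sG: "?s \<in> carrier G" using signed_closed[OF c(1)] Cons.hyps(1) by (rule funcset_mem)
  obtain x b where a: "a = (x, b)" "x \<in> X" using Cons.hyps(1) by auto
  have cx: "c x \<in> carrier G" "c x \<in> S" using c a by auto
  let ?A = "{C \<in> V. (C \<in> D) \<noteq> (C #> ?s \<in> D)}" and ?B = "{C \<in> V. (C \<in> D) \<noteq> (C #> ?g \<in> D)}"
  let ?B' = "{C \<in> V. C #> ?s \<in> ?B}"
  have A: "card ?A \<le> card (bd D)"
  proof (cases b)
    case True
    have se: "?s = c x" using True a by (simp add: signed_def)
    have "(\<lambda>C. (C, c x)) ` ?A \<subseteq> bd D"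
      unfolding se by (intro image_subsetI bdI cx(2)) (drule CollectD, erule conjunct1 conjunct2)+
    moreover have "inj_on (\<lambda>C. (C, c x)) ?A" by (simp add: inj_on_def)
    ultimately show ?thesis by (intro card_inj_on_le[OF _ _ finite_bd])
  next
    case False
    have se: "?s = inv c x" using False a by (simp add: signed_def)
    have "(\<lambda>C. (C #> inv c x, c x)) ` ?A \<subseteq> bd D"
    proof (rule image_subsetI)
      fix C assume C: "C \<in> ?A"
      then have CV: "C \<in> V" and ne: "(C \<in> D) \<noteq> (C #> inv c x \<in> D)" unfolding se by blast+
      have i: "C #> inv c x #> c x = C" "C #> inv c x \<in> V" using CV cx(1) by simp_all
      show "(C #> inv c x, c x) \<in> bd D"
        by (rule bdI[OF i(2) cx(2)]) (use ne in \<open>unfold i(1), rule not_sym\<close>)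
    qed
    moreover have "inj_on (\<lambda>C. (C #> inv c x, c x)) ?A"
    proof (rule inj_onI)
      fix C C' assume "C \<in> ?A" "C' \<in> ?A" and eq: "(C #> inv c x, c x) = (C' #> inv c x, c x)"
      then have V: "C \<in> V" "C' \<in> V" by blast+
      show "C = C'" by (rule act_cancel[OF V inv_closed[OF cx(1)]]) (use eq in simp)
    qed
    ultimately show ?thesis by (intro card_inj_on_le[OF _ _ finite_bd])
  qed
  have B: "card ?B' \<le> card ?B"
  proof (rule card_inj_on_le)
    show "inj_on (\<lambda>C. C #> ?s) ?B'"
    proof (rule inj_onI)
      fix C C' assume "C \<in> ?B'" "C' \<in> ?B'" and eq: "C #> ?s = C' #> ?s"
      then have V: "C \<in> V" "C' \<in> V" by blast+
      show "C = C'" by (rule act_cancel[OF V sG eq])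
    qed
    show "(\<lambda>C. C #> ?s) ` ?B' \<subseteq> ?B" by blast
    show "finite ?B" using fin by simp
  qed
  have "{C \<in> V. (C \<in> D) \<noteq> (C #> eval_word G (signed G c) (a # w) \<in> D)} \<subseteq> ?A \<union> ?B'"
  proof
    fix C assume "C \<in> {C \<in> V. (C \<in> D) \<noteq> (C #> eval_word G (signed G c) (a # w) \<in> D)}"
    then have C: "C \<in> V" and ne: "(C \<in> D) \<noteq> (C #> (?s \<otimes> ?g) \<in> D)"
      unfolding eval_word_Cons by blast+
    note ne = ne[unfolded act_mult[OF C sG wG]]
    have "C #> ?s \<in> V" by (rule act_closed[OF C sG])
    then show "C \<in> ?A \<union> ?B'" using C ne by blast
  qed
  then have "card {C \<in> V. (C \<in> D) \<noteq> (C #> eval_word G (signed G c) (a # w) \<in> D)} \<le> card (?A \<union> ?B')"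
    by (rule card_mono[rotated]) (use fin in simp)
  also have "\<dots> \<le> card ?A + card ?B'" by (rule card_Un_le)
  also have "\<dots> \<le> card (bd D) + length w * card (bd D)" using A B Cons.IH by linarith
  finally show ?case by simp
qed

end

text \<open>Normality of \<open>K\<close> in \<open>H\<close> lets left multiplication by elements
  of \<open>H\<close> permute the right cosets of \<open>K\<close>. These are the deck
  transformations of the covering of coset graphs; they commute with the right action of the
  generators.\<close>

lemma (in group) normal_l_coset:
  assumes H: "subgroup H G" and K: "K \<lhd> G\<lparr>carrier := H\<rparr>" and g: "g \<in> H" and x: "x \<in> carrier G"
  shows "g <# (K #> x) = K #> (g \<otimes> x)"
proof -
  have Ks: "subgroup K (G\<lparr>carrier := H\<rparr>)" by (rule normal_imp_subgroup[OF K])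
  have KG: "subgroup K G" using incl_subgroup[OF H Ks] .
  have Kc: "K \<subseteq> carrier G" by (rule subgroup.subset[OF KG])
  have gG: "g \<in> carrier G" by (rule subgroup.mem_carrier[OF H g])
  have "K #> g = g <# K" using normal.coset_eq[OF K] g by simp
  then show ?thesis using coset_assoc[OF gG x Kc] coset_mult_assoc[OF Kc gG x] by simp
qed

section \<open>The covering of coset graphs for a normal subgroup \<open>K\<close> of
  \<open>H\<close>\<close>

locale normal_step = G: group G for G (structure) +
  fixes H K S
  assumes H: "subgroup H G" "finite (rcosets H)"
    and K: "K \<lhd> G\<lparr>carrier := H\<rparr>" "finite (rcosets\<^bsub>G\<lparr>carrier := H\<rparr>\<^esub> K)"
    and S: "finite S" "S \<subseteq> carrier G"
begin

lemma KH: "subgroup K (G\<lparr>carrier := H\<rparr>)" by (rule normal_imp_subgroup[OF K(1)])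
lemma KG: "subgroup K G" using G.incl_subgroup[OF H(1) KH] .

sublocale VH: coset_graph G H S by (intro coset_graph.intro coset_graph_axioms.intro G.is_group H S)
sublocale VK: coset_graph G K S
  by (intro coset_graph.intro coset_graph_axioms.intro G.is_group KG G.finite_rcosets_trans[OF H KH K(2)] S)

definition proj :: "'a set \<Rightarrow> 'a set" where "proj C = H <#> C"

lemma proj_coset: "x \<in> carrier G \<Longrightarrow> proj (K #> x) = H #> x"
proof -
  assume x: "x \<in> carrier G"
  have "H <#> K = H" using G.set_mult_subgroup_idem[OF H(1) KH] .
  then have "H <#> (K #> x) = H #> x"
    using G.setmult_rcos_assoc[OF subgroup.subset[OF H(1)] subgroup.subset[OF KG] x] by simp
  then show ?thesis by (simp add: proj_def)
qed

lemma proj_closed: "C \<in> VK.V \<Longrightarrow> proj C \<in> VH.V"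
  by (erule G.rcoset_repr[OF KG]) (simp add: proj_coset G.rcosetsI[OF subgroup.subset[OF H(1)]])

lemma proj_act:
  assumes C: "C \<in> VK.V" and g: "g \<in> carrier G"
  shows "proj (C #> g) = proj C #> g"
proof -
  obtain x where x: "x \<in> carrier G" "C = K #> x" using G.rcoset_repr[OF KG C] .
  then show ?thesis
    using g proj_coset[of "x \<otimes> g"] proj_coset[of x] subgroup.subset[OF KG] subgroup.subset[OF H(1)]
    by (simp add: G.coset_mult_assoc)
qed

abbreviation q where "q \<equiv> card (rcosets\<^bsub>G\<lparr>carrier := H\<rparr>\<^esub> K)"

lemma q_pos: "0 < q"
proof -
  have "K \<in> rcosets\<^bsub>G\<lparr>carrier := H\<rparr>\<^esub> K"
    using group.subgroup_in_rcosets'[OF G.subgroup_imp_group[OF H(1)] KH] .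
  then show ?thesis using K(2) by (auto simp: card_gt_0_iff)
qed

text \<open>All fibres have \<open>q\<close> elements: a coset over \<open>B\<close> is a coset of
  \<open>K\<close> in \<open>H\<close>, translated by the representative of
  \<open>B\<close>.\<close>

lemma card_proj_preimage:
  assumes A: "A \<subseteq> VH.V"
  shows "card {C \<in> VK.V. proj C \<in> A} = q * card A"
proof -
  obtain \<tau> where "transversal G H \<tau>" using G.transversal_exists[OF H(1)] .
  then interpret T: transversal G H \<tau> .
  have tau: "\<tau> B \<in> carrier G" "H #> \<tau> B = B" if "B \<in> A" for B
    using T.tau_closed T.tau_repr that A by blast+
  have rep: "\<exists>h\<in>H. E = K #> h" if "E \<in> rcosets\<^bsub>G\<lparr>carrier := H\<rparr>\<^esub> K" for E
    using that by (auto simp: RCOSETS_def)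
  have Kc: "K \<subseteq> carrier G" by (rule subgroup.subset[OF KG])
  let ?f = "\<lambda>(E, B). E #> \<tau> B"
  have f: "?f (K #> h, B) = K #> (h \<otimes> \<tau> B)" "proj (?f (K #> h, B)) = B" if h: "h \<in> H" and B: "B \<in> A" for h B
  proof -
    have hG: "h \<in> carrier G" by (rule subgroup.mem_carrier[OF H(1) h])
    show 1: "?f (K #> h, B) = K #> (h \<otimes> \<tau> B)" using hG tau(1)[OF B] Kc by (simp add: G.coset_mult_assoc)
    have "proj (K #> (h \<otimes> \<tau> B)) = H #> (h \<otimes> \<tau> B)" using hG tau(1)[OF B] by (simp add: proj_coset)
    also have "\<dots> = H #> h #> \<tau> B" using G.coset_mult_assoc[OF subgroup.subset[OF H(1)] hG tau(1)[OF B]] by simp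
    also have "\<dots> = B" using G.coset_join2[OF hG H(1) h] tau(2)[OF B] by simp
    finally show "proj (?f (K #> h, B)) = B" using 1 by simp
  qed
  have "bij_betw ?f ((rcosets\<^bsub>G\<lparr>carrier := H\<rparr>\<^esub> K) \<times> A) {C \<in> VK.V. proj C \<in> A}"
  proof (rule bij_betw_imageI)
    show "inj_on ?f ((rcosets\<^bsub>G\<lparr>carrier := H\<rparr>\<^esub> K) \<times> A)"
    proof (rule inj_onI, clarify)
      fix E B E' B'
      assume *: "E \<in> rcosets\<^bsub>G\<lparr>carrier := H\<rparr>\<^esub> K" "B \<in> A" "E' \<in> rcosets\<^bsub>G\<lparr>carrier := H\<rparr>\<^esub> K" "B' \<in> A"
        and eq: "E #> \<tau> B = E' #> \<tau> B'"
      obtain h h' where h: "h \<in> H" "E = K #> h" "h' \<in> H" "E' = K #> h'" using rep *(1,3) by blast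
      have hG: "h \<in> carrier G" "h' \<in> carrier G" using subgroup.mem_carrier[OF H(1)] h by auto
      have B: "B = B'" using f(2)[OF h(1) *(2)] f(2)[OF h(3) *(4)] eq h by simp
      have EV: "E \<in> VK.V" "E' \<in> VK.V" using h hG Kc by (auto intro: G.rcosetsI)
      have "E = E'"
        by (rule VK.act_cancel[OF EV tau(1)[OF *(2)]]) (use eq B in blast)
      then show "E = E' \<and> B = B'" using B by simp
    qed
    show "?f ` ((rcosets\<^bsub>G\<lparr>carrier := H\<rparr>\<^esub> K) \<times> A) = {C \<in> VK.V. proj C \<in> A}"
    proof
      show "?f ` ((rcosets\<^bsub>G\<lparr>carrier := H\<rparr>\<^esub> K) \<times> A) \<subseteq> {C \<in> VK.V. proj C \<in> A}"
      proof clarify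
        fix E B assume *: "E \<in> rcosets\<^bsub>G\<lparr>carrier := H\<rparr>\<^esub> K" "B \<in> A"
        obtain h where h: "h \<in> H" "E = K #> h" using rep *(1) by blast
        have "h \<otimes> \<tau> B \<in> carrier G" using subgroup.mem_carrier[OF H(1) h(1)] tau(1)[OF *(2)] by simp
        then show "E #> \<tau> B \<in> VK.V \<and> proj (E #> \<tau> B) \<in> A"
          using f[OF h(1) *(2)] h(2) *(2) G.rcosetsI[OF Kc] by simp
      qed
      show "{C \<in> VK.V. proj C \<in> A} \<subseteq> ?f ` ((rcosets\<^bsub>G\<lparr>carrier := H\<rparr>\<^esub> K) \<times> A)"
      proof
        fix C assume "C \<in> {C \<in> VK.V. proj C \<in> A}"
        then have C: "C \<in> VK.V" "proj C \<in> A" by simp_all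
        obtain x where x: "x \<in> carrier G" "C = K #> x" using G.rcoset_repr[OF KG C(1)] .
        let ?B = "proj C"
        have t: "\<tau> ?B \<in> carrier G" "H #> \<tau> ?B = H #> x" using tau[OF C(2)] proj_coset[OF x(1)] x(2) by auto
        define h where "h = x \<otimes> inv (\<tau> ?B)"
        have h: "h \<in> H" unfolding h_def using G.rcoset_eq_iff[OF H(1) x(1) t(1)] t(2) by simp
        have "C = ?f (K #> h, ?B)" using f(1)[OF h C(2)] x t(1) by (simp add: h_def G.m_assoc)
        moreover have "K #> h \<in> rcosets\<^bsub>G\<lparr>carrier := H\<rparr>\<^esub> K" using h by (auto simp: RCOSETS_def)
        ultimately show "C \<in> ?f ` ((rcosets\<^bsub>G\<lparr>carrier := H\<rparr>\<^esub> K) \<times> A)" using C(2) by blast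
      qed
    qed
  qed
  from bij_betw_same_card[OF this] show ?thesis by (simp add: card_cartesian_product)
qed

lemma card_V: "card VK.V = q * card VH.V"
proof -
  have "{C \<in> VK.V. proj C \<in> VH.V} = VK.V" using proj_closed by blast
  then show ?thesis using card_proj_preimage[of VH.V] by simp
qed

text \<open>Sorting arcs by label reduces the count to fibres of vertices. Size and boundary are
  multiplied by the same \<open>q\<close>, so pulling back a set preserves its boundary
  ratio.\<close>

lemma card_bd_proj:
  assumes A: "A \<subseteq> VH.V"
  shows "card (VK.bd {C \<in> VK.V. proj C \<in> A}) = q * card (VH.bd A)"
proof -
  let ?D = "{C \<in> VK.V. proj C \<in> A}"
  let ?B = "\<lambda>s. {B \<in> VH.V. (B \<in> A) \<noteq> (B #> s \<in> A)}"
  have K: "VK.bd ?D = (\<lambda>(s, C). (C, s)) ` (SIGMA s:S. {C \<in> VK.V. proj C \<in> ?B s})"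
  proof -
    have "(C, s) \<in> VK.bd ?D \<longleftrightarrow> s \<in> S \<and> C \<in> VK.V \<and> proj C \<in> ?B s" for C s
    proof -
      have "(C \<in> ?D) = (proj C \<in> A) \<and> (C #> s \<in> ?D) = (proj C #> s \<in> A) \<and> proj C \<in> VH.V"
        if "C \<in> VK.V" "s \<in> S"
        using proj_closed[OF that(1)] proj_act[OF that(1)] VK.act_closed[OF that(1)] S(2) that by auto
      then show ?thesis unfolding coset_boundary_def by blast
    qed
    then show ?thesis by (auto simp: image_iff)
  qed
  have H: "VH.bd A = (\<lambda>(s, C). (C, s)) ` (SIGMA s:S. ?B s)"
    by (auto simp: coset_boundary_def image_iff)
  have inj: "inj_on (\<lambda>(s, C). (C, s)) Z" for Z :: "('a \<times> 'a set) set" by (auto simp: inj_on_def)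
  have finK: "finite {C \<in> VK.V. P C}" and finH: "finite {C \<in> VH.V. P C}" for P
    using VK.fin VH.fin by simp_all
  have "card (VK.bd ?D) = (\<Sum>s\<in>S. card {C \<in> VK.V. proj C \<in> ?B s})"
    unfolding K card_image[OF inj] by (rule card_SigmaI[OF S(1)]) (rule ballI, rule finK)
  also have "\<dots> = (\<Sum>s\<in>S. q * card (?B s))"
    by (rule sum.cong[OF HOL.refl]) (rule card_proj_preimage, blast)
  also have "\<dots> = q * card (VH.bd A)"
    unfolding H card_image[OF inj] using S(1) finH
    by (subst card_SigmaI) (auto simp: sum_distrib_left)
  finally show ?thesis .
qed

text \<open>A minimising set of maximal size which is at most a quarter of the whole is invariant under
  the deck group \<open>H/K\<close>, because its union with any translate is again minimising; it then
  descends to the quotient graph.\<close>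

lemma large_minimiser:
  assumes lt: "cheeger (schreier_graph G K S) < cheeger (schreier_graph G H S)"
  obtains D where "D \<in> small_sets G K" "card VK.V < 4 * card D"
    "cheeger (schreier_graph G K S) = ereal (real (card (VK.bd D)) / real (card D))"
proof -
  let ?h = "cheeger (schreier_graph G K S)"
  let ?r = "\<lambda>A. real (card (VK.bd A)) / real (card A)"
  have "small_sets G K \<noteq> {}"
  proof
    assume "small_sets G K = {}"
    then have "?h = \<infinity>" by (simp add: cheeger_schreier top_ereal_def)
    then show False using lt by simp
  qed
  then obtain A0 where A0: "A0 \<in> small_sets G K" "?h = ereal (?r A0)" by (rule VK.cheeger_attained)
  define M where "M = {A \<in> small_sets G K. ?h = ereal (?r A)}"
  have finM: "finite M" unfolding M_def using VK.small_sets_finite by simp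
  have "A0 \<in> M" using A0 by (simp add: M_def)
  then have "card ` M \<noteq> {}" by blast
  then have "Max (card ` M) \<in> card ` M" using finM by (intro Max_in) auto
  then obtain D where D: "D \<in> M" "card D = Max (card ` M)" by auto
  have Dmax: "card A \<le> card D" if "A \<in> M" for A unfolding D(2) using finM that by (intro Max_ge) auto
  have Ds: "D \<in> small_sets G K" and Dh: "?h = ereal (?r D)" using D(1) by (simp_all add: M_def)
  have DV: "D \<subseteq> VK.V" and D0: "0 < card D" using Ds by (simp_all add: small_sets_def)
  have finD: "finite D" using DV VK.fin finite_subset by blast
  define h where "h = ?r D"
  have h0: "0 \<le> h" by (simp add: h_def)
  have hge: "h * real (card A) \<le> real (card (VK.bd A))" if "A \<in> small_sets G K" for A
  proof -
    have "h \<le> ?r A" using VK.cheeger_le[OF that] Dh by (simp add: h_def)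
    moreover have "0 < card A" using that by (simp add: small_sets_def)
    ultimately show ?thesis by (simp add: pos_le_divide_eq)
  qed
  have hD: "real (card (VK.bd D)) = h * real (card D)" using D0 by (simp add: h_def)
  have "card VK.V < 4 * card D"
  proof (rule ccontr)
    assume "\<not> card VK.V < 4 * card D"
    then have quarter: "4 * card D \<le> card VK.V" by simp
    have inv: "g <# C \<in> D" if g: "g \<in> H" and C: "C \<in> D" for g C
    proof -
      have gG: "g \<in> carrier G" "inv g \<in> H" "inv g \<in> carrier G"
        using subgroup.mem_carrier[OF H(1) g] subgroup.m_inv_closed[OF H(1) g] by auto
      have l: "g <# C \<in> VK.V \<and> inv g <# (g <# C) = C \<and> (\<forall>s\<in>carrier G. (g <# C) #> s = g <# (C #> s))"
        if g: "g \<in> H" and C: "C \<in> VK.V" for g C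
      proof -
        have gG: "g \<in> carrier G" "inv g \<in> H"
          using subgroup.mem_carrier[OF H(1) g] subgroup.m_inv_closed[OF H(1) g] by auto
        obtain x where x: "x \<in> carrier G" "C = K #> x" using G.rcoset_repr[OF KG C] .
        note e = G.normal_l_coset[OF H(1) K(1)]
        have "g <# C = K #> (g \<otimes> x)" using e[OF g x(1)] x(2) by simp
        moreover have "inv g <# (K #> (g \<otimes> x)) = K #> x"
          using e[OF gG(2), of "g \<otimes> x"] gG x(1) by (simp flip: G.m_assoc)
        moreover have "(K #> (g \<otimes> x)) #> s = g <# (C #> s)" if s: "s \<in> carrier G" for s
          using e[OF g, of "x \<otimes> s"] gG x s subgroup.subset[OF KG] by (simp add: G.coset_mult_assoc G.m_assoc)
        ultimately show ?thesis
          using x gG G.rcosetsI[OF subgroup.subset[OF KG]] by simp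
      qed
      let ?l = "\<lambda>C. g <# C"
      have inj: "inj_on ?l VK.V"
        by (rule inj_on_inverseI[of _ "\<lambda>C. inv g <# C"]) (use l[OF g] in blast)
      let ?D = "?l ` D"
      have mem: "?l E \<in> ?D \<longleftrightarrow> E \<in> D" if "E \<in> VK.V" for E
        using inj that DV by (auto dest: inj_onD)
      have D'V: "?D \<subseteq> VK.V" using l[OF g] DV by blast
      have cD': "card ?D = card D" by (rule card_image[OF inj_on_subset[OF inj DV]])
      have bdD': "card (VK.bd ?D) = card (VK.bd D)"
      proof -
        have "VK.bd ?D = (\<lambda>(C, s). (?l C, s)) ` VK.bd D"
        proof
          show "(\<lambda>(C, s). (?l C, s)) ` VK.bd D \<subseteq> VK.bd ?D"
          proof clarify
            fix C s assume "(C, s) \<in> VK.bd D"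
            then have *: "C \<in> VK.V" "s \<in> S" "(C \<in> D) \<noteq> (C #> s \<in> D)" using VK.bdD by blast+
            have s: "s \<in> carrier G" using *(2) S(2) by blast
            have "C #> s \<in> VK.V" using *(1) s by simp
            then have "(?l C \<in> ?D) \<noteq> (?l C #> s \<in> ?D)"
              using *(3) mem[OF *(1)] mem[of "C #> s"] l[OF g *(1)] s by metis
            then show "(?l C, s) \<in> VK.bd ?D" using l[OF g *(1)] *(2) by (intro VK.bdI) blast+
          qed
          show "VK.bd ?D \<subseteq> (\<lambda>(C, s). (?l C, s)) ` VK.bd D"
          proof clarify
            fix E s assume "(E, s) \<in> VK.bd ?D"
            then have *: "E \<in> VK.V" "s \<in> S" "(E \<in> ?D) \<noteq> (E #> s \<in> ?D)" using VK.bdD by blast+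
            have s: "s \<in> carrier G" using *(2) S(2) by blast
            define C where "C = inv g <# E"
            have C: "C \<in> VK.V" "?l C = E" using l[OF gG(2) *(1)] gG(1) by (simp_all add: C_def)
            have "?l C #> s = ?l (C #> s)" using l[OF g C(1)] s by blast
            moreover have Cs: "C #> s \<in> VK.V" using C(1) s by simp
            ultimately have "(C \<in> D) \<noteq> (C #> s \<in> D)"
              using *(3) mem[OF C(1)] mem[OF Cs] C(2) by metis
            then have "(C, s) \<in> VK.bd D" using C(1) *(2) by (intro VK.bdI)
            then show "(E, s) \<in> (\<lambda>(C, s). (?l C, s)) ` VK.bd D" using C(2) by force
          qed
        qed
        moreover have "inj_on (\<lambda>(C, s). (?l C, s)) (VK.bd D)"
          using inj by (auto simp: inj_on_def coset_boundary_def)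
        ultimately show ?thesis by (simp add: card_image)
      qed
      have fin': "finite ?D" using finD by simp
      have cU: "card (D \<union> ?D) + card (D \<inter> ?D) = 2 * card D"
        using card_Un_Int[OF finD fin'] cD' by simp
      \<comment> \<open>The assumed quarter enters here: the union has at most
        \<open>2 * card D\<close> elements, hence at most half of the vertices.\<close>
      have Us: "D \<union> ?D \<in> small_sets G K"
        using DV D'V cU D0 quarter card_mono[of "D \<union> ?D" D] finD fin' by (simp add: small_sets_def)
      \<comment> \<open>An empty intersection lies outside \<open>small_sets\<close>, but then the
        inequality is trivial. Subtracting it from submodularity bounds the boundary of the union by
        \<open>h\<close> times its size.\<close>
      have "h * real (card (D \<inter> ?D)) \<le> real (card (VK.bd (D \<inter> ?D)))"
      proof (cases "D \<inter> ?D = {}")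
        case False
        then have "0 < card (D \<inter> ?D)" using finD by (simp add: card_gt_0_iff)
        then have "D \<inter> ?D \<in> small_sets G K"
          using DV cU quarter card_mono[of "D" "D \<inter> ?D"] finD by (auto simp: small_sets_def)
        then show ?thesis by (rule hge)
      qed simp
      moreover have "real (card (VK.bd (D \<union> ?D))) + real (card (VK.bd (D \<inter> ?D))) \<le> 2 * (h * real (card D))"
        using VK.bd_submodular[of D ?D] bdD' hD by linarith
      ultimately have "real (card (VK.bd (D \<union> ?D))) \<le> h * (2 * real (card D) - real (card (D \<inter> ?D)))"
        by (simp add: algebra_simps)
      also have "2 * real (card D) - real (card (D \<inter> ?D)) = real (card (D \<union> ?D))" using cU by linarith
      finally have up: "real (card (VK.bd (D \<union> ?D))) \<le> h * real (card (D \<union> ?D))" .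
      have U0: "0 < card (D \<union> ?D)" using Us by (simp add: small_sets_def)
      have "?r (D \<union> ?D) = h" using up hge[OF Us] U0 by (simp add: divide_eq_eq)
      then have "D \<union> ?D \<in> M" using Us Dh by (simp add: M_def h_def)
      then have "card (D \<union> ?D) \<le> card D" by (rule Dmax)
      then have "D \<union> ?D = D" using card_seteq[of "D \<union> ?D" D] finD by auto
      then show ?thesis using C by blast
    qed
    \<comment> \<open>By invariance \<open>D\<close> is the full preimage of \<open>E\<close>, so
      \<open>E\<close> has the same boundary ratio in the quotient graph. This contradicts the
      strict drop of the Cheeger constant.\<close>
    define E where "E = proj ` D"
    have EV: "E \<subseteq> VH.V" using proj_closed DV by (auto simp: E_def)
    have DE: "D = {C \<in> VK.V. proj C \<in> E}"
    proof
      show "D \<subseteq> {C \<in> VK.V. proj C \<in> E}" using DV by (auto simp: E_def)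
      show "{C \<in> VK.V. proj C \<in> E} \<subseteq> D"
      proof clarify
        fix C assume C: "C \<in> VK.V" "proj C \<in> E"
        then obtain C' where C': "C' \<in> D" "proj C = proj C'" by (auto simp: E_def)
        obtain x where x: "x \<in> carrier G" "C = K #> x" using G.rcoset_repr[OF KG C(1)] .
        obtain y where y: "y \<in> carrier G" "C' = K #> y" using G.rcoset_repr[OF KG] C'(1) DV by blast
        have "H #> x = H #> y" using C'(2) proj_coset x y by simp
        then have m: "x \<otimes> inv y \<in> H" using G.rcoset_eq_iff[OF H(1) x(1) y(1)] by simp
        have "(x \<otimes> inv y) <# C' = C"
          using G.normal_l_coset[OF H(1) K(1) m y(1)] x y by (simp add: G.m_assoc)
        then show "C \<in> D" using inv[OF m C'(1)] by simp
      qed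
    qed
    have cD: "card D = q * card E" using card_proj_preimage[OF EV] DE by simp
    have cB: "card (VK.bd D) = q * card (VH.bd E)" using card_bd_proj[OF EV] DE by simp
    have "2 * (q * card E) \<le> q * card VH.V" using Ds cD card_V by (simp add: small_sets_def)
    then have "2 * card E \<le> card VH.V" using q_pos by simp
    moreover have "0 < card E" using D0 cD by simp
    ultimately have Es: "E \<in> small_sets G H" using EV by (simp add: small_sets_def)
    have "?r D = real (card (VH.bd E)) / real (card E)" using cD cB q_pos by simp
    then have "cheeger (schreier_graph G H S) \<le> ?h" using VH.cheeger_le[OF Es] Dh by simp
    then show False using lt by simp
  qed
  then show ?thesis using that Ds Dh by blast
qed

end

text \<open>The first index at which the Cheeger constant falls below a suitable threshold is also a
  step at which it strictly decreases, so \<open>large_minimiser\<close> applies there.\<close>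

lemma (in group) almost_invariant_sets:
  assumes sub: "\<And>j. subgroup (Gs j) G" and fin: "\<And>j. finite (rcosets (Gs j))"
    and nor: "\<And>j. Gs (Suc j) \<lhd> G\<lparr>carrier := Gs j\<rparr>"
    and find: "\<And>j. finite (rcosets\<^bsub>G\<lparr>carrier := Gs j\<rparr>\<^esub> (Gs (Suc j)))"
    and S: "finite S" "S \<subseteq> carrier G" "generate G S = carrier G"
    and ntau: "\<not> property_tau G (range Gs)" and e: "0 < (e::real)"
  obtains j D where "i < j" "D \<subseteq> rcosets (Gs j)" "card (rcosets (Gs j)) < 4 * card D"
    "2 * card D \<le> card (rcosets (Gs j))" "0 < card (coset_boundary G (Gs j) S D)"
    "real (card (coset_boundary G (Gs j) S D)) \<le> e * real (card (rcosets (Gs j)))"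
proof -
  let ?h = "\<lambda>j. cheeger (schreier_graph G (Gs j) S)"
  have cg: "coset_graph G (Gs j) S" for j
    by (intro coset_graph.intro coset_graph_axioms.intro is_group sub fin S)
  have pos: "0 < ?h j" for j by (rule coset_graph.cheeger_pos[OF cg S(3)])
  have "\<not> 0 < (INF H\<in>range Gs. cheeger (schreier_graph G H S))"
    using ntau S unfolding property_tau_def by blast
  then have inf0: "(INF H\<in>range Gs. cheeger (schreier_graph G H S)) \<le> 0" by simp
  \<comment> \<open>As \<open>m\<close> bounds all Cheeger constants up to \<open>i\<close> from
    below, the first drop below \<open>m\<close> occurs after \<open>i\<close>; as \<open>m\<close>
    is at most \<open>e\<close>, the minimiser found there has boundary ratio at most
    \<open>e\<close>.\<close>
  define m where "m = Min (insert (ereal e) (?h ` {..i}))"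
  have "m \<in> insert (ereal e) (?h ` {..i})" unfolding m_def by (rule Min_in) auto
  then have m0: "0 < m" using pos e by auto
  have me: "m \<le> ereal e" unfolding m_def by (rule Min_le) auto
  have mi: "m \<le> ?h k" if "k \<le> i" for k unfolding m_def by (rule Min_le) (use that in auto)
  have "(INF H\<in>range Gs. cheeger (schreier_graph G H S)) < m" using inf0 m0 by (rule le_less_trans)
  then have ex: "\<exists>k. ?h k < m" unfolding INF_less_iff by blast
  define k where "k = (LEAST k. ?h k < m)"
  have hk: "?h k < m" unfolding k_def by (rule LeastI_ex[OF ex])
  have least: "m \<le> ?h l" if "l < k" for l
    using not_less_Least[OF that[unfolded k_def]] by simp
  have ik: "i < k" using mi[of k] hk by (meson leD leI)
  then obtain l where l: "k = Suc l" by (cases k) auto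
  have "?h (Suc l) < ?h l" using hk least[of l] l by (metis less_le_trans lessI)
  moreover have ns: "normal_step G (Gs l) (Gs (Suc l)) S"
    by (intro normal_step.intro normal_step_axioms.intro is_group sub fin nor find S)
  ultimately obtain D where D: "D \<in> small_sets G (Gs k)" "card (rcosets (Gs k)) < 4 * card D"
    "?h k = ereal (real (card (coset_boundary G (Gs k) S D)) / real (card D))"
    unfolding l by (elim normal_step.large_minimiser[rotated])
  have c: "D \<subseteq> rcosets (Gs k)" "0 < card D" "2 * card D \<le> card (rcosets (Gs k))"
    using D(1) by (simp_all add: small_sets_def)
  have "real (card (coset_boundary G (Gs k) S D)) / real (card D) \<le> e"
    using hk me D(3) by (metis ereal_less_eq(3) less_imp_le order_trans)
  then have "real (card (coset_boundary G (Gs k) S D)) \<le> e * real (card D)"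
    using c(2) by (simp add: pos_divide_le_eq)
  also have "\<dots> \<le> e * real (card (rcosets (Gs k)))"
    using e c(3) by (intro mult_left_mono) auto
  finally have b: "real (card (coset_boundary G (Gs k) S D)) \<le> e * real (card (rcosets (Gs k)))" .
  have "D \<noteq> {}" "D \<noteq> rcosets (Gs k)" using c(2,3) by auto
  then have "0 < card (coset_boundary G (Gs k) S D)"
    by (rule coset_graph.bd_nonempty[OF cg S(3) c(1)])
  with ik c(1) D(2) c(3) b show ?thesis using that by blast
qed

section \<open>Counting homomorphisms supported on a set of cosets\<close>

text \<open>The rank-nullity inequality in terms of cardinalities: subtracting a fixed member embeds
  each fibre of the restriction to \<open>Q\<close> into the kernel.\<close>

lemma card_restrict_le:
  fixes L :: "('d \<Rightarrow> int) set"
  assumes L: "finite L" "\<And>f g. f \<in> L \<Longrightarrow> g \<in> L \<Longrightarrow> (\<lambda>x. (f x - g x) mod int p) \<in> L"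
    and r: "\<And>f x. f \<in> L \<Longrightarrow> 0 \<le> f x \<and> f x < int p" and Q: "finite Q"
  shows "card L \<le> card {f \<in> L. \<forall>q\<in>Q. f q = 0} * p ^ card Q"
proof -
  let ?L0 = "{f \<in> L. \<forall>q\<in>Q. f q = 0}" and ?r = "\<lambda>f. restrict f Q"
  have fib: "card {f \<in> L. ?r f = v} \<le> card ?L0" if v: "v \<in> ?r ` L" for v
  proof -
    obtain g where g: "g \<in> L" "v = ?r g" using v by blast
    let ?s = "\<lambda>f x. (f x - g x) mod int p"
    have "inj_on ?s L"
    proof (rule inj_onI)
      fix f f' assume f: "f \<in> L" "f' \<in> L" and eq: "?s f = ?s f'"
      show "f = f'"
      proof
        fix x
        have "(f x - g x) mod int p = (f' x - g x) mod int p" using fun_cong[OF eq, of x] .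
        then have "((f x - g x) + g x) mod int p = ((f' x - g x) + g x) mod int p" by (rule mod_add_cong) simp
        then show "f x = f' x" using r[OF f(1), of x] r[OF f(2), of x] by simp
      qed
    qed
    then have inj: "inj_on ?s {f \<in> L. ?r f = v}" by (rule inj_on_subset) blast
    have "?s ` {f \<in> L. ?r f = v} \<subseteq> ?L0"
    proof (rule image_subsetI)
      fix f assume "f \<in> {f \<in> L. ?r f = v}"
      then have f: "f \<in> L" "?r f = ?r g" using g(2) by simp_all
      have "f q = g q" if "q \<in> Q" for q using fun_cong[OF f(2), of q] that by simp
      then show "?s f \<in> ?L0" using L(2)[OF f(1) g(1)] by simp
    qed
    with inj show ?thesis by (rule card_inj_on_le) (use L(1) in simp)
  qed
  have "?r ` L \<subseteq> (\<Pi>\<^sub>E q\<in>Q. {0..<int p})" using r by auto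
  then have "card (?r ` L) \<le> card (\<Pi>\<^sub>E q\<in>Q. {0..<int p})"
    by (rule card_mono[rotated]) (use Q in \<open>simp add: finite_PiE\<close>)
  also have "\<dots> = p ^ card Q" using Q by (simp add: card_PiE)
  finally have rL: "card (?r ` L) \<le> p ^ card Q" .
  have "L = (\<Union>v\<in>?r ` L. {f \<in> L. ?r f = v})" by auto
  then have "card L \<le> (\<Sum>v\<in>?r ` L. card {f \<in> L. ?r f = v})"
    using card_UN_le[OF finite_imageI[OF L(1)], of "\<lambda>v. {f \<in> L. ?r f = v}" ?r] by simp
  also have "\<dots> \<le> (\<Sum>v\<in>?r ` L. card ?L0)" by (rule sum_mono) (rule fib)
  also have "\<dots> = card (?r ` L) * card ?L0" by simp
  also have "\<dots> \<le> p ^ card Q * card ?L0" using rL by (rule mult_le_mono1)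
  finally show ?thesis by (simp add: mult.commute)
qed

lemma (in coset_graph) bd_words:
  assumes c: "c \<in> X \<rightarrow> carrier G" "c ` X \<subseteq> S" and W: "finite W" "W \<subseteq> lists (free_alphabet X)"
  shows "card {C \<in> V. \<exists>t\<in>eval_word G (signed G c) ` W. (C \<in> D) \<noteq> (C #> t \<in> D)} \<le> (\<Sum>w\<in>W. length w) * card (bd D)"
proof -
  let ?B = "\<lambda>w. {C \<in> V. (C \<in> D) \<noteq> (C #> eval_word G (signed G c) w \<in> D)}"
  have "{C \<in> V. \<exists>t\<in>eval_word G (signed G c) ` W. (C \<in> D) \<noteq> (C #> t \<in> D)} = (\<Union>w\<in>W. ?B w)" by blast
  then have "card {C \<in> V. \<exists>t\<in>eval_word G (signed G c) ` W. (C \<in> D) \<noteq> (C #> t \<in> D)} \<le> (\<Sum>w\<in>W. card (?B w))"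
    using card_UN_le[OF W(1), of ?B] by simp
  also have "\<dots> \<le> (\<Sum>w\<in>W. length w * card (bd D))"
    by (rule sum_mono) (rule bd_word[OF c], use W(2) in blast)
  finally show ?thesis by (simp add: sum_distrib_right)
qed

context schreier
begin

text \<open>An edge is assigned to the coset where it starts, the same convention by which
  \<open>cut_hom\<close> decides between the two sides of \<open>D\<close>.\<close>

definition supported :: "nat \<Rightarrow> 'a set set \<Rightarrow> ('a \<Rightarrow> int) set" where
  "supported p Z = {\<alpha> \<in> homs p HG. \<forall>C\<in>V - Z. \<forall>x\<in>X. \<alpha> (loop C (c x)) = 0}"

lemma homs_diff:
  assumes "p > 0" "\<alpha> \<in> homs p HG" "\<beta> \<in> homs p HG"
  shows "(\<lambda>x. (\<alpha> x - k * \<beta> x) mod int p) \<in> homs p HG"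
  using homs_lincomb[OF assms(1) group.is_monoid[OF group_HG] assms(2,3), of 1 "- k"] by simp

lemma supported_diff:
  assumes "p > 0" "\<alpha> \<in> supported p Z" "\<beta> \<in> supported p Z"
  shows "(\<lambda>x. (\<alpha> x - k * \<beta> x) mod int p) \<in> supported p Z"
  using homs_diff[OF assms(1), of \<alpha> \<beta> k] assms(2,3) unfolding supported_def by simp

lemma finite_supported: "p > 0 \<Longrightarrow> finite X \<Longrightarrow> finite V \<Longrightarrow> finite (supported p Z)"
  unfolding supported_def using finite_homs by simp

text \<open>A path labelled by the word of some \<open>x \<in> set xs\<close> which starts outside \<open>Z\<close> and away from its
  boundary never meets \<open>Z\<close>.  A supported homomorphism is therefore determined by its values on the
  loops \<open>loop C x\<close> for the remaining cosets \<open>C\<close> of elements of \<open>L\<close>.\<close>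

lemma card_supported_le:
  assumes p: "prime p" and fin: "finite X" "finite V" and L: "subgroup L G" and xs: "set xs \<subseteq> L"
    and w: "\<And>x. x \<in> set xs \<Longrightarrow> w x \<in> lists (free_alphabet X)"
      "\<And>x. x \<in> set xs \<Longrightarrow> eval_word G (signed G c) (w x) = x"
    and T: "\<And>x k. x \<in> set xs \<Longrightarrow> k \<le> length (w x) \<Longrightarrow> eval_word G (signed G c) (take k (w x)) \<in> T"
    and det: "\<And>\<alpha>. \<alpha> \<in> homs p HG \<Longrightarrow> (\<And>u. u \<in> generate G (set xs) \<inter> H \<Longrightarrow> \<alpha> u = 0) \<Longrightarrow> \<alpha> = (\<lambda>x. 0)"
  shows "card (supported p Z) \<le> p ^ (length xs * card ({C \<in> V. \<exists>h\<in>L. C = H #> h} \<inter> (Z \<union> bdry Z T)))"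
proof -
  \<comment> \<open>In the application \<open>L\<close> is the earlier subgroup of the chain, and
    these are the cosets of \<open>H\<close> that it contains.\<close>
  let ?VL = "{C \<in> V. \<exists>h\<in>L. C = H #> h}"
  let ?E = "?VL \<inter> (Z \<union> bdry Z T)"
  have p0: "p > 0" using p prime_gt_0_nat by blast
  have cX: "c \<in> X \<rightarrow> carrier G" using pres unfolding presents_def by blast
  define Q where "Q = (\<lambda>(C, x). loop C x) ` (?E \<times> set xs)"
  have finE: "finite ?E" using fin(2) by simp
  then have finQ: "finite Q" by (simp add: Q_def)
  have LG: "L \<subseteq> carrier G" by (rule subgroup.subset[OF L])
  have zero: "\<alpha> = (\<lambda>x. 0)" if a: "\<alpha> \<in> supported p Z" and aQ: "\<forall>q\<in>Q. \<alpha> q = 0" for \<alpha>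
  proof -
    have ah: "\<alpha> \<in> homs p HG" using a by (simp add: supported_def)
    have a0: "\<alpha> (loop C (c x)) = 0" if "C \<in> V" "C \<notin> Z" "x \<in> X" for C x
      using a that unfolding supported_def by blast
    note coc = homs_cocycle[OF ah]
    have gen0: "\<alpha> (loop C g) = 0" if C: "C \<in> ?VL" and g: "g \<in> set xs" for C g
    proof (cases "C \<in> ?E")
      case True
      then have "loop C g \<in> Q" using g unfolding Q_def by force
      then show ?thesis using aQ by blast
    next
      case False
      then have nZ: "C \<notin> Z" "C \<notin> bdry Z T" and CV: "C \<in> V" using C by blast+
      have "\<alpha> (loop C (eval_word G (signed G c) (w g))) = \<one>\<^bsub>integer_mod_group p\<^esub>"
      proof (rule cocycle_path_trivial[OF cX _ coc w(1)[OF g] CV])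
        show "group (integer_mod_group p)" by simp
        fix k x assume k: "k \<le> length (w g)" and x: "x \<in> X"
        let ?t = "eval_word G (signed G c) (take k (w g))"
        have "take k (w g) \<in> lists (free_alphabet X)" using w(1)[OF g] by (meson in_lists_conv_set in_set_takeD)
        then have t: "?t \<in> carrier G" by (rule eval_word_closed[OF signed_closed[OF cX]])
        have "?t \<in> T" by (rule T[OF g k])
        then have "C #> ?t \<notin> Z" using nZ CV unfolding bdry_def by blast
        then show "\<alpha> (loop (C #> ?t) (c x)) = \<one>\<^bsub>integer_mod_group p\<^esub>"
          using a0[OF act_closed[OF CV t] _ x] by simp
      qed
      then show ?thesis using w(2)[OF g] by simp
    qed
    have VLact: "C #> u \<in> ?VL" if C: "C \<in> ?VL" and u: "u \<in> L" for C u
    proof -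
      obtain h where h: "h \<in> L" "C = H #> h" using C by blast
      have uG: "u \<in> carrier G" "h \<in> carrier G" using LG u h(1) by blast+
      have "C #> u = H #> (h \<otimes> u)" unfolding h(2) using act_mult[OF base uG(2,1)] by simp
      moreover have "h \<otimes> u \<in> L" by (rule subgroup.m_closed[OF L h(1) u])
      moreover have "C #> u \<in> V" using act_closed[OF _ uG(1)] C by blast
      ultimately show ?thesis by blast
    qed
    have mult0: "\<alpha> (loop C (u \<otimes> v)) = 0"
      if "C \<in> ?VL" "u \<in> L" "v \<in> L" "\<alpha> (loop C u) = 0" "\<alpha> (loop (C #> u) v) = 0" for C u v
    proof -
      have "u \<in> carrier G" "v \<in> carrier G" "C \<in> V" using that LG by blast+
      then have "\<alpha> (loop C (u \<otimes> v)) = \<alpha> (loop C u) \<otimes>\<^bsub>integer_mod_group p\<^esub> \<alpha> (loop (C #> u) v)"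
        using coc unfolding cocycle_def by blast
      then show ?thesis using that(4,5) by simp
    qed
    have genL: "generate G (set xs) \<subseteq> L" by (rule generate_subgroup_incl[OF xs L])
    \<comment> \<open>The generators map \<open>?VL\<close> to itself, so the cocycle identity
      extends vanishing from \<open>set xs\<close> to the subgroup it generates. At the base coset
      this is the hypothesis of \<open>det\<close>.\<close>
    have U0: "\<forall>C\<in>?VL. \<alpha> (loop C u) = 0" if "u \<in> generate G (set xs)" for u
      using that
    proof induction
      case one
      have "\<alpha> (loop C \<one>) = 0" if "C \<in> ?VL" for C
      proof -
        have CV: "C \<in> V" using that by blast
        then have "loop C \<one> = \<one>" using tau_closed[OF CV] by (simp add: loop_def)
        moreover have "\<alpha> \<one> = 0" using loop_def homs_hom[OF ah] hom_one[OF homs_hom[OF ah] group_HG] by simp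
        ultimately show ?thesis by simp
      qed
      then show ?case by blast
    next
      case (incl u)
      then show ?case using gen0 by blast
    next
      case (inv u)
      show ?case
      proof
        fix C assume C: "C \<in> ?VL"
        have uL: "u \<in> L" "inv u \<in> L" using inv xs subgroup.m_inv_closed[OF L] by blast+
        have uG: "u \<in> carrier G" "inv u \<in> carrier G" using uL LG by blast+
        have CV: "C \<in> V" using C by blast
        let ?C = "C #> inv u"
        have C': "?C \<in> ?VL" by (rule VLact[OF C uL(2)])
        have "\<alpha> (loop ?C u) = 0" by (rule gen0[OF C' inv])
        moreover have "\<alpha> (loop C (inv u \<otimes> u)) = \<alpha> (loop C (inv u)) \<otimes>\<^bsub>integer_mod_group p\<^esub> \<alpha> (loop ?C u)"
          using coc CV uG unfolding cocycle_def by blast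
        moreover have "\<alpha> (loop C (inv u \<otimes> u)) = 0"
        proof -
          have "loop C (inv u \<otimes> u) = \<one>" using tau_closed[OF CV] uG CV by (simp add: loop_def)
          then show ?thesis using hom_one[OF homs_hom[OF ah] group_HG] by simp
        qed
        moreover have "0 \<le> \<alpha> (loop C (inv u)) \<and> \<alpha> (loop C (inv u)) < int p" by (rule homs_range[OF p0 ah])
        ultimately show "\<alpha> (loop C (inv u)) = 0" by (simp add: mult_integer_mod_group)
      qed
    next
      case (eng u v)
      have uv: "u \<in> L" "v \<in> L" using eng genL by blast+
      show ?case
      proof
        fix C assume C: "C \<in> ?VL"
        show "\<alpha> (loop C (u \<otimes> v)) = 0"
          by (rule mult0[OF C uv bspec[OF eng.IH(1) C] bspec[OF eng.IH(2) VLact[OF C uv(1)]]])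
      qed
    qed
    show ?thesis
    proof (rule det[OF ah])
      fix u assume u: "u \<in> generate G (set xs) \<inter> H"
      have "H #> \<one> = H" by (rule act_one[OF base])
      then have "H \<in> ?VL" using base subgroup.one_closed[OF L] by blast
      then have "\<alpha> (loop H u) = 0" using U0 u by blast
      then show "\<alpha> u = 0" using loop_base u by simp
    qed
  qed
  have "{\<alpha> \<in> supported p Z. \<forall>q\<in>Q. \<alpha> q = 0} \<subseteq> {\<lambda>x. 0}" using zero by blast
  then have "card {\<alpha> \<in> supported p Z. \<forall>q\<in>Q. \<alpha> q = 0} \<le> 1"
    using card_mono[of "{\<lambda>x. 0 :: int}" "{\<alpha> \<in> supported p Z. \<forall>q\<in>Q. \<alpha> q = 0}"] by simp
  moreover have "card (supported p Z) \<le> card {\<alpha> \<in> supported p Z. \<forall>q\<in>Q. \<alpha> q = 0} * p ^ card Q"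
  proof (rule card_restrict_le[OF finite_supported[OF p0 fin] _ _ finQ])
    show "(\<lambda>x. (f x - g x) mod int p) \<in> supported p Z" if "f \<in> supported p Z" "g \<in> supported p Z" for f g
      using supported_diff[OF p0 that, of 1] by simp
    show "0 \<le> f x \<and> f x < int p" if "f \<in> supported p Z" for f x
      using homs_range[OF p0, of f] that unfolding supported_def by blast
  qed
  ultimately have "card (supported p Z) \<le> 1 * p ^ card Q"
    by (meson mult_le_mono1 le_trans)
  also have "\<dots> \<le> p ^ (length xs * card ?E)"
  proof -
    have "card Q \<le> card (?E \<times> set xs)" unfolding Q_def by (rule card_image_le) (use finE in simp)
    also have "\<dots> = card ?E * card (set xs)" by (rule card_cartesian_product)
    also have "\<dots> \<le> length xs * card ?E" using card_length[of xs] by simp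
    finally show ?thesis using p0 by (simp add: power_increasing)
  qed
  finally show ?thesis .
qed

text \<open>The translates of the cosets of \<open>L\<close> by a transversal are disjoint.\<close>

lemma card_translates_le:
  assumes fin: "finite V" and L: "subgroup L G" "H \<subseteq> L" and Z: "Z \<subseteq> V"
    and Y: "Y \<subseteq> T" "Y \<subseteq> carrier G" "\<And>y y'. y \<in> Y \<Longrightarrow> y' \<in> Y \<Longrightarrow> y \<otimes> inv y' \<in> L \<Longrightarrow> y = y'"
  shows "card Y * card ({C \<in> V. \<exists>h\<in>L. C = H #> h} \<inter> Z - bdry Z T) \<le> card Z"
proof -
  \<comment> \<open>The interior part of \<open>Z\<close> among the cosets inside \<open>L\<close>.
    Its translates by \<open>Y\<close> stay in \<open>Z\<close> because \<open>Y\<close> is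
    contained in \<open>T\<close>, so its share of \<open>Z\<close> is at most one in
    \<open>card Y\<close>.\<close>
  let ?A = "{C \<in> V. \<exists>h\<in>L. C = H #> h} \<inter> Z - bdry Z T"
  have "card (Y \<times> ?A) \<le> card Z"
  proof (rule card_inj_on_le[of "\<lambda>(y, C). C #> y"])
    show "inj_on (\<lambda>(y, C). C #> y) (Y \<times> ?A)"
    proof (rule inj_onI)
      fix q q' assume q: "q \<in> Y \<times> ?A" "q' \<in> Y \<times> ?A" "(\<lambda>(y, C). C #> y) q = (\<lambda>(y, C). C #> y) q'"
      obtain y C y' C' where qq: "q = (y, C)" "q' = (y', C')" by (cases q, cases q')
      have y: "y \<in> Y" "y' \<in> Y" and CV: "C \<in> V" "C' \<in> V" and eq: "C #> y = C' #> y'"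
        and hh: "\<exists>h\<in>L. C = H #> h" "\<exists>h\<in>L. C' = H #> h"
        using q unfolding qq by blast+
      obtain h where h: "h \<in> L" "C = H #> h" using hh(1) by blast
      obtain h' where h': "h' \<in> L" "C' = H #> h'" using hh(2) by blast
      have G: "y \<in> carrier G" "y' \<in> carrier G" "h \<in> carrier G" "h' \<in> carrier G"
        using y Y(2) h(1) h'(1) subgroup.subset[OF L(1)] by blast+
      have "H #> (h \<otimes> y) = H #> (h' \<otimes> y')"
        using eq unfolding h(2) h'(2) act_mult[OF base G(3,1)] act_mult[OF base G(4,2)] .
      then have "h \<otimes> y \<otimes> inv (h' \<otimes> y') \<in> H"
        using rcoset_eq_iff[OF sub m_closed[OF G(3,1)] m_closed[OF G(4,2)]] by (rule iffD1[rotated])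
      then have "h \<otimes> y \<otimes> inv (h' \<otimes> y') \<in> L" by (rule subsetD[OF L(2)])
      then have "inv h \<otimes> (h \<otimes> y \<otimes> inv (h' \<otimes> y')) \<otimes> h' \<in> L"
        by (rule subgroup.m_closed[OF L(1) subgroup.m_closed[OF L(1) subgroup.m_inv_closed[OF L(1) h(1)]] h'(1)])
      moreover have "inv h \<otimes> (h \<otimes> y \<otimes> inv (h' \<otimes> y')) \<otimes> h' = y \<otimes> inv y'"
      proof -
        have "inv h \<otimes> (h \<otimes> y \<otimes> inv (h' \<otimes> y')) \<otimes> h' = (inv h \<otimes> h) \<otimes> y \<otimes> inv y' \<otimes> (inv h' \<otimes> h')"
          unfolding inv_mult_group[OF G(4,2)] using G by (simp only: m_assoc inv_closed m_closed)
        then show ?thesis using G by simp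
      qed
      ultimately have yy: "y = y'" using Y(3)[OF y] by simp
      have eq': "C #> y = C' #> y" using eq unfolding yy .
      have "C = C #> y #> inv y" using act_inv(1)[OF CV(1) G(1)] by simp
      also have "\<dots> = C' #> y #> inv y" using eq' by (rule arg_cong)
      also have "\<dots> = C'" by (rule act_inv(1)[OF CV(2) G(1)])
      finally show "q = q'" using yy qq by simp
    qed
    show "(\<lambda>(y, C). C #> y) ` (Y \<times> ?A) \<subseteq> Z"
    proof clarify
      fix y C assume y: "y \<in> Y" and C: "C \<in> V" "C \<in> Z" "C \<notin> bdry Z T"
      then show "C #> y \<in> Z" using Y(1) unfolding bdry_def by blast
    qed
    show "finite Z" using Z fin finite_subset by blast
  qed
  then show ?thesis by (simp add: card_cartesian_product)
qed

lemma bdry_compl: "T \<subseteq> carrier G \<Longrightarrow> bdry (V - D) T = bdry D T"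
proof -
  assume T: "T \<subseteq> carrier G"
  have "(C \<in> V - D) \<noteq> (C #> t \<in> V - D) \<longleftrightarrow> (C \<in> D) \<noteq> (C #> t \<in> D)" if "C \<in> V" "t \<in> T" for C t
    using that act_closed[OF that(1), of t] T by blast
  then show ?thesis unfolding bdry_def by blast
qed

text \<open>The homomorphisms vanishing near the boundary of \<open>D\<close> form a space of
  dimension at least \<open>y + 2\<close>, while those supported on one side have dimension at most
  \<open>y\<close>. The margin suffices for both choices below, since \<open>2 * p ^ y\<close> and
  \<open>p * p ^ y\<close> are smaller than \<open>p ^ (y + 2)\<close>.\<close>

lemma free_quotients:
  assumes p: "prime p" and fin: "finite X" "finite V"
    and B: "bdry D relator_differences \<subseteq> B" "B \<subseteq> V"
    and small: "card (supported p D) \<le> p ^ y" "card (supported p (V - D)) \<le> p ^ y"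
    and e: "card (homs p HG) = p ^ e" "card X * card B + y + 2 \<le> e"
  shows "epi HG (free_product (integer_mod_group p) (integer_mod_group p)) \<noteq> {}"
    "\<exists>N. N \<lhd> HG \<and> (\<exists>k. card (rcosets\<^bsub>HG\<^esub> N) = p ^ k) \<and> onto_nonabelian_free (HG\<lparr>carrier := N\<rparr>)"
proof -
  have p2: "p \<ge> 2" using p prime_ge_2_nat by blast
  then have p0: "p > 0" by simp
  have finB: "finite B" using B(2) fin(2) finite_subset by blast
  define Q where "Q = (\<lambda>(C, x). loop C (c x)) ` (B \<times> X)"
  \<comment> \<open>One linear condition for each edge starting in \<open>B\<close>, so the
    codimension is at most \<open>card X * card B\<close>.\<close>
  define HB where "HB = {\<alpha> \<in> homs p HG. \<forall>q\<in>Q. \<alpha> q = 0}"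
  have finh: "finite (homs p HG)" by (rule finite_homs[OF p0 fin])
  then have finHB: "finite HB" by (simp add: HB_def)
  have HBh: "\<alpha> \<in> homs p HG" if "\<alpha> \<in> HB" for \<alpha> using that by (simp add: HB_def)
  have triv: "\<alpha> (loop C (c x)) = 0" if "\<alpha> \<in> HB" "C \<in> bdry D relator_differences" "x \<in> X" for \<alpha> C x
  proof -
    have "loop C (c x) \<in> Q" using that(2,3) B(1) unfolding Q_def by force
    then show ?thesis using that(1) by (simp add: HB_def)
  qed
  have cQ: "card Q \<le> card X * card B"
  proof -
    have "card Q \<le> card (B \<times> X)" unfolding Q_def by (rule card_image_le) (use finB fin in simp)
    then show ?thesis by (simp add: card_cartesian_product mult.commute)
  qed
  have "card (homs p HG) \<le> card HB * p ^ card Q"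
    unfolding HB_def
  proof (rule card_restrict_le[OF finh])
    show "(\<lambda>x. (f x - g x) mod int p) \<in> homs p HG" if "f \<in> homs p HG" "g \<in> homs p HG" for f g
      using homs_diff[OF p0 that, of 1] by simp
    show "0 \<le> f x \<and> f x < int p" if "f \<in> homs p HG" for f x by (rule homs_range[OF p0 that])
    show "finite Q" using finB fin by (simp add: Q_def)
  qed
  also have "\<dots> \<le> card HB * p ^ (card X * card B)"
    using cQ p0 by (intro mult_le_mono2 power_increasing) auto
  finally have "p ^ (y + 2) * p ^ (card X * card B) \<le> card HB * p ^ (card X * card B)"
    unfolding e(1) power_add[symmetric]
    using power_increasing[of "y + 2 + card X * card B" e p] e(2) p0 by (simp add: ac_simps)
  then have big: "p ^ (y + 2) \<le> card HB" using p0 by simp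
  have pp: "p * p ^ y < p ^ (y + 2)" "p ^ y + p ^ y < p ^ (y + 2)"
  proof -
    have "p ^ (y + 2) = p * (p * p ^ y)" by (simp add: power_add power2_eq_square)
    moreover have "2 * (p * p ^ y) \<le> p * (p * p ^ y)" using p2 by (rule mult_le_mono1)
    moreover have "2 * p ^ y \<le> p * p ^ y" using p2 by (rule mult_le_mono1)
    moreover have "0 < p ^ y" using p0 by simp
    ultimately show "p * p ^ y < p ^ (y + 2)" "p ^ y + p ^ y < p ^ (y + 2)" by linarith+
  qed
  let ?LD = "supported p D" and ?LE = "supported p (V - D)"
  have finL: "finite ?LD" "finite ?LE" using finite_supported[OF p0 fin] by simp_all
  have "card (?LD \<union> ?LE) < card HB"
    using card_Un_le[of ?LD ?LE] small pp(2) big by linarith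
  then have "\<not> HB \<subseteq> ?LD \<union> ?LE" using card_mono[of "?LD \<union> ?LE" HB] finL by auto
  \<comment> \<open>Outside both supported spaces, \<alpha> is non-zero on an edge starting outside
    \<open>D\<close> and on an edge starting inside.\<close>
  then obtain \<alpha> where a: "\<alpha> \<in> HB" "\<alpha> \<notin> ?LD" "\<alpha> \<notin> ?LE" by blast
  obtain C3 x3 where 3: "C3 \<in> V" "C3 \<notin> D" "x3 \<in> X" "\<alpha> (loop C3 (c x3)) \<noteq> 0"
    using a(2) HBh[OF a(1)] unfolding supported_def by blast
  obtain C1 x1 where 1: "C1 \<in> V" "C1 \<in> D" "x1 \<in> X" "\<alpha> (loop C1 (c x1)) \<noteq> 0"
    using a(3) HBh[OF a(1)] unfolding supported_def by blast
  \<comment> \<open>The space \<open>?LE\<close> enlarged by the line through \<alpha>. A \<beta>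
    outside it stays non-zero somewhere on \<open>D\<close> after any multiple of \<alpha> is
    subtracted.\<close>
  define F where "F = (\<lambda>(\<beta>, k) x. (\<beta> x + int k * \<alpha> x) mod int p) ` (?LE \<times> {..<p})"
  have "card F \<le> card (?LE \<times> {..<p})" unfolding F_def by (rule card_image_le) (use finL in simp)
  also have "\<dots> = card ?LE * p" by (simp add: card_cartesian_product)
  also have "\<dots> \<le> p ^ y * p" using small(2) by (rule mult_le_mono1)
  also have "\<dots> < card HB" unfolding mult.commute[of "p ^ y" p] by (rule less_le_trans[OF pp(1) big])
  finally have "card F < card HB" .
  moreover have "finite F" unfolding F_def using finL by simp
  ultimately have "\<not> HB \<subseteq> F" using card_mono[of F HB] by auto
  then obtain \<beta> where b: "\<beta> \<in> HB" "\<beta> \<notin> F" by blast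
  let ?a = "\<alpha> (loop C1 (c x1))" and ?b = "\<beta> (loop C1 (c x1))"
  \<comment> \<open>This multiple makes \<open>\<beta> - k \<alpha>\<close> vanish at the edge
    \<open>(C1, x1)\<close>. It is still non-zero at another edge in \<open>D\<close>, so the pair
    of values there is non-trivial and differs from the pair at the first edge.\<close>
  obtain k where k: "k < p" "(?b - int k * ?a) mod int p = 0"
  proof -
    have "0 < ?a" "?a < int p" using 1(4) homs_range[OF p0 HBh[OF a(1)], of "loop C1 (c x1)"] by linarith+
    then have "\<not> int p dvd ?a" using zdvd_imp_le[of "int p" ?a] by linarith
    then have "coprime ?a (int p)" using p by (simp add: prime_imp_coprime coprime_commute)
    then obtain i where i: "[?a * i = 1] (mod int p)" using cong_solve_coprime_int by blast
    let ?k = "nat ((i * ?b) mod int p)"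
    have kk: "int ?k = (i * ?b) mod int p" using p0 by simp
    have "[int ?k * ?a = i * ?b * ?a] (mod int p)" unfolding kk by (simp add: cong_def mod_mult_left_eq)
    also have "i * ?b * ?a = (?a * i) * ?b" by simp
    also have "[(?a * i) * ?b = 1 * ?b] (mod int p)" using i by (rule cong_scalar_right)
    finally have "[?b = int ?k * ?a] (mod int p)" by (simp add: cong_sym)
    then have z: "(?b - int ?k * ?a) mod int p = 0" by (simp add: cong_iff_dvd_diff)
    have "int ?k < int p" unfolding kk using p0 by simp
    then have "?k < p" by (simp only: of_nat_less_iff)
    then show ?thesis using z by (rule that)
  qed
  let ?g = "\<lambda>x. (\<beta> x - int k * \<alpha> x) mod int p"
  have gh: "?g \<in> homs p HG" by (rule homs_diff[OF p0 HBh[OF b(1)] HBh[OF a(1)]])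
  have "?g \<notin> ?LE"
  proof
    assume "?g \<in> ?LE"
    then have "(\<lambda>(\<beta>, k) x. (\<beta> x + int k * \<alpha> x) mod int p) (?g, k) \<in> F" unfolding F_def using k(1) by blast
    moreover have "(\<lambda>(\<beta>, k) x. (\<beta> x + int k * \<alpha> x) mod int p) (?g, k) = \<beta>"
    proof
      fix x
      show "(\<lambda>(\<beta>, k) x. (\<beta> x + int k * \<alpha> x) mod int p) (?g, k) x = \<beta> x"
        using homs_range[OF p0 HBh[OF b(1)], of x] by (simp add: mod_add_left_eq)
    qed
    ultimately show False using b(2) by simp
  qed
  then obtain C2 x2 where 2: "C2 \<in> V" "C2 \<in> D" "x2 \<in> X" "?g (loop C2 (c x2)) \<noteq> 0"
    using gh unfolding supported_def by blast
  note ah = homs_hom[OF HBh[OF a(1)]] and bh = homs_hom[OF HBh[OF b(1)]]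
  show "epi HG (free_product (integer_mod_group p) (integer_mod_group p)) \<noteq> {}"
    by (rule epi_free_product[where \<alpha> = \<alpha> and D = D, OF p ah _ 1 3]) (rule triv[OF a(1)])
  let ?u = "\<lambda>C x. (\<alpha> (loop C (c x)), \<beta> (loop C (c x)))"
  have u2: "?u C2 x2 \<noteq> (0, 0)"
  proof
    assume "?u C2 x2 = (0, 0)"
    then have "\<alpha> (loop C2 (c x2)) = 0" "\<beta> (loop C2 (c x2)) = 0" by simp_all
    with 2(4) show False by simp
  qed
  have u12: "?u C1 x1 \<noteq> ?u C2 x2"
  proof
    assume "?u C1 x1 = ?u C2 x2"
    then have "\<alpha> (loop C2 (c x2)) = ?a" "\<beta> (loop C2 (c x2)) = ?b" by simp_all
    with 2(4) k(2) show False by (simp only:)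
  qed
  have u13: "?u C1 x1 \<noteq> (0, 0)" "?u C3 x3 \<noteq> (0, 0)" using 1(4) 3(4) by simp_all
  show "\<exists>N. N \<lhd> HG \<and> (\<exists>k. card (rcosets\<^bsub>HG\<^esub> N) = p ^ k) \<and> onto_nonabelian_free (HG\<lparr>carrier := N\<rparr>)"
    by (rule normal_onto_free[where \<alpha> = \<alpha> and \<beta> = \<beta> and D = D and ?u1.0 = "?u C1 x1" and
          ?u2.0 = "?u C2 x2" and ?u3.0 = "?u C3 x3", OF p ah bh _ _ 1(1-3) HOL.refl 2(1-3) HOL.refl
          3(1-3) HOL.refl u13(1) u2 u13(2) u12]) (rule triv[OF a(1)] triv[OF b(1)]; assumption)+
qed

lemma finite_relator_differences: "finite R \<Longrightarrow> finite relator_differences"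
proof -
  assume R: "finite R"
  let ?e = "\<lambda>r k. eval_word G (signed G c) (take k r)"
  have "relator_differences \<subseteq> (\<Union>r\<in>R. (\<lambda>(k, l). inv (?e r k) \<otimes> ?e r l) ` ({..length r} \<times> {..length r}))"
    unfolding relator_differences_def by force
  then show ?thesis by (rule finite_subset) (use R in simp)
qed

lemma relator_differences_closed: "relator_differences \<subseteq> carrier G"
proof -
  have cX: "c \<in> X \<rightarrow> carrier G" and R: "R \<subseteq> lists (free_alphabet X)" using pres unfolding presents_def by blast+
  have "eval_word G (signed G c) (take k r) \<in> carrier G" if "r \<in> R" for k r
  proof (rule eval_word_closed[OF signed_closed[OF cX]])
    show "take k r \<in> lists (free_alphabet X)" using that R by (meson in_lists_conv_set in_set_takeD subsetD)
  qed
  then show ?thesis unfolding relator_differences_def by blast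
qed

end

section \<open>The dichotomy\<close>

context schreier
begin

text \<open>\<open>D\<close> and its complement each have at most three quarters of the cosets;
  division by \<open>card Y\<close> bounds their interior cosets inside \<open>L\<close>. The
  boundary is charged \<open>card X\<close> times for the conditions that make a homomorphism vanish
  near it, and \<open>length xs\<close> times for the lifts that start on it.\<close>

lemma free_quotients_of_almost_invariant:
  assumes p: "prime p" and fin: "finite X" "finite V"
    and L: "subgroup L G" "H \<subseteq> L" and xs: "set xs \<subseteq> L"
    and w: "\<And>x. x \<in> set xs \<Longrightarrow> w x \<in> lists (free_alphabet X)"
      "\<And>x. x \<in> set xs \<Longrightarrow> eval_word G (signed G c) (w x) = x"
    and T: "T \<subseteq> carrier G" "relator_differences \<subseteq> T" "Y \<subseteq> T"
      "\<And>x k. x \<in> set xs \<Longrightarrow> k \<le> length (w x) \<Longrightarrow> eval_word G (signed G c) (take k (w x)) \<in> T"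
    and Y: "0 < card Y" "\<And>y y'. y \<in> Y \<Longrightarrow> y' \<in> Y \<Longrightarrow> y \<otimes> inv y' \<in> L \<Longrightarrow> y = y'"
    and det: "\<And>\<alpha>. \<alpha> \<in> homs p HG \<Longrightarrow> (\<And>u. u \<in> generate G (set xs) \<inter> H \<Longrightarrow> \<alpha> u = 0) \<Longrightarrow> \<alpha> = (\<lambda>x. 0)"
    and D: "D \<subseteq> V" "card V < 4 * card D" "2 * card D \<le> card V"
    and e: "card (homs p HG) = p ^ e"
      "real (card X + length xs) * real (card (bdry D T)) +
         real (length xs) * (3 * real (card V) / (4 * real (card Y))) + 2 \<le> real e"
  shows "epi HG (free_product (integer_mod_group p) (integer_mod_group p)) \<noteq> {}"
    "\<exists>N. N \<lhd> HG \<and> (\<exists>k. card (rcosets\<^bsub>HG\<^esub> N) = p ^ k) \<and> onto_nonabelian_free (HG\<lparr>carrier := N\<rparr>)"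
proof -
  let ?VL = "{C \<in> V. \<exists>h\<in>L. C = H #> h}"
  let ?E = "\<lambda>Z. ?VL \<inter> (Z \<union> bdry Z T)"
  define B where "B = bdry D T"
  have BV: "B \<subseteq> V" by (auto simp: B_def bdry_def)
  have YG: "Y \<subseteq> carrier G" using T(1,3) by blast
  have bound: "real (card (?E Z)) \<le> 3 * real (card V) / (4 * real (card Y)) + real (card B)"
    if Z: "Z \<subseteq> V" "4 * card Z \<le> 3 * card V" and b: "bdry Z T = B" for Z
  proof -
    let ?A = "?VL \<inter> Z - B"
    have "card Y * card ?A \<le> card Z"
      using card_translates_le[OF fin(2) L Z(1) T(3) YG Y(2)] unfolding b by blast
    then have "4 * (card Y * card ?A) \<le> 3 * card V" using Z(2) by linarith
    then have "real (4 * (card Y * card ?A)) \<le> real (3 * card V)" by (simp only: of_nat_le_iff)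
    then have A: "real (card ?A) \<le> 3 * real (card V) / (4 * real (card Y))"
      using Y(1) by (simp add: pos_le_divide_eq mult.commute mult.left_commute)
    have "finite ?A" "finite B" using fin(2) finite_subset[OF BV] by simp_all
    then have "card (?E Z) \<le> card (?A \<union> B)" unfolding b by (intro card_mono) auto
    also have "\<dots> \<le> card ?A + card B" by (rule card_Un_le)
    finally show ?thesis using A by linarith
  qed
  have cD: "card (V - D) = card V - card D" using D(1) fin(2) by (meson card_Diff_subset finite_subset)
  have ED: "real (card (?E D)) \<le> 3 * real (card V) / (4 * real (card Y)) + real (card B)"
    by (rule bound[OF D(1)]) (use D(3) in \<open>simp_all add: B_def\<close>)
  have EE: "real (card (?E (V - D))) \<le> 3 * real (card V) / (4 * real (card Y)) + real (card B)"
    by (rule bound) (use D(2) cD bdry_compl[OF T(1)] in \<open>auto simp: B_def\<close>)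
  define m where "m = max (card (?E D)) (card (?E (V - D)))"
  have m: "real m \<le> 3 * real (card V) / (4 * real (card Y)) + real (card B)"
    using ED EE by (simp add: m_def)
  have supp: "card (supported p Z) \<le> p ^ (length xs * m)" if "card (?E Z) \<le> m" for Z
  proof -
    have "card (supported p Z) \<le> p ^ (length xs * card (?E Z))"
      by (rule card_supported_le[OF p fin L(1) xs w T(4) det])
    also have "\<dots> \<le> p ^ (length xs * m)"
      using that prime_gt_0_nat[OF p] by (intro power_increasing mult_le_mono2) auto
    finally show ?thesis .
  qed
  have "real (length xs) * real m \<le> real (length xs) * (3 * real (card V) / (4 * real (card Y)) + real (card B))"
    using m by (intro mult_left_mono) auto
  then have "real (card X * card B + length xs * m + 2) \<le> real e"
    using e(2) unfolding B_def[symmetric] by (simp add: algebra_simps)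
  then have ee: "card X * card B + length xs * m + 2 \<le> e" by (simp only: of_nat_le_iff)
  have sD: "card (supported p D) \<le> p ^ (length xs * m)" "card (supported p (V - D)) \<le> p ^ (length xs * m)"
    by (rule supp; simp add: m_def)+
  have "bdry D relator_differences \<subseteq> B" unfolding B_def bdry_def using T(2) by blast
  note fq = free_quotients[OF p fin this BV sD e(1) ee]
  show "epi HG (free_product (integer_mod_group p) (integer_mod_group p)) \<noteq> {}"
    by (rule fq(1))
  show "\<exists>N. N \<lhd> HG \<and> (\<exists>k. card (rcosets\<^bsub>HG\<^esub> N) = p ^ k) \<and> onto_nonabelian_free (HG\<lparr>carrier := N\<rparr>)"
    by (rule fq(2))
qed

end

lemma presents_generate:
  assumes G: "group G" and pres: "presents G X c R"
  shows "generate G (c ` X) = carrier G"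
proof -
  interpret group G by fact
  have c: "c \<in> X \<rightarrow> carrier G" and im: "eval_word G (signed G c) ` lists (free_alphabet X) = carrier G"
    using pres unfolding presents_def by blast+
  have cs: "c ` X \<subseteq> carrier G" using c by blast
  interpret U: subgroup "generate G (c ` X)" G by (rule generate_is_subgroup[OF cs])
  have "signed G c \<in> free_alphabet X \<rightarrow> generate G (c ` X)"
  proof
    fix a assume "a \<in> free_alphabet X"
    then obtain x b where a: "a = (x, b)" "x \<in> X" by auto
    have "c x \<in> generate G (c ` X)" using a(2) by (blast intro: generate.incl)
    then show "signed G c a \<in> generate G (c ` X)" unfolding a(1) signed_def by (cases b) simp_all
  qed
  then have "eval_word G (signed G c) w \<in> generate G (c ` X)" if "w \<in> lists (free_alphabet X)" for w
    using that by (intro eval_word_in_submonoid[OF U.one_closed U.m_closed])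
  then have "carrier G \<subseteq> generate G (c ` X)" unfolding im[symmetric] by blast
  then show ?thesis using generate_incl[OF cs] by blast
qed

theorem theorem1p1:
  fixes G :: "('a, 'b) monoid_scheme" and Gs :: "nat \<Rightarrow> 'a set" and p :: nat
  assumes "group G" and "finitely_presented G"
    and "prime p"
    and "\<And>i. subgroup (Gs i) G"
    and "\<And>i. finite (rcosets\<^bsub>G\<^esub> (Gs i))"
    and "\<And>i. Gs (Suc i) \<lhd> G\<lparr>carrier := Gs i\<rparr>"
    and "\<And>i. \<exists>k. card (rcosets\<^bsub>G\<lparr>carrier := Gs i\<rparr>\<^esub> (Gs (Suc i))) = p ^ k"
    and "linear_growth_mod_homology p G (range Gs)"
  shows "((\<exists>i. epi (G\<lparr>carrier := Gs i\<rparr>)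
                 (free_product (integer_mod_group p) (integer_mod_group p)) \<noteq> {} \<and>
               (\<exists>N. N \<lhd> G\<lparr>carrier := Gs i\<rparr> \<and>
                    (\<exists>k. card (rcosets\<^bsub>G\<lparr>carrier := Gs i\<rparr>\<^esub> N) = p ^ k) \<and>
                    onto_nonabelian_free (G\<lparr>carrier := N\<rparr>)))
          \<and> large G)
        \<or> property_tau G (range Gs)"
proof (rule disjCI)
  assume ntau: "\<not> property_tau G (range Gs)"
  note p = \<open>prime p\<close> and sub = assms(4) and fin = assms(5) and nor = assms(6) and ind = assms(7)
  interpret group G by fact
  have p0: "p > 0" using p by (rule prime_gt_0_nat)
  obtain X :: "nat set" and c R where X: "finite X" "finite R" and pres: "presents G X c R"
    using presents_exists[OF assms(1,2)] .
  let ?A = "free_alphabet X" and ?ev = "eval_word G (signed G c)"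
  have cX: "c \<in> X \<rightarrow> carrier G" and im: "?ev ` lists ?A = carrier G"
    using pres unfolding presents_def by blast+
  define S where "S = c ` X"
  have S: "finite S" "S \<subseteq> carrier G" "generate G S = carrier G"
    unfolding S_def using X(1) cX presents_generate[OF assms(1) pres] by blast+
  have find: "finite (rcosets\<^bsub>G\<lparr>carrier := Gs k\<rparr>\<^esub> (Gs (Suc k)))" for k
    using ind[of k] p0 by (intro card_ge_0_finite) (elim exE, simp)
  have grp: "group (G\<lparr>carrier := Gs k\<rparr>)" for k by (rule subgroup_imp_group[OF sub])
  \<comment> \<open>The length of \<open>ys\<close> is the dimension of the space of homomorphisms,
    and \<open>ys\<close> itself is a set of elements on which they can be tested.\<close>
  have "\<exists>ys. set ys \<subseteq> Gs k \<and> card (homs p (G\<lparr>carrier := Gs k\<rparr>)) = p ^ length ys \<and>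
      (\<forall>\<alpha>\<in>homs p (G\<lparr>carrier := Gs k\<rparr>). (\<forall>x\<in>set ys. \<alpha> x = 0) \<longrightarrow> \<alpha> = (\<lambda>x. 0))" for k
  proof -
    obtain \<tau> rank where "schreier G (Gs k) \<tau> X c R rank" using schreier_exists[OF sub pres] .
    then have fh: "finite (homs p (G\<lparr>carrier := Gs k\<rparr>))" by (rule schreier.finite_homs[OF _ p0 X(1) fin])
    obtain ys where "card (homs p (G\<lparr>carrier := Gs k\<rparr>)) = p ^ length ys"
      "set ys \<subseteq> carrier (G\<lparr>carrier := Gs k\<rparr>)"
      "\<And>\<alpha>. \<alpha> \<in> homs p (G\<lparr>carrier := Gs k\<rparr>) \<Longrightarrow> (\<And>x. x \<in> set ys \<Longrightarrow> \<alpha> x = 0) \<Longrightarrow> \<alpha> = (\<lambda>x. 0)"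
      using homs_separating[OF p group.is_monoid[OF grp] fh] by blast
    then show ?thesis by (intro exI[of _ ys]) auto
  qed
  then obtain xs where "\<forall>k. set (xs k) \<subseteq> Gs k \<and> card (homs p (G\<lparr>carrier := Gs k\<rparr>)) = p ^ length (xs k) \<and>
      (\<forall>\<alpha>\<in>homs p (G\<lparr>carrier := Gs k\<rparr>). (\<forall>x\<in>set (xs k). \<alpha> x = 0) \<longrightarrow> \<alpha> = (\<lambda>x. 0))"
    using choice[of "\<lambda>k ys. set ys \<subseteq> Gs k \<and> card (homs p (G\<lparr>carrier := Gs k\<rparr>)) = p ^ length ys \<and>
      (\<forall>\<alpha>\<in>homs p (G\<lparr>carrier := Gs k\<rparr>). (\<forall>x\<in>set ys. \<alpha> x = 0) \<longrightarrow> \<alpha> = (\<lambda>x. 0))"] by blast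
  then have xs: "set (xs k) \<subseteq> Gs k" "card (homs p (G\<lparr>carrier := Gs k\<rparr>)) = p ^ length (xs k)"
    and sep: "\<And>\<alpha>. \<alpha> \<in> homs p (G\<lparr>carrier := Gs k\<rparr>) \<Longrightarrow> (\<And>x. x \<in> set (xs k) \<Longrightarrow> \<alpha> x = 0) \<Longrightarrow> \<alpha> = (\<lambda>x. 0)" for k
    by blast+
  let ?e = "\<lambda>k. real (length (xs k))" and ?N = "\<lambda>k. real (card (rcosets\<^bsub>G\<^esub> (Gs k)))"
  have N0: "0 < card (rcosets\<^bsub>G\<^esub> (Gs k))" for k
    using fin[of k] subgroup_in_rcosets'[OF sub[of k]] by (auto simp: card_gt_0_iff)
  have dim: "dim_H1_mod p (G\<lparr>carrier := Gs k\<rparr>) \<le> length (xs k)" for k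
    by (rule dim_H1_mod_le[OF p grp _ sep]) (use xs(1) in simp)
  \<comment> \<open>By \<open>dim\<close> this infimum is at least the one in the growth hypothesis,
    hence positive.\<close>
  define b where "b = (INF k. ?e k / ?N k)"
  have bdd: "bdd_below (range (\<lambda>k. ?e k / ?N k))" by (rule bdd_belowI2[of _ 0]) simp
  have b0: "0 < b"
  proof -
    let ?d = "\<lambda>H. real (dim_H1_mod p (G\<lparr>carrier := H\<rparr>)) / real (card (rcosets\<^bsub>G\<^esub> H))"
    have "0 < (INF H\<in>range Gs. ?d H)" using assms(8) unfolding linear_growth_mod_homology_def .
    also have "(INF H\<in>range Gs. ?d H) \<le> b"
      unfolding b_def
    proof (rule cINF_greatest)
      fix k
      have "(INF H\<in>range Gs. ?d H) \<le> ?d (Gs k)"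
        by (rule cINF_lower) (auto intro: bdd_belowI2[of _ 0])
      also have "\<dots> \<le> ?e k / ?N k" using dim[of k] by (intro divide_right_mono) auto
      finally show "(INF H\<in>range Gs. ?d H) \<le> ?e k / ?N k" .
    qed simp
    finally show ?thesis .
  qed
  have low: "b * ?N k \<le> ?e k" for k
  proof -
    have "b \<le> ?e k / ?N k" unfolding b_def by (rule cINF_lower[OF bdd]) simp
    then show ?thesis using N0[of k] by (simp add: pos_le_divide_eq)
  qed
  \<comment> \<open>A positive infimum is approached within any factor above 1; the factor has to
    stay below 4/3 to be outweighed by the gain of 3/4.\<close>
  have "Inf (range (\<lambda>k. ?e k / ?N k)) < 9 / 8 * b" using b0 unfolding b_def by simp
  from cInf_lessD[OF _ this] obtain i where "?e i / ?N i < 9 / 8 * b" by auto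
  then have hi: "?e i \<le> 9 / 8 * b * ?N i" using N0[of i] by (simp add: pos_divide_less_eq)
  define w where "w = inv_into (lists ?A) ?ev"
  have w: "w x \<in> lists ?A" "?ev (w x) = x" if "x \<in> carrier G" for x
    using that unfolding w_def im[symmetric] by (rule inv_into_into, rule f_inv_into_f)
  have xsG: "x \<in> carrier G" if "x \<in> set (xs i)" for x
    using that xs(1)[of i] subgroup.subset[OF sub[of i]] by blast
  obtain \<sigma> where "transversal G (Gs i) \<sigma>" using transversal_exists[OF sub[of i]] .
  then interpret I: transversal G "Gs i" \<sigma> .
  define Y where "Y = \<sigma> ` (rcosets\<^bsub>G\<^esub> (Gs i))"
  have cY: "card Y = card (rcosets\<^bsub>G\<^esub> (Gs i))"
    unfolding Y_def by (rule card_image, rule inj_on_inverseI[of _ "\<lambda>y. Gs i #>\<^bsub>G\<^esub> y"]) (rule I.tau_repr)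
  have YG: "Y \<subseteq> carrier G" unfolding Y_def using I.tau_closed by blast
  have Ysep: "y = y'" if y: "y \<in> Y" "y' \<in> Y" and m: "y \<otimes>\<^bsub>G\<^esub> inv\<^bsub>G\<^esub> y' \<in> Gs i" for y y'
  proof -
    obtain C C' where C: "C \<in> rcosets\<^bsub>G\<^esub> (Gs i)" "y = \<sigma> C" "C' \<in> rcosets\<^bsub>G\<^esub> (Gs i)" "y' = \<sigma> C'"
      using y unfolding Y_def by blast
    have "Gs i #>\<^bsub>G\<^esub> y = Gs i #>\<^bsub>G\<^esub> y'" using rcoset_eq_iff[OF sub, of y y' i] m y YG by blast
    then have "C = C'" unfolding C(2,4) I.tau_repr[OF C(1)] I.tau_repr[OF C(3)] .
    then show ?thesis using C by simp
  qed
  obtain \<tau>\<^sub>0 rank\<^sub>0 where s0: "schreier G (Gs i) \<tau>\<^sub>0 X c R rank\<^sub>0" using schreier_exists[OF sub pres] .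
  \<comment> \<open>The displacements that \<open>D\<close> has to respect: those of the relators
    for the cut, the transversal for equal distribution, and the prefixes of words for tracing the
    lifts. The index \<open>j\<close> is not yet chosen.\<close>
  define T where "T = schreier.relator_differences G c R \<union> Y \<union>
    (\<Union>x\<in>set (xs i). (\<lambda>k. ?ev (take k (w x))) ` {..length (w x)})"
  have "finite T"
    unfolding T_def Y_def using schreier.finite_relator_differences[OF s0 X(2)] fin by simp
  have TG: "T \<subseteq> carrier G"
  proof -
    have "?ev (take k (w x)) \<in> carrier G" if "x \<in> set (xs i)" for k x
    proof (rule eval_word_closed[OF signed_closed[OF cX]])
      show "take k (w x) \<in> lists ?A"
        using w(1)[OF xsG[OF that]] by (meson in_lists_conv_set in_set_takeD)
    qed
    then show ?thesis unfolding T_def using schreier.relator_differences_closed[OF s0] YG by blast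
  qed
  have "T \<subseteq> ?ev ` lists ?A" using TG unfolding im .
  with \<open>finite T\<close> obtain W where W: "W \<subseteq> lists ?A" "finite W" "T = ?ev ` W"
    using finite_subset_image[of T ?ev "lists ?A"] by blast
  \<comment> \<open>The total length of words for \<open>T\<close>; it bounds the vertices of
    \<open>bdry D T\<close> by \<open>M\<close> times the number of boundary arcs.\<close>
  define M where "M = (\<Sum>v\<in>W. length v)"
  \<comment> \<open>The summand 2 stands for the two dimensions in reserve. It can be charged to the
    boundary too, since the boundary of \<open>D\<close> has at least one arc.\<close>
  let ?q = "real (card X + length (xs i)) * real M + 2"
  have q: "0 < ?q" by (simp add: add_nonneg_pos)
  have eps: "0 < b / (32 * ?q)" using b0 q by simp
  obtain j D where ij: "i < j" and D: "D \<subseteq> rcosets\<^bsub>G\<^esub> (Gs j)" "card (rcosets\<^bsub>G\<^esub> (Gs j)) < 4 * card D"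
      "2 * card D \<le> card (rcosets\<^bsub>G\<^esub> (Gs j))"
    and bd: "0 < card (coset_boundary G (Gs j) S D)"
      "real (card (coset_boundary G (Gs j) S D)) \<le> b / (32 * ?q) * ?N j"
    using almost_invariant_sets[of Gs S "b / (32 * ?q)" i, OF sub fin nor find S ntau eps] .
  obtain \<tau> rank where "schreier G (Gs j) \<tau> X c R rank" using schreier_exists[OF sub pres] .
  then interpret J: schreier G "Gs j" \<tau> X c R rank .
  let ?d = "real (card (coset_boundary G (Gs j) S D))"
  have cg: "coset_graph G (Gs j) S"
    by (intro coset_graph.intro coset_graph_axioms.intro is_group sub fin S)
  have "card (J.bdry D T) \<le> M * card (coset_boundary G (Gs j) S D)"
    unfolding J.bdry_def W(3) M_def
    by (rule coset_graph.bd_words[OF cg cX _ W(2,1)]) (simp add: S_def)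
  then have bT: "real (card (J.bdry D T)) \<le> real M * ?d"
    by (simp only: of_nat_mult[symmetric] of_nat_le_iff)
  \<comment> \<open>Per coset, boundary and reserve cost at most \<open>b / 32\<close> and the lifts
    at most \<open>27 / 32 * b\<close>, which together stay below the guaranteed
    \<open>b\<close>.\<close>
  have num: "real (card X + length (xs i)) * real (card (J.bdry D T)) +
      ?e i * (3 * ?N j / (4 * real (card Y))) + 2 \<le> ?e j"
  proof -
    have "real (card X + length (xs i)) * real (card (J.bdry D T)) \<le> real (card X + length (xs i)) * (real M * ?d)"
      using bT by (intro mult_left_mono) auto
    moreover have "2 \<le> 2 * ?d" using bd(1) by simp
    ultimately have "real (card X + length (xs i)) * real (card (J.bdry D T)) + 2 \<le> ?q * ?d"
      by (simp add: algebra_simps)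
    also have "\<dots> \<le> ?q * (b / (32 * ?q) * ?N j)" using bd(2) q by (intro mult_left_mono) auto
    also have "\<dots> = b * ?N j / 32"
    proof -
      have "r * (b / (32 * r) * n) = b * n / 32" if "0 < r" for r n :: real using that by (simp add: field_simps)
      from this[OF q] show ?thesis .
    qed
    finally have 1: "real (card X + length (xs i)) * real (card (J.bdry D T)) + 2 \<le> b * ?N j / 32" .
    have "?e i * (3 * ?N j / (4 * ?N i)) \<le> (9 / 8 * b * ?N i) * (3 * ?N j / (4 * ?N i))"
      using hi by (intro mult_right_mono) auto
    also have "\<dots> = 27 / 32 * b * ?N j" using N0[of i] by (simp add: field_simps)
    finally have 2: "?e i * (3 * ?N j / (4 * real (card Y))) \<le> 27 / 32 * b * ?N j" unfolding cY .
    have "0 \<le> b * ?N j" using b0 by simp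
    with 1 2 low[of j] show ?thesis by linarith
  qed
  have le: "Gs l \<subseteq> Gs k" if "k \<le> l" for k l
    using that
  proof (induction rule: dec_induct)
    case (step l)
    have "Gs (Suc l) \<subseteq> Gs l" using subgroup.subset[OF normal_imp_subgroup[OF nor]] by simp
    then show ?case using step.IH by (rule subset_trans)
  qed simp
  \<comment> \<open>The elements of \<open>xs i\<close> detect all homomorphisms from
    \<open>Gs i\<close>. Down the chain, the subgroup they generate detects homomorphisms from
    \<open>Gs j\<close> through its intersection with \<open>Gs j\<close>.\<close>
  have det: "\<alpha> = (\<lambda>x. 0)"
    if a: "\<alpha> \<in> homs p J.HG" and v: "\<And>u. u \<in> generate G (set (xs i)) \<inter> Gs j \<Longrightarrow> \<alpha> u = 0" for \<alpha>
  proof (rule homs_vanish_chain[OF p sub nor ind _ _ less_imp_le[OF ij] a v])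
    show "subgroup (generate G (set (xs i))) G" by (rule generate_is_subgroup) (use xsG in blast)
    fix \<chi> assume chi: "\<chi> \<in> homs p (G\<lparr>carrier := Gs i\<rparr>)"
      and 0: "\<And>u. u \<in> generate G (set (xs i)) \<inter> Gs i \<Longrightarrow> \<chi> u = 0"
    show "\<chi> = (\<lambda>x. 0)"
    proof (rule sep[OF chi])
      fix x assume x: "x \<in> set (xs i)"
      then show "\<chi> x = 0" using xs(1)[of i] by (intro 0 IntI generate.incl) blast+
    qed
  qed
  have T': "J.relator_differences \<subseteq> T" "Y \<subseteq> T" unfolding T_def by blast+
  have Tk: "?ev (take k (w x)) \<in> T" if "x \<in> set (xs i)" "k \<le> length (w x)" for x k
    unfolding T_def using that by blast
  have Y0: "0 < card Y" unfolding cY by (rule N0)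
  note fq = J.free_quotients_of_almost_invariant[OF p X(1) fin sub[of i] le[OF less_imp_le[OF ij]] xs(1)[of i]
      w(1)[OF xsG] w(2)[OF xsG] TG T' Tk Y0 Ysep det D xs(2)[of j] num]
  obtain N where N: "N \<lhd> J.HG" "\<exists>k. card (rcosets\<^bsub>J.HG\<^esub> N) = p ^ k" "onto_nonabelian_free (J.HG\<lparr>carrier := N\<rparr>)"
    using fq(2) by blast
  have "finite (rcosets\<^bsub>J.HG\<^esub> N)"
    using N(2) p0 by (intro card_ge_0_finite) (elim exE, simp)
  from finite_rcosets_trans[OF sub fin normal_imp_subgroup[OF N(1)] this]
  have "large G" unfolding large_def using N(3) by auto
  moreover have "\<exists>N. N \<lhd> J.HG \<and> (\<exists>k. card (rcosets\<^bsub>J.HG\<^esub> N) = p ^ k) \<and> onto_nonabelian_free (G\<lparr>carrier := N\<rparr>)"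
    using N by auto
  ultimately show "(\<exists>i. epi (G\<lparr>carrier := Gs i\<rparr>)
                 (free_product (integer_mod_group p) (integer_mod_group p)) \<noteq> {} \<and>
               (\<exists>N. N \<lhd> G\<lparr>carrier := Gs i\<rparr> \<and>
                    (\<exists>k. card (rcosets\<^bsub>G\<lparr>carrier := Gs i\<rparr>\<^esub> N) = p ^ k) \<and>
                    onto_nonabelian_free (G\<lparr>carrier := N\<rparr>)))
          \<and> large G" using fq(1) by blast
qed

end
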